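(* There are $c_{size},c_{con}=O(1/\sigma^2)$ and an algorithm that, given a graph $G=(V,E)$, a set $A\subset V$, an overlapping parameter $\sigma$ and a conductance parameter $\alpha\in[0,1]$ such that (i) $2\mathrm{vol}(A)\le \mathrm{vol}(V\setminus A)$ and (ii) $\sigma\in[\frac{2\mathrm{vol}(A)}{\mathrm{vol}(V\setminus A)},1]$, runs in time $\tilde O\big(\frac{\mathrm{vol}(A)}{\alpha\sigma^2}\big)$ and either (Case 1) outputs a set $S\subset V$ with $\mathrm{vol}(S)\le\mathrm{vol}(V\setminus S)$, $\phi(S)<\alpha$ and $c_{size}\cdot \mathrm{vol}(S)\ge \mathrm{OPT}(G,\alpha/c_{con},A,\sigma)$, or (Case 2) reports that $\mathrm{OPT}(G,\alpha/c_{con},A,\sigma)=0$, i.e., that there is no $(\alpha/c_{con})$-sparse $(A,\sigma)$-overlapping cut. That is, on such inputs it is an $(O(1/\sigma^2),O(1/\sigma^2))$-approximate locally balanced sparse cut algorithm.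
   Context: For a graph $G=(V,E)$ and $S\subseteq V$: $\mathrm{vol}(S)=\sum_{v\in S}\deg(v)$, $\delta(S)$ is the number of edges crossing $S$, and the conductance is $\phi(S)=\delta(S)/\min\{\mathrm{vol}(S),\mathrm{vol}(V\setminus S)\}$. A cut $S$ is $\alpha$-sparse if $\phi(S)<\alpha$. For $A\subset V$ and $0\le\sigma\le1$, $S$ is $(A,\sigma)$-overlapping if $\mathrm{vol}(S\cap A)/\mathrm{vol}(S)\ge\sigma$. $\mathrm{OPT}(G,\alpha,A,\sigma)$ is the largest value of $\mathrm{vol}(S^* )$ over sets $S^*$ that are $\alpha$-sparse, $(A,\sigma)$-overlapping and satisfy $\mathrm{vol}(S^* )\le\mathrm{vol}(V\setminus S^* )$, and is $0$ if no such set exists. A $(c_{size},c_{con})$-approximate LBS (locally balanced sparse) cut algorithm, given $(G,A,\sigma,\alpha)$, either outputs $S$ with $\mathrm{vol}(S)\le\mathrm{vol}(V\setminus S)$, $\phi(S)<\alpha$ and $c_{size}\mathrm{vol}(S)\ge\mathrm{OPT}(G,\alpha/c_{con},A,\sigma)$, or reports $\mathrm{OPT}(G,\alpha/c_{con},A,\sigma)=0$. $\tilde O$ hides polylogarithmic factors in the graph size. The graph is given as a pointer to an adjacency list (local access).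
   Formalization: In the running time, vol(A) is replaced by max{1, |A|, vol(A)}, which differs only if A is empty or contains isolated vertices (where reading A alone can exceed the stated bound); σ = 0, where 1/σ² is undefined, is excluded. *)

theory Defs
  imports Complex_Main
begin

section \<open>Cuts, conductance and OPT\<close>

definition simple_graph :: "'a set \<Rightarrow> 'a set set \<Rightarrow> bool" where
  "simple_graph V E \<longleftrightarrow> finite V \<and> (\<forall>e\<in>E. \<exists>u\<in>V. \<exists>v\<in>V. u \<noteq> v \<and> e = {u, v})"

definition deg :: "'a set set \<Rightarrow> 'a \<Rightarrow> nat" where
  "deg E v = card {e \<in> E. v \<in> e}"

definition vol :: "'a set set \<Rightarrow> 'a set \<Rightarrow> nat" where
  "vol E S = (\<Sum>v\<in>S. deg E v)"

definition crossing :: "'a set \<Rightarrow> 'a set set \<Rightarrow> 'a set \<Rightarrow> nat" where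
  "crossing V E S = card {e \<in> E. e \<inter> S \<noteq> {} \<and> e \<inter> (V - S) \<noteq> {}}"

definition conductance :: "'a set \<Rightarrow> 'a set set \<Rightarrow> 'a set \<Rightarrow> real" where
  "conductance V E S = real (crossing V E S) / real (min (vol E S) (vol E (V - S)))"

text \<open>The conductance is undefined when one side of the cut has volume 0; such a set is not
  a sparse cut. (Without the positivity condition the convention \<open>x / 0 = 0\<close> would
  make the empty set sparse.)\<close>

definition sparse_cut :: "'a set \<Rightarrow> 'a set set \<Rightarrow> real \<Rightarrow> 'a set \<Rightarrow> bool" where
  "sparse_cut V E \<alpha> S \<longleftrightarrow>
     S \<subseteq> V \<and> 0 < min (vol E S) (vol E (V - S)) \<and> conductance V E S < \<alpha>"

definition overlapping :: "'a set set \<Rightarrow> 'a set \<Rightarrow> real \<Rightarrow> 'a set \<Rightarrow> bool" where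
  "overlapping E A \<sigma> S \<longleftrightarrow> real (vol E (S \<inter> A)) / real (vol E S) \<ge> \<sigma>"

definition opt_candidates ::
  "'a set \<Rightarrow> 'a set set \<Rightarrow> real \<Rightarrow> 'a set \<Rightarrow> real \<Rightarrow> 'a set set" where
  "opt_candidates V E \<alpha> A \<sigma> =
     {S. sparse_cut V E \<alpha> S \<and> overlapping E A \<sigma> S \<and> vol E S \<le> vol E (V - S)}"

definition OPT :: "'a set \<Rightarrow> 'a set set \<Rightarrow> real \<Rightarrow> 'a set \<Rightarrow> real \<Rightarrow> nat" where
  "OPT V E \<alpha> A \<sigma> =
     (if opt_candidates V E \<alpha> A \<sigma> = {} then 0
      else Max (vol E ` opt_candidates V E \<alpha> A \<sigma>))"

text \<open>Admissible answers of a \<open>(c_size, c_con)\<close>-approximate locally balanced sparse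
  cut algorithm; \<open>None\<close> is the report that OPT is 0.\<close>

definition lbs_answer ::
  "real \<Rightarrow> real \<Rightarrow> 'a set \<Rightarrow> 'a set set \<Rightarrow> 'a set \<Rightarrow> real \<Rightarrow> real \<Rightarrow> 'a set option \<Rightarrow> bool" where
  "lbs_answer c_size c_con V E A \<sigma> \<alpha> r =
     (case r of
        Some S \<Rightarrow> sparse_cut V E \<alpha> S \<and> vol E S \<le> vol E (V - S)
                  \<and> c_size * real (vol E S) \<ge> real (OPT V E (\<alpha> / c_con) A \<sigma>)
      | None \<Rightarrow> OPT V E (\<alpha> / c_con) A \<sigma> = 0)"


section \<open>A word RAM with local access to a graph\<close>

text \<open>
  Algorithms are structured programs for a word RAM: finitely many registers, a random access
  memory that is initially zero outside the input, and unit-cost arithmetic on words. A value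
  \<open>\<ge> W\<close> cannot be stored (execution gets stuck), so words have \<open>log W\<close> bits.

  The graph is not copied into the memory: it is accessed by degree queries and by queries for
  the \<open>i\<close>-th entry of the adjacency list of a vertex, each in constant time.

  The real parameters \<open>\<alpha>\<close> and \<open>\<sigma>\<close> can only be accessed by the comparisons
  \<open>a < \<alpha> * b\<close> and \<open>a < \<sigma> * b\<close> for integers \<open>a\<close>, \<open>b\<close>. A real RAM performs them
  in constant time, and so does a plain word RAM if the parameters are given as quotients
  of words; no further arithmetic on reals is available.
\<close>

datatype aexp =
    Const nat
  | Reg nat
  | Load aexp
  | Degree aexp
  | Neighbour aexp aexp
  | Plus aexp aexp
  | Minus aexp aexp
  | Times aexp aexp
  | Quot aexp aexp

datatype bexp =
    Less aexp aexp
  | Less_alpha aexp aexp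
  | Less_sigma aexp aexp
  | Neg bexp
  | Conj bexp bexp

datatype com =
    Skip
  | Assign nat aexp
  | Store aexp aexp
  | Seq com com
  | Cond bexp com com
  | While bexp com

record graph_access =
  adj :: "nat \<Rightarrow> nat list"
  alpha :: real
  sigma :: real

record state =
  reg :: "nat \<Rightarrow> nat"
  mem :: "nat \<Rightarrow> nat"

fun aval :: "graph_access \<Rightarrow> aexp \<Rightarrow> state \<Rightarrow> nat" where
  "aval G (Const c) s = c"
| "aval G (Reg x) s = reg s x"
| "aval G (Load a) s = mem s (aval G a s)"
| "aval G (Degree a) s = length (adj G (aval G a s))"
| "aval G (Neighbour a b) s =
     (let L = adj G (aval G a s); i = aval G b s in if i < length L then L ! i else 0)"
| "aval G (Plus a b) s = aval G a s + aval G b s"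
| "aval G (Minus a b) s = aval G a s - aval G b s"
| "aval G (Times a b) s = aval G a s * aval G b s"
| "aval G (Quot a b) s = aval G a s div aval G b s"

fun bval :: "graph_access \<Rightarrow> bexp \<Rightarrow> state \<Rightarrow> bool" where
  "bval G (Less a b) s \<longleftrightarrow> aval G a s < aval G b s"
| "bval G (Less_alpha a b) s \<longleftrightarrow> real (aval G a s) < alpha G * real (aval G b s)"
| "bval G (Less_sigma a b) s \<longleftrightarrow> real (aval G a s) < sigma G * real (aval G b s)"
| "bval G (Neg b) s \<longleftrightarrow> \<not> bval G b s"
| "bval G (Conj b c) s \<longleftrightarrow> bval G b s \<and> bval G c s"

text \<open>\<open>exec W G c s t s'\<close>: started in \<open>s\<close>, the program \<open>c\<close> halts in \<open>s'\<close> after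
  \<open>t\<close> steps without exceeding the word bound \<open>W\<close>. Evaluating the expressions of a command
  counts as one step; as the size of the expressions is fixed by the program, this changes
  running times, and the lengths of intermediate values, by a constant factor only.\<close>

inductive exec :: "nat \<Rightarrow> graph_access \<Rightarrow> com \<Rightarrow> state \<Rightarrow> nat \<Rightarrow> state \<Rightarrow> bool"
  for W :: nat and G :: graph_access where
  Skip: "exec W G Skip s 1 s"
| Assign: "aval G a s < W \<Longrightarrow>
    exec W G (Assign x a) s 1 (s\<lparr>reg := (reg s)(x := aval G a s)\<rparr>)"
| Store: "aval G a s < W \<Longrightarrow> aval G b s < W \<Longrightarrow>
    exec W G (Store a b) s 1 (s\<lparr>mem := (mem s)(aval G a s := aval G b s)\<rparr>)"
| Seq: "exec W G c1 s t1 s1 \<Longrightarrow> exec W G c2 s1 t2 s2 \<Longrightarrow>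
    exec W G (Seq c1 c2) s (t1 + t2) s2"
| IfTrue: "bval G b s \<Longrightarrow> exec W G c1 s t s1 \<Longrightarrow> exec W G (Cond b c1 c2) s (1 + t) s1"
| IfFalse: "\<not> bval G b s \<Longrightarrow> exec W G c2 s t s1 \<Longrightarrow> exec W G (Cond b c1 c2) s (1 + t) s1"
| WhileFalse: "\<not> bval G b s \<Longrightarrow> exec W G (While b c) s 1 s"
| WhileTrue: "bval G b s \<Longrightarrow> exec W G c s t1 s1 \<Longrightarrow> exec W G (While b c) s1 t2 s2 \<Longrightarrow>
    exec W G (While b c) s (1 + t1 + t2) s2"

text \<open>Programs are deterministic, so a statement about some terminating execution is a
  statement about the execution.\<close>

inductive_cases exec_SkipE: "exec W G Skip s t s'"
inductive_cases exec_AssignE: "exec W G (Assign x a) s t s'"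
inductive_cases exec_StoreE: "exec W G (Store a b) s t s'"
inductive_cases exec_SeqE: "exec W G (Seq c1 c2) s t s'"
inductive_cases exec_CondE: "exec W G (Cond b c1 c2) s t s'"
inductive_cases exec_WhileE: "exec W G (While b c) s t s'"

lemma exec_deterministic:
  "exec W G c s t s' \<Longrightarrow> exec W G c s u s'' \<Longrightarrow> t = u \<and> s' = s''"
proof (induction arbitrary: u s'' rule: exec.induct)
  case (Skip s)
  from Skip.prems show ?case by (rule exec_SkipE) simp
next
  case (Assign a s x)
  from Assign.prems show ?case by (rule exec_AssignE) simp
next
  case (Store a s b)
  from Store.prems show ?case by (rule exec_StoreE) simp
next
  case (Seq c1 s t1 s1 c2 t2 s2)
  from Seq.prems show ?case by (rule exec_SeqE) (use Seq.IH in metis)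
next
  case (IfTrue b s c1 t s1 c2)
  from IfTrue.prems show ?case by (rule exec_CondE) (use IfTrue.IH IfTrue.hyps in \<open>metis plus_1_eq_Suc add_Suc\<close>)+
next
  case (IfFalse b s c2 t s1 c1)
  from IfFalse.prems show ?case by (rule exec_CondE) (use IfFalse.IH IfFalse.hyps in \<open>metis plus_1_eq_Suc add_Suc\<close>)+
next
  case (WhileFalse b s c)
  from WhileFalse.prems show ?case by (rule exec_WhileE) (use WhileFalse.hyps in simp_all)
next
  case (WhileTrue b s c t1 s1 t2 s2)
  from WhileTrue.prems show ?case by (rule exec_WhileE) (use WhileTrue.IH WhileTrue.hyps in \<open>metis plus_1_eq_Suc add_Suc\<close>)+
qed

text \<open>The vertices are \<open>0, \<dots>, n - 1\<close>; the order within an adjacency list is arbitrary.\<close>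

definition adjacency_lists :: "nat \<Rightarrow> nat set set \<Rightarrow> (nat \<Rightarrow> nat list) \<Rightarrow> bool" where
  "adjacency_lists n E L \<longleftrightarrow>
     (\<forall>v<n. distinct (L v) \<and> set (L v) = {u. {u, v} \<in> E}) \<and> (\<forall>v\<ge>n. L v = [])"

text \<open>Input: the number of vertices in register 0, and the set \<open>A\<close> as a list \<open>xs\<close> stored
  in the memory from address 0, with its length in register 1.\<close>

definition input_state :: "nat \<Rightarrow> nat list \<Rightarrow> state" where
  "input_state n xs =
     \<lparr>reg = (\<lambda>_. 0)(0 := n, 1 := length xs),
      mem = (\<lambda>i. if i < length xs then xs ! i else 0)\<rparr>"

text \<open>Output: register 0 is 0 for the report; otherwise the set \<open>S\<close> is the contents of the
  memory block whose address and length are in registers 1 and 2.\<close>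

definition result :: "state \<Rightarrow> nat set option" where
  "result s = (if reg s 0 = 0 then None
               else Some ((\<lambda>i. mem s (reg s 1 + i)) ` {..<reg s 2}))"

end

theory Submission
  imports Defs
begin

text \<open>
  Every vertex \<open>v\<close> of \<open>A\<close> emits \<open>M deg(v)\<close> tokens, where \<open>4/\<sigma> + 1 \<le> M \<le> 4/\<sigma> + 2\<close>, every vertex
  can absorb \<open>4 deg(v)\<close> tokens, and every edge carries a net flow of at most \<open>4 M s\<close> with
  \<open>s \<approx> 1/\<alpha>\<close>. The tokens are routed one at a time by push-relabel with heights at most
  \<open>h = O(log n / \<alpha>)\<close>; a token that reaches height \<open>h\<close> is parked. Vertices of positive height
  have absorbed \<open>4 deg(v)\<close> tokens, so their volume is at most \<open>M vol(A) / 4\<close>, and this bounds the work.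

  If \<open>S\<close> is overlapping, its sources emit at least \<open>(4 + \<sigma>) vol(S)\<close> tokens and it absorbs at most
  \<open>4 vol(S)\<close>; if moreover its conductance is below \<open>\<alpha> \<sigma>\<^sup>2 / 96\<close>, at most \<open>\<sigma>/2 vol(S)\<close> can leave, so
  \<open>\<sigma>/2 vol(S)\<close> of them are parked. Hence no such \<open>S\<close> exists if no token is parked.

  If a token is parked, consider the sets \<open>{v. i \<le> height v}\<close> for \<open>1 \<le> i \<le> h\<close>. Unsaturated edges
  leave such a set only from height exactly \<open>i\<close>. If there were many of them at every level,
  the volume would decay geometrically in \<open>i\<close> and vanish before level \<open>h\<close>; so some level is
  \<open>\<alpha>\<close>-sparse. It contains all parked tokens, hence its volume is at least of order \<open>\<sigma>\<^sup>2\<close> times that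
  of any competitor, and the upper bound on \<open>M\<close> together with the hypothesis on \<open>\<sigma>\<close> makes it
  the smaller side.
\<close>

section \<open>Running loop-free code and loops\<close>

text \<open>The values of \<open>run\<close> and \<open>steps\<close> on a loop are junk; \<open>safe\<close> excludes loops.\<close>

fun run :: "graph_access \<Rightarrow> com \<Rightarrow> state \<Rightarrow> state" where
  "run G Skip s = s"
| "run G (Assign x a) s = s\<lparr>reg := (reg s)(x := aval G a s)\<rparr>"
| "run G (Store a b) s = s\<lparr>mem := (mem s)(aval G a s := aval G b s)\<rparr>"
| "run G (Seq c1 c2) s = run G c2 (run G c1 s)"
| "run G (Cond b c1 c2) s = (if bval G b s then run G c1 s else run G c2 s)"
| "run G (While b c) s = s"

fun safe :: "nat \<Rightarrow> graph_access \<Rightarrow> com \<Rightarrow> state \<Rightarrow> bool" where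
  "safe W G Skip s \<longleftrightarrow> True"
| "safe W G (Assign x a) s \<longleftrightarrow> aval G a s < W"
| "safe W G (Store a b) s \<longleftrightarrow> aval G a s < W \<and> aval G b s < W"
| "safe W G (Seq c1 c2) s \<longleftrightarrow> safe W G c1 s \<and> safe W G c2 (run G c1 s)"
| "safe W G (Cond b c1 c2) s \<longleftrightarrow> (if bval G b s then safe W G c1 s else safe W G c2 s)"
| "safe W G (While b c) s \<longleftrightarrow> False"

fun steps :: "com \<Rightarrow> nat" where
  "steps Skip = 1"
| "steps (Assign x a) = 1"
| "steps (Store a b) = 1"
| "steps (Seq c1 c2) = steps c1 + steps c2"
| "steps (Cond b c1 c2) = 1 + max (steps c1) (steps c2)"
| "steps (While b c) = 1"

definition halts :: "nat \<Rightarrow> graph_access \<Rightarrow> com \<Rightarrow> state \<Rightarrow> nat \<Rightarrow> (state \<Rightarrow> bool) \<Rightarrow> bool" where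
  "halts W G c s T Q \<longleftrightarrow> (\<exists>t s'. exec W G c s t s' \<and> t \<le> T \<and> Q s')"

lemma safe_exec: "safe W G c s \<Longrightarrow> \<exists>t\<le>steps c. exec W G c s t (run G c s)"
proof (induction c arbitrary: s)
  case (Seq c1 c2)
  then obtain t1 t2 where "t1 \<le> steps c1" "exec W G c1 s t1 (run G c1 s)"
    "t2 \<le> steps c2" "exec W G c2 (run G c1 s) t2 (run G c2 (run G c1 s))"
    by fastforce
  then show ?case
    by (auto intro!: exI[of _ "t1 + t2"] exec.Seq)
next
  case (Cond b c1 c2)
  show ?case
  proof (cases "bval G b s")
    case True
    with Cond obtain t where "t \<le> steps c1" "exec W G c1 s t (run G c1 s)" by fastforce
    with True show ?thesis by (auto intro!: exI[of _ "1 + t"] exec.IfTrue)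
  next
    case False
    with Cond obtain t where "t \<le> steps c2" "exec W G c2 s t (run G c2 s)" by fastforce
    with False show ?thesis using exec.IfFalse[of G b s W c2 t] by (auto intro!: exI[of _ "1 + t"])
  qed
qed (auto simp del: One_nat_def intro: exec.intros)

lemma halts_safe: "safe W G c s \<Longrightarrow> Q (run G c s) \<Longrightarrow> halts W G c s (steps c) Q"
  using safe_exec unfolding halts_def by blast

lemma halts_Seq:
  assumes "halts W G c1 s T1 Q" "\<And>s'. Q s' \<Longrightarrow> halts W G c2 s' T2 R"
  shows "halts W G (Seq c1 c2) s (T1 + T2) R"
proof -
  obtain t1 s1 where 1: "exec W G c1 s t1 s1" "t1 \<le> T1" "Q s1"
    using assms(1) unfolding halts_def by blast
  obtain t2 s2 where 2: "exec W G c2 s1 t2 s2" "t2 \<le> T2" "R s2"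
    using assms(2)[OF 1(3)] unfolding halts_def by blast
  show ?thesis unfolding halts_def
    using exec.Seq[OF 1(1) 2(1)] 1 2 by (intro exI[of _ "t1 + t2"] exI[of _ s2]) auto
qed

lemma halts_Cond:
  assumes "bval G b s \<Longrightarrow> halts W G c1 s T Q" "\<not> bval G b s \<Longrightarrow> halts W G c2 s T Q"
  shows "halts W G (Cond b c1 c2) s (1 + T) Q"
proof (cases "bval G b s")
  case True
  then obtain t s1 where 1: "exec W G c1 s t s1" "t \<le> T" "Q s1"
    using assms(1) unfolding halts_def by blast
  show ?thesis unfolding halts_def using exec.IfTrue[OF True 1(1)] 1
    by (intro exI[of _ "1 + t"] exI[of _ s1]) auto
next
  case False
  then obtain t s1 where 1: "exec W G c2 s t s1" "t \<le> T" "Q s1"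
    using assms(2) unfolding halts_def by blast
  show ?thesis unfolding halts_def using exec.IfFalse[OF False 1(1)] 1
    by (intro exI[of _ "1 + t"] exI[of _ s1]) auto
qed

lemma halts_mono: "halts W G c s T Q \<Longrightarrow> T \<le> T' \<Longrightarrow> (\<And>s. Q s \<Longrightarrow> R s) \<Longrightarrow> halts W G c s T' R"
  unfolding halts_def by (meson le_trans)

text \<open>The second argument of the invariant measures progress. An increasing quantity is used
  because the work is bounded in terms of the visited part of the graph only, which is
  not known in advance.\<close>

lemma halts_While:
  fixes I :: "state \<Rightarrow> int \<Rightarrow> bool" and B k :: int
  assumes step: "\<And>s k. I s k \<Longrightarrow> bval G b s \<Longrightarrow> safe W G c s \<and> (\<exists>k'>k. I (run G c s) k')"
    and bound: "\<And>s k. I s k \<Longrightarrow> k \<le> B"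
    and init: "I s k"
  shows "halts W G (While b c) s (1 + (1 + steps c) * nat (B - k))
           (\<lambda>s'. (\<exists>k'. I s' k') \<and> \<not> bval G b s')"
  using init
proof (induction "nat (B - k)" arbitrary: s k rule: less_induct)
  case less
  show ?case
  proof (cases "bval G b s")
    case False
    show ?thesis unfolding halts_def
      using False less.prems by (intro exI[of _ 1] exI[of _ s]) (auto simp del: One_nat_def intro: exec.WhileFalse)
  next
    case True
    obtain k' where k': "safe W G c s" "k' > k" "I (run G c s) k'"
      using step[OF less.prems True] by blast
    have le: "k' \<le> B" using bound k'(3) by blast
    have lt: "nat (B - k') < nat (B - k)" using k'(2) le by linarith
    obtain t1 where t1: "t1 \<le> steps c" "exec W G c s t1 (run G c s)"
      using safe_exec[OF k'(1)] by blast
    obtain t2 s2 where t2: "exec W G (While b c) (run G c s) t2 s2"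
      "t2 \<le> 1 + (1 + steps c) * nat (B - k')" "\<exists>k. I s2 k" "\<not> bval G b s2"
      using less.hyps[OF lt k'(3)] unfolding halts_def by blast
    have "1 + t1 + t2 \<le> 1 + (1 + steps c) * (1 + nat (B - k'))"
      using t1 t2 by (simp add: algebra_simps)
    also have "\<dots> \<le> 1 + (1 + steps c) * nat (B - k)"
      using lt by (intro add_left_mono mult_left_mono) auto
    finally show ?thesis unfolding halts_def
      using exec.WhileTrue[OF True t1(2) t2(1)] t2 by blast
  qed
qed

section \<open>Local push-relabel with single tokens\<close>

record flow_state =
  ht :: "nat \<Rightarrow> nat"
  ptr :: "nat \<Rightarrow> nat"
  held :: "nat \<Rightarrow> nat"
  sent :: "nat \<Rightarrow> nat \<Rightarrow> nat"
  touched :: "nat list"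
  idx :: nat
  tok :: nat
  pos :: nat
  parked :: nat

text \<open>Tokens emitted by the \<open>idx\<close>-th source are processed one after the other, so at any time there
  is a single moving token, at \<open>pos\<close>; \<open>tok\<close> counts the completed tokens of that source.\<close>

locale local_flow =
  fixes n M U h :: nat and L :: "nat \<Rightarrow> nat list" and xs :: "nat list"
  assumes distinct_L: "v < n \<Longrightarrow> distinct (L v)"
    and L_less: "v < n \<Longrightarrow> w \<in> set (L v) \<Longrightarrow> w < n"
    and L_sym: "v < n \<Longrightarrow> w \<in> set (L v) \<Longrightarrow> v \<in> set (L w)"
    and L_irrefl: "v < n \<Longrightarrow> v \<notin> set (L v)"
    and distinct_xs: "distinct xs"
    and xs_less: "v \<in> set xs \<Longrightarrow> v < n"
    and h_pos: "0 < h"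
begin

definition dg :: "nat \<Rightarrow> nat" where
  "dg v = length (L v)"

definition residual :: "flow_state \<Rightarrow> nat \<Rightarrow> nat \<Rightarrow> bool" where
  "residual a v w \<longleftrightarrow> sent a v w < U + sent a w v"

definition net :: "flow_state \<Rightarrow> nat \<Rightarrow> nat \<Rightarrow> int" where
  "net a v w = int (sent a v w) - int (sent a w v)"

definition injected :: "flow_state \<Rightarrow> nat \<Rightarrow> nat" where
  "injected a v = (if v \<in> set (take (idx a) xs) then M * dg v
     else if idx a < length xs \<and> v = xs ! idx a then tok a else 0)"

text \<open>The moving token has left its source but is not held anywhere: \<open>transit\<close> is the
  resulting correction in the conservation law.\<close>

definition transit :: "flow_state \<Rightarrow> nat \<Rightarrow> int" where
  "transit a v = (if idx a < length xs then of_bool (v = xs ! idx a) - of_bool (v = pos a) else 0)"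

definition routed :: "flow_state \<Rightarrow> nat" where
  "routed a = (\<Sum>i<idx a. M * dg (xs ! i)) + (if idx a < length xs then tok a else 0)"

text \<open>A push lowers the token, a relabelling raises it by one; the weight \<open>h + 1\<close> of a
  completed token pays for placing the next one.\<close>

definition progress :: "flow_state \<Rightarrow> int" where
  "progress a = 2 * int (\<Sum>v<n. ht a v * (dg v + 1) + ptr a v)
     + int ((h + 1) * (routed a + idx a))
     - (if idx a < length xs then int (ht a (pos a)) else 0)"

definition token_inv :: "flow_state \<Rightarrow> bool" where
  "token_inv a \<longleftrightarrow> idx a \<le> length xs \<and>
     (idx a < length xs \<longrightarrow> pos a < n \<and> tok a \<le> M * dg (xs ! idx a) \<and>
        (tok a = M * dg (xs ! idx a) \<longrightarrow> pos a = xs ! idx a) \<and>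
        (tok a < M * dg (xs ! idx a) \<longrightarrow> 0 < dg (pos a)))"

definition label_inv :: "flow_state \<Rightarrow> bool" where
  "label_inv a \<longleftrightarrow>
     (\<forall>v<n. ht a v \<le> h \<and> ptr a v \<le> dg v \<and>
        (0 < ht a v \<or> 0 < ptr a v \<longrightarrow> 0 < dg v \<and> 4 * dg v \<le> held a v) \<and>
        (4 * dg v < held a v \<longrightarrow> ht a v = h)) \<and>
     (parked a = 0 \<longrightarrow> (\<forall>v<n. held a v \<le> 4 * dg v)) \<and>
     (parked a \<noteq> 0 \<longrightarrow> (\<exists>v<n. ht a v = h)) \<and>
     (\<forall>v<n. \<forall>w\<in>set (L v). residual a v w \<longrightarrow> ht a v \<le> ht a w + 1) \<and>
     (\<forall>v<n. \<forall>q<ptr a v. residual a v (L v ! q) \<longrightarrow> ht a v \<le> ht a (L v ! q)) \<and>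
     distinct (touched a) \<and> set (touched a) = {v. v < n \<and> 0 < ht a v}"

definition flow_inv :: "flow_state \<Rightarrow> bool" where
  "flow_inv a \<longleftrightarrow>
     (\<forall>v<n. \<forall>w<n. sent a v w \<le> U + sent a w v \<and> int (sent a v w) \<le> progress a \<and>
        (w \<notin> set (L v) \<longrightarrow> sent a v w = 0)) \<and>
     (\<forall>v<n. int (held a v) + (\<Sum>w<n. net a v w) = int (injected a v) + transit a v)"

definition good :: "flow_state \<Rightarrow> bool" where
  "good a \<longleftrightarrow> token_inv a \<and> label_inv a \<and> flow_inv a"

definition deliver :: "flow_state \<Rightarrow> flow_state" where
  "deliver a = a\<lparr>held := (held a)(pos a := held a (pos a) + 1), tok := tok a + 1,
     pos := xs ! idx a, parked := (if held a (pos a) < 4 * dg (pos a) then parked a else 1)\<rparr>"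

definition push :: "flow_state \<Rightarrow> nat \<Rightarrow> flow_state" where
  "push a w = a\<lparr>sent := (sent a)(pos a := (sent a (pos a))(w := sent a (pos a) w + 1)), pos := w\<rparr>"

definition advance :: "flow_state \<Rightarrow> flow_state" where
  "advance a = a\<lparr>ptr := (ptr a)(pos a := ptr a (pos a) + 1)\<rparr>"

definition relabel :: "flow_state \<Rightarrow> flow_state" where
  "relabel a = a\<lparr>ht := (ht a)(pos a := ht a (pos a) + 1), ptr := (ptr a)(pos a := 0),
     touched := (if ht a (pos a) = 0 then touched a @ [pos a] else touched a)\<rparr>"

definition next_source :: "flow_state \<Rightarrow> flow_state" where
  "next_source a = a\<lparr>idx := idx a + 1, tok := 0,
     pos := (if idx a + 1 < length xs then xs ! (idx a + 1) else 0)\<rparr>"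

definition move :: "flow_state \<Rightarrow> flow_state" where
  "move a =
     (if tok a < M * dg (xs ! idx a) then
        if held a (pos a) < 4 * dg (pos a) \<or> h \<le> ht a (pos a) then deliver a
        else if ptr a (pos a) < dg (pos a) then
          let w = L (pos a) ! ptr a (pos a) in
            if ht a w < ht a (pos a) \<and> residual a (pos a) w then push a w else advance a
        else relabel a
      else next_source a)"

definition start :: flow_state where
  "start = \<lparr>ht = (\<lambda>_. 0), ptr = (\<lambda>_. 0), held = (\<lambda>_. 0), sent = (\<lambda>_ _. 0), touched = [],
     idx = 0, tok = 0, pos = (if xs = [] then 0 else xs ! 0), parked = 0\<rparr>"

lemma label_invD:
  assumes "label_inv a"
  shows "v < n \<Longrightarrow> ht a v \<le> h" "v < n \<Longrightarrow> ptr a v \<le> dg v"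
    "v < n \<Longrightarrow> 0 < ht a v \<or> 0 < ptr a v \<Longrightarrow> 0 < dg v \<and> 4 * dg v \<le> held a v"
    "v < n \<Longrightarrow> 4 * dg v < held a v \<Longrightarrow> ht a v = h"
    "parked a = 0 \<Longrightarrow> v < n \<Longrightarrow> held a v \<le> 4 * dg v"
    "parked a \<noteq> 0 \<Longrightarrow> \<exists>v<n. ht a v = h"
    "v < n \<Longrightarrow> w \<in> set (L v) \<Longrightarrow> residual a v w \<Longrightarrow> ht a v \<le> ht a w + 1"
    "v < n \<Longrightarrow> q < ptr a v \<Longrightarrow> residual a v (L v ! q) \<Longrightarrow> ht a v \<le> ht a (L v ! q)"
    "distinct (touched a)" "set (touched a) = {v. v < n \<and> 0 < ht a v}"
  using assms unfolding label_inv_def by auto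

lemma label_invI:
  assumes "\<And>v. v < n \<Longrightarrow> ht a v \<le> h" "\<And>v. v < n \<Longrightarrow> ptr a v \<le> dg v"
    "\<And>v. v < n \<Longrightarrow> 0 < ht a v \<or> 0 < ptr a v \<Longrightarrow> 0 < dg v \<and> 4 * dg v \<le> held a v"
    "\<And>v. v < n \<Longrightarrow> 4 * dg v < held a v \<Longrightarrow> ht a v = h"
    "\<And>v. parked a = 0 \<Longrightarrow> v < n \<Longrightarrow> held a v \<le> 4 * dg v"
    "parked a \<noteq> 0 \<Longrightarrow> \<exists>v<n. ht a v = h"
    "\<And>v w. v < n \<Longrightarrow> w \<in> set (L v) \<Longrightarrow> residual a v w \<Longrightarrow> ht a v \<le> ht a w + 1"
    "\<And>v q. v < n \<Longrightarrow> q < ptr a v \<Longrightarrow> residual a v (L v ! q) \<Longrightarrow> ht a v \<le> ht a (L v ! q)"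
    "distinct (touched a)" "set (touched a) = {v. v < n \<and> 0 < ht a v}"
  shows "label_inv a"
  using assms unfolding label_inv_def by simp

lemma sum_upd:
  fixes f :: "nat \<Rightarrow> int"
  assumes "v < n" "\<And>u. u < n \<Longrightarrow> f u = g u + (if u = v then c else 0)"
  shows "(\<Sum>u<n. f u) = (\<Sum>u<n. g u) + c"
proof -
  have "(\<Sum>u<n. f u) = (\<Sum>u<n. g u + (if u = v then c else 0))"
    using assms(2) by (intro sum.cong) auto
  also have "\<dots> = (\<Sum>u<n. g u) + c" using assms(1) by (simp add: sum.distrib)
  finally show ?thesis .
qed

lemma work_upd:
  assumes "v < n" and "\<And>u. u \<noteq> v \<Longrightarrow> ht b u = ht a u \<and> ptr b u = ptr a u"
    and "ht b v * (dg v + 1) + ptr b v = ht a v * (dg v + 1) + ptr a v + 1"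
  shows "int (\<Sum>u<n. ht b u * (dg u + 1) + ptr b u) = int (\<Sum>u<n. ht a u * (dg u + 1) + ptr a u) + 1"
  unfolding of_nat_sum
  by (rule sum_upd[OF assms(1)]) (use assms in \<open>auto simp flip: of_nat_add of_nat_mult\<close>)

lemma good_start: "good start" "progress start = 0"
proof -
  show p: "progress start = 0" by (simp add: progress_def start_def routed_def)
  have "xs = [] \<or> xs ! 0 < n" using xs_less[of "xs ! 0"] by (cases xs) auto
  then have "token_inv start"
    by (auto simp: token_inv_def start_def)
  moreover have "label_inv start" using h_pos by (auto simp: label_inv_def start_def)
  moreover have "flow_inv start"
    using p by (auto simp: flow_inv_def start_def net_def injected_def transit_def)
  ultimately show "good start" by (simp add: good_def)
qed

context
  fixes a :: flow_state
  assumes inv_a: "good a" and busy: "idx a < length xs"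
begin

lemma tokD: "pos a < n" "tok a \<le> M * dg (xs ! idx a)"
    "tok a = M * dg (xs ! idx a) \<Longrightarrow> pos a = xs ! idx a"
    "tok a < M * dg (xs ! idx a) \<Longrightarrow> 0 < dg (pos a)"
    "xs ! idx a < n"
  using inv_a busy xs_less[of "xs ! idx a"] by (auto simp: good_def token_inv_def)

lemma label_a: "label_inv a" and flow_a: "flow_inv a"
  using inv_a by (auto simp: good_def)

lemma src_notin: "xs ! idx a \<notin> set (take (idx a) xs)"
  using distinct_xs busy by (auto simp: in_set_conv_nth nth_eq_iff_index_eq)

lemma good_deliver:
  assumes t: "tok a < M * dg (xs ! idx a)"
    and full: "held a (pos a) < 4 * dg (pos a) \<or> h \<le> ht a (pos a)"
  shows "good (deliver a)" "progress a < progress (deliver a)"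
proof -
  have hle: "ht a v \<le> h" if "v < n" for v using label_a that by (auto simp: label_inv_def)
  have "progress (deliver a) = progress a + int (h + 1) + int (ht a (pos a)) - int (ht a (xs ! idx a))"
    using busy by (simp add: progress_def deliver_def routed_def algebra_simps)
  with hle[OF tokD(5)] show p: "progress a < progress (deliver a)" by simp
  have d: "0 < dg (xs ! idx a)" using t by (cases "dg (xs ! idx a)") auto
  have "token_inv (deliver a)"
    using tokD t busy d by (auto simp: token_inv_def deliver_def)
  moreover have "label_inv (deliver a)"
  proof (rule label_invI)
    have res: "residual (deliver a) = residual a"
      by (simp add: residual_def deliver_def fun_eq_iff)
    fix v assume v: "v < n"
    show "0 < ht (deliver a) v \<or> 0 < ptr (deliver a) v \<Longrightarrow>
        0 < dg v \<and> 4 * dg v \<le> held (deliver a) v"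
      using label_invD(3)[OF label_a v] by (auto simp: deliver_def)
    show "4 * dg v < held (deliver a) v \<Longrightarrow> ht (deliver a) v = h"
      using label_invD(4)[OF label_a v] full hle[OF v] by (auto simp: deliver_def split: if_splits)
    show "parked (deliver a) = 0 \<Longrightarrow> held (deliver a) v \<le> 4 * dg v"
      using label_invD(5)[OF label_a _ v] by (auto simp: deliver_def split: if_splits)
    show "w \<in> set (L v) \<Longrightarrow> residual (deliver a) v w \<Longrightarrow> ht (deliver a) v \<le> ht (deliver a) w + 1" for w
      using label_invD(7)[OF label_a v, of w] unfolding res by (simp add: deliver_def)
    show "q < ptr (deliver a) v \<Longrightarrow> residual (deliver a) v (L v ! q) \<Longrightarrow>
        ht (deliver a) v \<le> ht (deliver a) (L v ! q)" for q
      using label_invD(8)[OF label_a v, of q] unfolding res by (simp add: deliver_def)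
  next
    show "parked (deliver a) \<noteq> 0 \<Longrightarrow> \<exists>v<n. ht (deliver a) v = h"
      using label_invD(6)[OF label_a] full hle[OF tokD(1)] tokD(1)
      by (auto simp: deliver_def split: if_splits intro: le_antisym)
  qed (use label_invD[OF label_a] in \<open>auto simp: deliver_def\<close>)
  moreover have "flow_inv (deliver a)"
    unfolding flow_inv_def
  proof (intro conjI allI impI)
    fix v w assume vw: "v < n" "w < n"
    show "sent (deliver a) v w \<le> U + sent (deliver a) w v"
      "w \<notin> set (L v) \<Longrightarrow> sent (deliver a) v w = 0"
      using flow_a vw by (auto simp: flow_inv_def deliver_def)
    show "int (sent (deliver a) v w) \<le> progress (deliver a)"
      using flow_a vw p by (force simp: flow_inv_def deliver_def)
  next
    fix v assume v: "v < n"
    have "int (held a v) + (\<Sum>w<n. net a v w) = int (injected a v) + transit a v"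
      using flow_a v by (auto simp: flow_inv_def)
    then show "int (held (deliver a) v) + (\<Sum>w<n. net (deliver a) v w)
        = int (injected (deliver a) v) + transit (deliver a) v"
      using busy src_notin by (auto simp: deliver_def net_def injected_def transit_def)
  qed
  ultimately show "good (deliver a)" by (simp add: good_def)
qed

lemma good_push:
  assumes t: "tok a < M * dg (xs ! idx a)"
    and w: "w \<in> set (L (pos a))" "ht a w < ht a (pos a)" "residual a (pos a) w"
  shows "good (push a w)" "progress a < progress (push a w)"
proof -
  have "progress (push a w) = progress a + int (ht a (pos a)) - int (ht a w)"
    using busy by (simp add: progress_def push_def routed_def)
  with w show p: "progress a < progress (push a w)" by simp
  have wn: "w < n" and wsym: "pos a \<in> set (L w)" and wne: "w \<noteq> pos a"
    using L_less[OF tokD(1)] L_sym[OF tokD(1)] L_irrefl[OF tokD(1)] w by auto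
  have dw: "0 < dg w" using wsym by (cases "L w") (auto simp: dg_def)
  have "token_inv (push a w)"
    using tokD t busy wn dw by (auto simp: token_inv_def push_def)
  moreover have res: "residual (push a w) u v \<Longrightarrow> residual a u v \<or> (u = w \<and> v = pos a)" for u v
    using wne by (auto simp: residual_def push_def split: if_splits)
  have "label_inv (push a w)"
  proof (rule label_invI)
    fix u v assume u: "u < n"
    show "v \<in> set (L u) \<Longrightarrow> residual (push a w) u v \<Longrightarrow> ht (push a w) u \<le> ht (push a w) v + 1"
      using label_invD(7)[OF label_a u, of v] res[of u v] w(2) by (auto simp: push_def)
    show "v < ptr (push a w) u \<Longrightarrow> residual (push a w) u (L u ! v) \<Longrightarrow>
        ht (push a w) u \<le> ht (push a w) (L u ! v)"
      using label_invD(8)[OF label_a u, of v] res[of u "L u ! v"] w(2) by (auto simp: push_def)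
  qed (use label_invD[OF label_a] in \<open>auto simp: push_def\<close>)
  moreover have "flow_inv (push a w)"
    unfolding flow_inv_def
  proof (intro conjI allI impI)
    fix u v assume uv: "u < n" "v < n"
    show "sent (push a w) u v \<le> U + sent (push a w) v u"
      using flow_a uv w(3) wne
      by (auto simp: flow_inv_def push_def residual_def intro: le_SucI)
    show "v \<notin> set (L u) \<Longrightarrow> sent (push a w) u v = 0"
      using flow_a uv w by (auto simp: flow_inv_def push_def)
    show "int (sent (push a w) u v) \<le> progress (push a w)"
      using flow_a uv p by (force simp: flow_inv_def push_def)
  next
    fix v assume v: "v < n"
    have old: "int (held a v) + (\<Sum>w<n. net a v w) = int (injected a v) + transit a v"
      using flow_a v by (auto simp: flow_inv_def)
    have "(\<Sum>u<n. net (push a w) v u) = (\<Sum>u<n. net a v u) + of_bool (v = pos a) - of_bool (v = w)"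
    proof -
      consider "v = pos a" | "v = w" | "v \<noteq> pos a" "v \<noteq> w" by blast
      then show ?thesis
      proof cases
        case 1
        then show ?thesis using wne
          by (subst sum_upd[OF wn, of "net (push a w) v" "net a v" 1])
            (auto simp: net_def push_def)
      next
        case 2
        then show ?thesis using wne
          by (subst sum_upd[OF tokD(1), of "net (push a w) v" "net a v" "- 1"])
            (auto simp: net_def push_def)
      next
        case 3
        then show ?thesis by (auto simp: net_def push_def intro!: sum.cong)
      qed
    qed
    with old show "int (held (push a w) v) + (\<Sum>u<n. net (push a w) v u)
        = int (injected (push a w) v) + transit (push a w) v"
      using busy wne by (auto simp: push_def injected_def transit_def)
  qed
  ultimately show "good (push a w)" by (simp add: good_def)
qed

lemma good_advance:
  assumes t: "tok a < M * dg (xs ! idx a)"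
    and full: "4 * dg (pos a) \<le> held a (pos a)" and q: "ptr a (pos a) < dg (pos a)"
    and stuck: "\<not> (ht a (L (pos a) ! ptr a (pos a)) < ht a (pos a)
          \<and> residual a (pos a) (L (pos a) ! ptr a (pos a)))"
  shows "good (advance a)" "progress a < progress (advance a)"
proof -
  have "int (\<Sum>u<n. ht (advance a) u * (dg u + 1) + ptr (advance a) u)
      = int (\<Sum>u<n. ht a u * (dg u + 1) + ptr a u) + 1"
    by (rule work_upd[OF tokD(1)]) (auto simp: advance_def)
  then have pe: "progress (advance a) = progress a + 2"
    unfolding progress_def by (simp add: advance_def routed_def del: of_nat_sum)
  then show "progress a < progress (advance a)" by simp
  have "token_inv (advance a)"
    using tokD t busy by (auto simp: token_inv_def advance_def)
  moreover have "label_inv (advance a)"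
    using label_a full q stuck unfolding label_inv_def
    by (auto simp: advance_def residual_def less_Suc_eq)
  moreover have "int (sent a v w) \<le> progress (advance a)" if "v < n" "w < n" for v w
    using flow_a pe that by (force simp: flow_inv_def)
  then have "flow_inv (advance a)"
    using flow_a unfolding flow_inv_def
    by (auto simp: advance_def net_def injected_def transit_def)
  ultimately show "good (advance a)" by (simp add: good_def)
qed

lemma good_relabel:
  assumes t: "tok a < M * dg (xs ! idx a)"
    and full: "4 * dg (pos a) \<le> held a (pos a)" and q: "\<not> ptr a (pos a) < dg (pos a)"
    and low: "ht a (pos a) < h"
  shows "good (relabel a)" "progress a < progress (relabel a)"
proof -
  have ptr: "ptr a (pos a) = dg (pos a)" using q label_invD(2)[OF label_a tokD(1)] by simp
  have "int (\<Sum>u<n. ht (relabel a) u * (dg u + 1) + ptr (relabel a) u)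
      = int (\<Sum>u<n. ht a u * (dg u + 1) + ptr a u) + 1"
    by (rule work_upd[OF tokD(1)]) (auto simp: relabel_def ptr)
  then have pe: "progress (relabel a) = progress a + 1"
    unfolding progress_def using busy by (simp add: relabel_def routed_def del: of_nat_sum)
  then show "progress a < progress (relabel a)" by simp
  have "token_inv (relabel a)"
    using tokD t busy by (auto simp: token_inv_def relabel_def)
  moreover have "label_inv (relabel a)"
  proof -
    have res: "residual (relabel a) = residual a" by (auto simp: residual_def relabel_def fun_eq_iff)
    have up: "ht a (pos a) \<le> ht a w" if w: "w \<in> set (L (pos a))" "residual a (pos a) w" for w
    proof -
      obtain q where "q < ptr a (pos a)" "w = L (pos a) ! q"
        using w(1) ptr by (auto simp: in_set_conv_nth dg_def)
      with label_a w(2) tokD(1) show ?thesis by (auto simp: label_inv_def)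
    qed
    have tl: "set (touched (relabel a)) = {v. v < n \<and> 0 < ht (relabel a) v}"
      "distinct (touched (relabel a))"
      using label_a tokD(1) by (auto simp: label_inv_def relabel_def)
    show ?thesis
    proof (rule label_invI)
      fix v assume v: "v < n"
      show "ht (relabel a) v \<le> h"
        using label_invD(1)[OF label_a v] low by (auto simp: relabel_def)
      show "ptr (relabel a) v \<le> dg v"
        using label_invD(2)[OF label_a v] by (auto simp: relabel_def)
      show "0 < ht (relabel a) v \<or> 0 < ptr (relabel a) v \<Longrightarrow> 0 < dg v \<and> 4 * dg v \<le> held (relabel a) v"
        using label_invD(3)[OF label_a v] full tokD t by (auto simp: relabel_def split: if_splits)
      show "4 * dg v < held (relabel a) v \<Longrightarrow> ht (relabel a) v = h"
        using label_invD(4)[OF label_a v] low by (auto simp: relabel_def)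
      show "w \<in> set (L v) \<Longrightarrow> residual (relabel a) v w \<Longrightarrow> ht (relabel a) v \<le> ht (relabel a) w + 1" for w
        using label_invD(7)[OF label_a v, of w] up[of w] unfolding res by (auto simp: relabel_def)
      show "q < ptr (relabel a) v \<Longrightarrow> residual (relabel a) v (L v ! q) \<Longrightarrow>
          ht (relabel a) v \<le> ht (relabel a) (L v ! q)" for q
        using label_invD(8)[OF label_a v, of q] unfolding res
        by (auto simp: relabel_def split: if_splits)
    next
      show "parked (relabel a) \<noteq> 0 \<Longrightarrow> \<exists>v<n. ht (relabel a) v = h"
        using label_invD(6)[OF label_a] low by (force simp: relabel_def)
    qed (use label_invD[OF label_a] tl in \<open>auto simp: relabel_def\<close>)
  qed
  moreover have "int (sent a v w) \<le> progress (relabel a)" if "v < n" "w < n" for v w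
    using flow_a pe that by (force simp: flow_inv_def)
  then have "flow_inv (relabel a)"
    using flow_a unfolding flow_inv_def
    by (auto simp: relabel_def net_def injected_def transit_def)
  ultimately show "good (relabel a)" by (simp add: good_def)
qed

lemma good_next_source:
  assumes t: "\<not> tok a < M * dg (xs ! idx a)"
  shows "good (next_source a)" "progress a < progress (next_source a)"
proof -
  have hle: "ht a v \<le> h" if "v < n" for v using label_a that by (auto simp: label_inv_def)
  have tok: "tok a = M * dg (xs ! idx a)" and pos: "pos a = xs ! idx a" using t tokD by auto
  have nxt: "idx a + 1 < length xs \<Longrightarrow> xs ! (idx a + 1) < n" using xs_less nth_mem by blast
  have rt: "routed (next_source a) = routed a"
    using busy tok by (simp add: routed_def next_source_def)
  have "progress (next_source a) = progress a + int (h + 1) + int (ht a (pos a))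
      - (if idx a + 1 < length xs then int (ht a (xs ! (idx a + 1))) else 0)"
    using busy unfolding progress_def rt by (simp add: next_source_def algebra_simps)
  moreover have "idx a + 1 < length xs \<Longrightarrow> ht a (xs ! (idx a + 1)) \<le> h" using nxt hle by blast
  ultimately show p: "progress a < progress (next_source a)" by (simp split: if_splits)
  have "token_inv (next_source a)"
    using busy nxt by (auto simp: token_inv_def next_source_def)
  moreover have "label_inv (next_source a)"
    using label_a unfolding label_inv_def by (auto simp: next_source_def residual_def)
  moreover have "flow_inv (next_source a)"
    unfolding flow_inv_def
  proof (intro conjI allI impI)
    fix v w assume vw: "v < n" "w < n"
    show "sent (next_source a) v w \<le> U + sent (next_source a) w v"
      "w \<notin> set (L v) \<Longrightarrow> sent (next_source a) v w = 0"
      using flow_a vw by (auto simp: flow_inv_def next_source_def)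
    show "int (sent (next_source a) v w) \<le> progress (next_source a)"
      using flow_a vw p by (force simp: flow_inv_def next_source_def)
  next
    fix v assume v: "v < n"
    have "int (held a v) + (\<Sum>w<n. net a v w) = int (injected a v) + transit a v"
      using flow_a v by (auto simp: flow_inv_def)
    moreover have "injected (next_source a) v = injected a v"
      using busy tok src_notin by (auto simp: injected_def next_source_def take_Suc_conv_app_nth)
    moreover have "transit (next_source a) v = transit a v"
      using busy pos by (auto simp: transit_def next_source_def)
    ultimately show "int (held (next_source a) v) + (\<Sum>w<n. net (next_source a) v w)
        = int (injected (next_source a) v) + transit (next_source a) v"
      by (simp add: next_source_def net_def)
  qed
  ultimately show "good (next_source a)" by (simp add: good_def)
qed

lemma good_move: "good (move a)" "progress a < progress (move a)"
proof -
  have "L (pos a) ! ptr a (pos a) \<in> set (L (pos a))" if "ptr a (pos a) < dg (pos a)"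
    using that by (simp add: dg_def)
  then show "good (move a)" "progress a < progress (move a)"
    using good_deliver good_push good_advance good_relabel good_next_source
    unfolding move_def Let_def by (auto simp: not_le not_less)
qed

end

end

section \<open>Level cuts of a finished flow\<close>

lemma decay_half:
  fixes m :: nat
  assumes "0 < m"
  shows "(1 - 1 / real m) ^ m \<le> 1 / 2"
proof -
  have "(1 - 1 / real m) ^ m \<le> exp (- 1 / real m) ^ m"
    using assms exp_ge_add_one_self[of "- 1 / real m"] by (intro power_mono) (auto simp: field_simps)
  also have "\<dots> = exp (- 1)" using assms by (simp flip: exp_of_nat_mult)
  also have "\<dots> \<le> 1 / 2" using exp_ge_add_one_self[of 1] by (simp add: exp_minus field_simps)
  finally show ?thesis .
qed

lemma slow_level:
  fixes a :: "nat \<Rightarrow> nat"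
  assumes m: "0 < m" and first: "a 1 < 2 ^ k" and last: "0 < a (m * k + 1)"
  shows "\<exists>i\<in>{1..m * k}. m * (a i - a (i + 1)) \<le> a i"
proof (rule ccontr)
  assume "\<not> ?thesis"
  then have less: "a i < m * (a i - a (i + 1))" if "1 \<le> i" "i \<le> m * k" for i
    using that by (auto simp: not_le)
  have shrink: "real (a (j + 1)) \<le> (1 - 1 / real m) ^ j * real (a 1)" if "j \<le> m * k" for j
    using that
  proof (induction j)
    case (Suc j)
    have l: "a (j + 1) < m * (a (j + 1) - a (j + 2))" using less[of "j + 1"] Suc.prems by simp
    then have "a (j + 2) < a (j + 1)" by (cases "a (j + 2) < a (j + 1)") auto
    then have "real (a (j + 1)) < real m * (real (a (j + 1)) - real (a (j + 2)))"
      using l by (metis of_nat_diff of_nat_less_iff of_nat_mult less_imp_le)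
    then have "real (a (j + 2)) \<le> (1 - 1 / real m) * real (a (j + 1))"
      using m by (simp add: field_simps)
    also have "\<dots> \<le> (1 - 1 / real m) * ((1 - 1 / real m) ^ j * real (a 1))"
      using Suc m by (intro mult_left_mono) auto
    finally show ?case by (simp add: mult.assoc)
  qed simp
  have "(1 - 1 / real m) ^ (m * k) = ((1 - 1 / real m) ^ m) ^ k" by (simp add: power_mult)
  also have "\<dots> \<le> (1 / 2) ^ k" using decay_half[OF m] m by (intro power_mono) auto
  finally have "real (a (m * k + 1)) \<le> (1 / 2) ^ k * real (a 1)"
    using shrink[of "m * k"] by (meson le_refl mult_right_mono of_nat_0_le_iff order_trans)
  also have "\<dots> < 1"
  proof -
    have "real (a 1) < 2 ^ k" using first by (metis of_nat_less_iff of_nat_numeral of_nat_power)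
    then show ?thesis by (simp add: power_divide)
  qed
  finally show False using last by simp
qed

context local_flow
begin

definition weight :: "nat set \<Rightarrow> nat" where
  "weight S = (\<Sum>v\<in>S. dg v)"

definition boundary :: "nat set \<Rightarrow> nat" where
  "boundary S = (\<Sum>v\<in>S. card (set (L v) - S))"

definition excess :: "flow_state \<Rightarrow> nat" where
  "excess a = (\<Sum>v<n. held a v - 4 * dg v)"

definition above :: "flow_state \<Rightarrow> nat \<Rightarrow> nat set" where
  "above a i = {v. v < n \<and> i \<le> ht a v}"

lemma sum_antisym:
  fixes f :: "nat \<Rightarrow> nat \<Rightarrow> int"
  assumes "\<And>u w. f u w = - f w u"
  shows "(\<Sum>u\<in>S. \<Sum>w\<in>S. f u w) = 0"
proof -
  have "(\<Sum>u\<in>S. \<Sum>w\<in>S. f u w) = (\<Sum>u\<in>S. \<Sum>w\<in>S. f w u)" by (rule sum.swap)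
  also have "\<dots> = (\<Sum>u\<in>S. \<Sum>w\<in>S. - f u w)" by (intro sum.cong refl assms)
  also have "\<dots> = - (\<Sum>u\<in>S. \<Sum>w\<in>S. f u w)" by (simp add: sum_negf)
  finally show ?thesis by simp
qed

lemma L_subset: "v < n \<Longrightarrow> set (L v) \<subseteq> {..<n}"
  using L_less by auto

lemma card_L: "v < n \<Longrightarrow> card (set (L v)) = dg v"
  using distinct_L by (simp add: dg_def distinct_card)

lemma weight_sources: "(\<Sum>i<length xs. dg (xs ! i)) = weight (set xs)"
  unfolding weight_def
  by (rule sum.reindex_bij_betw) (use distinct_xs in \<open>simp add: bij_betw_nth\<close>)

context
  fixes a :: flow_state
  assumes good_a: "good a"
begin

lemma net_eq_0: "v < n \<Longrightarrow> w < n \<Longrightarrow> w \<notin> set (L v) \<Longrightarrow> net a v w = 0"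
  using good_a L_sym[of w v] by (auto simp: good_def flow_inv_def net_def)

lemma net_bounds: "v < n \<Longrightarrow> w < n \<Longrightarrow> - int U \<le> net a v w \<and> net a v w \<le> int U"
  using good_a by (force simp: good_def flow_inv_def net_def)

lemma injected_le: "injected a v \<le> (if v \<in> set xs then M * dg v else 0)"
proof -
  have "set (take (idx a) xs) \<subseteq> set xs" by (rule set_take_subset)
  then show ?thesis using good_a by (auto simp: good_def token_inv_def injected_def)
qed

lemma outflow:
  assumes S: "S \<subseteq> {..<n}" and u: "u \<in> S"
  shows "(\<Sum>w\<in>{..<n} - S. net a u w) = (\<Sum>w\<in>set (L u) - S. net a u w)"
  using S u L_subset[of u] net_eq_0 by (intro sum.mono_neutral_right) auto

lemma conservation:
  assumes S: "S \<subseteq> {..<n}"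
  shows "(\<Sum>v\<in>S. int (held a v)) + (\<Sum>u\<in>S. \<Sum>w\<in>set (L u) - S. net a u w)
    = (\<Sum>v\<in>S. int (injected a v)) + (\<Sum>v\<in>S. transit a v)"
proof -
  have split: "(\<Sum>w<n. net a u w) = (\<Sum>w\<in>S. net a u w) + (\<Sum>w\<in>set (L u) - S. net a u w)"
    if "u \<in> S" for u
    using sum.subset_diff[OF S, of "net a u"] outflow[OF S that] by simp
  have "(\<Sum>v\<in>S. int (held a v) + (\<Sum>w<n. net a v w)) = (\<Sum>v\<in>S. int (injected a v) + transit a v)"
    using good_a S by (intro sum.cong) (auto simp: good_def flow_inv_def)
  moreover have "(\<Sum>u\<in>S. \<Sum>w\<in>S. net a u w) = 0"
    by (rule sum_antisym) (simp add: net_def)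
  ultimately show ?thesis by (simp add: sum.distrib split)
qed

lemma held_total: "(\<Sum>v<n. held a v) \<le> M * weight (set xs)"
proof -
  have empty: "set (L u) - {..<n} = {}" if "u < n" for u using L_subset[OF that] by auto
  have "(\<Sum>v<n. int (held a v)) = (\<Sum>v<n. int (injected a v)) + (\<Sum>v<n. transit a v)"
    using conservation[of "{..<n}"] empty by simp
  moreover have "(\<Sum>v<n. transit a v) = 0"
  proof (cases "idx a < length xs")
    case True
    then have "xs ! idx a < n" "pos a < n"
      using good_a xs_less[of "xs ! idx a"] by (auto simp: good_def token_inv_def)
    with True show ?thesis by (simp add: transit_def sum_subtractf of_bool_def)
  qed (simp add: transit_def)
  ultimately have "(\<Sum>v<n. held a v) = (\<Sum>v<n. injected a v)"
    by (simp flip: of_nat_sum)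
  also have "\<dots> \<le> (\<Sum>v<n. if v \<in> set xs then M * dg v else 0)"
    by (intro sum_mono injected_le)
  also have "\<dots> = (\<Sum>v\<in>set xs. M * dg v)"
    using xs_less by (subst sum.inter_restrict[symmetric]) (auto intro!: sum.cong)
  finally show ?thesis by (simp add: weight_def sum_distrib_left)
qed

lemma routed_le: "routed a \<le> M * weight (set xs)"
proof -
  have i: "idx a \<le> length xs" "idx a < length xs \<Longrightarrow> tok a \<le> M * dg (xs ! idx a)"
    using good_a by (auto simp: good_def token_inv_def)
  have "routed a \<le> (\<Sum>i<length xs. M * dg (xs ! i))"
  proof (cases "idx a < length xs")
    case True
    then have "routed a \<le> (\<Sum>i<Suc (idx a). M * dg (xs ! i))" using i by (simp add: routed_def)
    also have "\<dots> \<le> (\<Sum>i<length xs. M * dg (xs ! i))"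
      using True by (intro sum_mono2) auto
    finally show ?thesis .
  next
    case False
    then show ?thesis using i by (simp add: routed_def)
  qed
  then show ?thesis by (simp add: weight_sources flip: sum_distrib_left)
qed

lemma progress_le:
  "progress a \<le> int ((6 * h + 4) * (M * weight (set xs)) + (h + 1) * length xs)"
proof -
  have lab: "label_inv a" using good_a by (simp add: good_def)
  have "(\<Sum>v<n. ht a v * (dg v + 1) + ptr a v) \<le> (\<Sum>v<n. (2 * h + 1) * held a v)"
  proof (rule sum_mono)
    fix v assume "v \<in> {..<n}"
    then have v: "v < n" by simp
    show "ht a v * (dg v + 1) + ptr a v \<le> (2 * h + 1) * held a v"
    proof (cases "0 < ht a v \<or> 0 < ptr a v")
      case True
      have d: "0 < dg v" "4 * dg v \<le> held a v" using label_invD(3)[OF lab v True] by auto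
      have "ht a v * (dg v + 1) + ptr a v \<le> h * (dg v + dg v) + dg v"
        using label_invD(1,2)[OF lab v] d by (intro add_mono mult_mono) auto
      also have "\<dots> = (2 * h + 1) * dg v" by (simp add: algebra_simps)
      also have "\<dots> \<le> (2 * h + 1) * held a v" using d by (intro mult_left_mono) auto
      finally show ?thesis .
    qed simp
  qed
  also have "\<dots> = (2 * h + 1) * (\<Sum>v<n. held a v)" by (simp add: sum_distrib_left)
  also have "\<dots> \<le> (2 * h + 1) * (M * weight (set xs))"
    by (intro mult_left_mono held_total) simp
  finally have 1: "(\<Sum>v<n. ht a v * (dg v + 1) + ptr a v) \<le> (2 * h + 1) * (M * weight (set xs))" .
  have 2: "(h + 1) * (routed a + idx a) \<le> (h + 1) * (M * weight (set xs) + length xs)"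
    using routed_le good_a by (intro mult_left_mono add_mono) (auto simp: good_def token_inv_def)
  have "progress a \<le> int (2 * (\<Sum>v<n. ht a v * (dg v + 1) + ptr a v) + (h + 1) * (routed a + idx a))"
    by (simp add: progress_def)
  also have "\<dots> \<le> int (2 * ((2 * h + 1) * (M * weight (set xs))) + (h + 1) * (M * weight (set xs) + length xs))"
    using mult_left_mono[OF 1, of 2] 2 by (intro of_nat_mono) linarith
  also have "\<dots> \<le> int ((6 * h + 4) * (M * weight (set xs)) + (h + 1) * length xs)"
    by (intro of_nat_mono) (simp add: algebra_simps)
  finally show ?thesis .
qed

lemma outflow_bounds:
  assumes S: "S \<subseteq> {..<n}"
  shows "(\<Sum>u\<in>S. \<Sum>w\<in>set (L u) - S. net a u w) \<le> int (U * boundary S)"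
    and "- int (U * boundary S) \<le> (\<Sum>u\<in>S. \<Sum>w\<in>set (L u) - S. net a u w)"
proof -
  have b: "(\<Sum>w\<in>set (L u) - S. net a u w) \<le> int (U * card (set (L u) - S))"
      "- int (U * card (set (L u) - S)) \<le> (\<Sum>w\<in>set (L u) - S. net a u w)" if u: "u \<in> S" for u
  proof -
    have nb: "w \<in> set (L u) - S \<Longrightarrow> - int U \<le> net a u w \<and> net a u w \<le> int U" for w
      using net_bounds[of u w] L_less[of u w] u S by auto
    show "(\<Sum>w\<in>set (L u) - S. net a u w) \<le> int (U * card (set (L u) - S))"
      using sum_bounded_above[of "set (L u) - S" "net a u" "int U"] nb by (simp add: mult.commute)
    show "- int (U * card (set (L u) - S)) \<le> (\<Sum>w\<in>set (L u) - S. net a u w)"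
      using sum_bounded_below[of "set (L u) - S" "- int U" "net a u"] nb by (simp add: mult.commute)
  qed
  have "(\<Sum>u\<in>S. \<Sum>w\<in>set (L u) - S. net a u w) \<le> (\<Sum>u\<in>S. int (U * card (set (L u) - S)))"
    by (intro sum_mono b)
  then show "(\<Sum>u\<in>S. \<Sum>w\<in>set (L u) - S. net a u w) \<le> int (U * boundary S)"
    by (simp add: boundary_def sum_distrib_left)
  have "(\<Sum>u\<in>S. - int (U * card (set (L u) - S))) \<le> (\<Sum>u\<in>S. \<Sum>w\<in>set (L u) - S. net a u w)"
    by (intro sum_mono b)
  then show "- int (U * boundary S) \<le> (\<Sum>u\<in>S. \<Sum>w\<in>set (L u) - S. net a u w)"
    by (simp add: boundary_def sum_distrib_left sum_negf)
qed

lemma above_small: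
  assumes i: "1 \<le> i"
  shows "4 * weight (above a i) \<le> M * weight (set xs)"
proof -
  have lab: "label_inv a" using good_a by (simp add: good_def)
  have "4 * weight (above a i) \<le> (\<Sum>v\<in>above a i. held a v)"
    unfolding weight_def sum_distrib_left
    using label_invD(3)[OF lab] i by (intro sum_mono) (auto simp: above_def)
  also have "\<dots> \<le> (\<Sum>v<n. held a v)" by (intro sum_mono2) (auto simp: above_def)
  finally show ?thesis using held_total by simp
qed

context
  assumes finished: "idx a = length xs"
begin

lemma final_balance:
  assumes S: "S \<subseteq> {..<n}"
  shows "(\<Sum>v\<in>S. int (held a v)) + (\<Sum>u\<in>S. \<Sum>w\<in>set (L u) - S. net a u w)
    = int (M * weight (S \<inter> set xs))"
proof -
  have "finite S" using S finite_subset by blast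
  moreover have "injected a v = (if v \<in> set xs then M * dg v else 0)" for v
    by (simp add: injected_def finished)
  ultimately have "(\<Sum>v\<in>S. injected a v) = M * weight (S \<inter> set xs)"
    by (simp add: weight_def sum_distrib_left flip: sum.inter_restrict)
  moreover have "(\<Sum>v\<in>S. transit a v) = 0" by (simp add: transit_def finished)
  ultimately show ?thesis using conservation[OF S] by (simp flip: of_nat_sum)
qed

lemma source_le:
  assumes S: "S \<subseteq> {..<n}"
  shows "M * weight (S \<inter> set xs) \<le> 4 * weight S + excess a + U * boundary S"
proof -
  have "(\<Sum>v\<in>S. held a v) \<le> (\<Sum>v\<in>S. 4 * dg v + (held a v - 4 * dg v))"
    by (intro sum_mono) auto
  also have "\<dots> \<le> 4 * weight S + excess a"
    using S by (auto simp: sum.distrib weight_def excess_def sum_distrib_left intro!: sum_mono2)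
  finally have "(\<Sum>v\<in>S. int (held a v)) \<le> int (4 * weight S + excess a)"
    by (metis of_nat_mono of_nat_sum)
  with final_balance[OF S] outflow_bounds(1)[OF S] show ?thesis by linarith
qed

lemma excess_eq_0: "parked a = 0 \<Longrightarrow> excess a = 0"
  using good_a label_invD(5)[of a] by (simp add: good_def excess_def)

lemma excess_le:
  assumes i: "1 \<le> i" "i \<le> h"
  shows "excess a + 4 * weight (above a i) \<le> M * weight (above a i \<inter> set xs) + U * boundary (above a i)"
proof -
  let ?S = "above a i"
  have lab: "label_inv a" using good_a by (simp add: good_def)
  have S: "?S \<subseteq> {..<n}" by (auto simp: above_def)
  have "excess a = (\<Sum>v\<in>?S. held a v - 4 * dg v)"
    unfolding excess_def using label_invD(4)[OF lab] i S
    by (intro sum.mono_neutral_right) (auto simp: above_def not_less intro: leI)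
  also have "\<dots> + 4 * weight ?S = (\<Sum>v\<in>?S. held a v)"
    unfolding weight_def sum_distrib_left sum.distrib[symmetric]
    using label_invD(3)[OF lab] i by (intro sum.cong refl le_add_diff_inverse2) (auto simp: above_def)
  finally have "(\<Sum>v\<in>?S. int (held a v)) = int (excess a + 4 * weight ?S)" by (metis of_nat_sum)
  with final_balance[OF S] outflow_bounds(2)[OF S] show ?thesis by linarith
qed

text \<open>Unsaturated edges leave \<open>above a i\<close> only from the vertices of height exactly \<open>i\<close>.\<close>

lemma boundary_above:
  assumes i: "1 \<le> i"
  shows "U * boundary (above a i)
    \<le> M * weight (above a i) + 2 * U * (weight (above a i) - weight (above a (i + 1)))"
proof -
  let ?S = "above a i" and ?T = "above a (i + 1)"
  have lab: "label_inv a" using good_a by (simp add: good_def)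
  have S: "?S \<subseteq> {..<n}" and fin: "finite ?S" by (auto simp: above_def)
  have each: "int (U * card (set (L u) - ?S))
      \<le> (\<Sum>w\<in>set (L u) - ?S. net a u w) + (if ht a u = i then int (2 * U * dg u) else 0)"
    if u: "u \<in> ?S" for u
  proof -
    have un: "u < n" "i \<le> ht a u" using u by (auto simp: above_def)
    show ?thesis
    proof (cases "ht a u = i")
      case True
      have "- int (U * card (set (L u) - ?S)) \<le> (\<Sum>w\<in>set (L u) - ?S. net a u w)"
        using sum_bounded_below[of "set (L u) - ?S" "- int U" "net a u"] net_bounds L_less un
        by (auto simp: mult.commute)
      moreover have "card (set (L u) - ?S) \<le> dg u"
        using card_L[OF un(1)] by (metis Diff_subset List.finite_set card_mono)
      then have "int (U * card (set (L u) - ?S)) \<le> int (U * dg u)"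
        by (intro of_nat_mono mult_left_mono) auto
      moreover have "int (2 * U * dg u) = 2 * int (U * dg u)" by simp
      ultimately show ?thesis unfolding if_P[OF True] by linarith
    next
      case False
      have "net a u w = int U" if w: "w \<in> set (L u) - ?S" for w
      proof -
        have wn: "w < n" using L_less un w by blast
        then have "\<not> residual a u w"
          using label_invD(7)[OF lab un(1), of w] False un w by (force simp: above_def)
        then show ?thesis using net_bounds[OF un(1) wn] by (auto simp: residual_def net_def)
      qed
      then show ?thesis using False by (simp add: mult.commute)
    qed
  qed
  have eq: "?S - ?T = {v \<in> ?S. ht a v = i}" by (auto simp: above_def)
  have "int (U * boundary ?S) = (\<Sum>u\<in>?S. int (U * card (set (L u) - ?S)))"
    by (simp add: boundary_def sum_distrib_left)
  also have "\<dots> \<le> (\<Sum>u\<in>?S. (\<Sum>w\<in>set (L u) - ?S. net a u w)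
      + (if ht a u = i then int (2 * U * dg u) else 0))"
    by (intro sum_mono each)
  also have "\<dots> = (\<Sum>u\<in>?S. \<Sum>w\<in>set (L u) - ?S. net a u w) + int (2 * U * weight (?S - ?T))"
    unfolding sum.distrib eq weight_def sum.inter_filter[OF fin, symmetric]
    by (simp add: sum_distrib_left)
  also have "weight (?S - ?T) = weight ?S - weight ?T"
    unfolding weight_def using fin by (intro sum_diff_nat) (auto simp: above_def)
  also have "(\<Sum>u\<in>?S. \<Sum>w\<in>set (L u) - ?S. net a u w) \<le> int (M * weight ?S)"
  proof -
    have "weight (?S \<inter> set xs) \<le> weight ?S" unfolding weight_def by (intro sum_mono2) (auto simp: fin)
    then have "int (M * weight (?S \<inter> set xs)) \<le> int (M * weight ?S)"
      by (intro of_nat_mono mult_left_mono) auto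
    with final_balance[OF S] show ?thesis
      by (smt (verit) of_nat_0_le_iff sum_nonneg)
  qed
  finally show ?thesis by (simp flip: of_nat_mult of_nat_add)
qed

lemma sparse_level:
  assumes U: "U = 4 * M * s" and h: "h = 8 * s * k + 1" and pos: "0 < M" "0 < s"
    and k: "weight {..<n} < 2 ^ k" and parked: "parked a \<noteq> 0"
  shows "\<exists>i. 1 \<le> i \<and> i \<le> h \<and> 2 * s * boundary (above a i) \<le> weight (above a i)
    \<and> 0 < weight (above a i)"
proof -
  have lab: "label_inv a" using good_a by (simp add: good_def)
  obtain v where v: "v < n" "ht a v = h" using label_invD(6)[OF lab parked] by auto
  have dv: "0 < dg v" using label_invD(3)[OF lab v(1)] v h_pos by auto
  have posi: "0 < weight (above a i)" if "i \<le> h" for i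
  proof -
    have "v \<in> above a i" using v that by (simp add: above_def)
    then have "dg v \<le> weight (above a i)"
      unfolding weight_def by (intro member_le_sum) (auto simp: above_def)
    with dv show ?thesis by simp
  qed
  have "weight (above a 1) \<le> weight {..<n}"
    unfolding weight_def by (intro sum_mono2) (auto simp: above_def)
  then have "\<exists>i\<in>{1..8 * s * k}. 8 * s * (weight (above a i) - weight (above a (i + 1))) \<le> weight (above a i)"
    using pos k posi[of h] by (intro slow_level) (auto simp: h)
  then obtain i where i: "1 \<le> i" "i \<le> 8 * s * k"
    "8 * s * (weight (above a i) - weight (above a (i + 1))) \<le> weight (above a i)" by auto
  have "M * (4 * s * boundary (above a i))
      \<le> M * (weight (above a i) + 8 * s * (weight (above a i) - weight (above a (i + 1))))"
    using boundary_above[OF i(1)] unfolding U by (simp add: algebra_simps)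
  then have "4 * s * boundary (above a i)
      \<le> weight (above a i) + 8 * s * (weight (above a i) - weight (above a (i + 1)))"
    using pos by simp
  also have "\<dots> \<le> 2 * weight (above a i)" using i(3) by simp
  finally have "2 * s * boundary (above a i) \<le> weight (above a i)" by simp
  then show ?thesis using i posi[of i] h by (intro exI[of _ i]) auto
qed

end

end

end

section \<open>Volumes and cuts from adjacency lists\<close>

context
  fixes n :: nat and E :: "nat set set" and L :: "nat \<Rightarrow> nat list"
  assumes simple: "simple_graph {..<n} E" and adj: "adjacency_lists n E L"
begin

lemma set_adj: "v < n \<Longrightarrow> set (L v) = {u. {u, v} \<in> E}"
  using adj by (auto simp: adjacency_lists_def)

lemma edge_endpoints: "{u, v} \<in> E \<Longrightarrow> u < n \<and> v < n \<and> u \<noteq> v"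
  using simple by (fastforce simp: simple_graph_def doubleton_eq_iff)

lemma edge_cases:
  assumes "e \<in> E" "v \<in> e"
  obtains u where "e = {u, v}"
  using assms simple by (fastforce simp: simple_graph_def)

lemma local_flow_graph:
  assumes "distinct xs" "set xs \<subseteq> {..<n}" "0 < h"
  shows "local_flow n h L xs"
proof
  fix v w assume v: "v < n"
  show "distinct (L v)" using adj v by (simp add: adjacency_lists_def)
  show "v \<notin> set (L v)" using set_adj[OF v] edge_endpoints by blast
  assume w: "w \<in> set (L v)"
  then have e: "{w, v} \<in> E" using set_adj[OF v] by blast
  then show "w < n" using edge_endpoints by blast
  with e show "v \<in> set (L w)" using set_adj[of w] by (simp add: insert_commute)
qed (use assms in auto)

lemma deg_adj: "v < n \<Longrightarrow> deg E v = length (L v)"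
proof -
  assume v: "v < n"
  have "\<exists>u. {u, v} \<in> E \<and> e = {u, v}" if "e \<in> E" "v \<in> e" for e
    using that by (metis edge_cases)
  then have "bij_betw (\<lambda>u. {u, v}) (set (L v)) {e \<in> E. v \<in> e}"
    by (intro bij_betwI') (auto simp: set_adj[OF v] doubleton_eq_iff)
  then have "card (set (L v)) = deg E v" by (simp add: bij_betw_same_card deg_def)
  then show ?thesis using adj v by (metis adjacency_lists_def distinct_card)
qed

lemma crossing_adj:
  assumes S: "S \<subseteq> {..<n}"
  shows "crossing {..<n} E S = (\<Sum>v\<in>S. card (set (L v) - S))"
proof -
  have fin: "finite S" using S finite_subset by blast
  have "bij_betw (\<lambda>(v, w). {v, w}) (SIGMA v:S. set (L v) - S)
      {e \<in> E. e \<inter> S \<noteq> {} \<and> e \<inter> ({..<n} - S) \<noteq> {}}"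
  proof (rule bij_betw_imageI)
    show "inj_on (\<lambda>(v, w). {v, w}) (SIGMA v:S. set (L v) - S)"
      by (auto simp: inj_on_def doubleton_eq_iff)
    show "(\<lambda>(v, w). {v, w}) ` (SIGMA v:S. set (L v) - S)
        = {e \<in> E. e \<inter> S \<noteq> {} \<and> e \<inter> ({..<n} - S) \<noteq> {}}"
    proof (intro equalityI subsetI)
      fix e assume "e \<in> (\<lambda>(v, w). {v, w}) ` (SIGMA v:S. set (L v) - S)"
      then obtain v w where vw: "v \<in> S" "w \<in> set (L v)" "w \<notin> S" "e = {v, w}" by auto
      then have "{v, w} \<in> E" using set_adj[of v] S by (auto simp: insert_commute)
      then show "e \<in> {e \<in> E. e \<inter> S \<noteq> {} \<and> e \<inter> ({..<n} - S) \<noteq> {}}"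
        using vw edge_endpoints by auto
    next
      fix e assume "e \<in> {e \<in> E. e \<inter> S \<noteq> {} \<and> e \<inter> ({..<n} - S) \<noteq> {}}"
      then obtain v w where vw: "e \<in> E" "v \<in> e" "v \<in> S" "w \<in> e" "w \<notin> S" by auto
      then have e: "e = {w, v}" by (metis edge_cases insertE singletonD)
      then have "w \<in> set (L v)" using vw set_adj[of v] S by auto
      then show "e \<in> (\<lambda>(v, w). {v, w}) ` (SIGMA v:S. set (L v) - S)"
        using vw e by (auto intro!: image_eqI[of _ _ "(v, w)"])
    qed
  qed
  then have "crossing {..<n} E S = card (SIGMA v:S. set (L v) - S)"
    by (simp add: bij_betw_same_card crossing_def)
  also have "\<dots> = (\<Sum>v\<in>S. card (set (L v) - S))" using fin by (intro card_SigmaI) auto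
  finally show ?thesis .
qed

end

section \<open>The routing loop as a program\<close>

text \<open>The memory is used as a matrix with rows of length \<open>n + 1\<close>, kept in register 2. Row 0 is
  the input, rows 1 to 3 are \<open>ht\<close>, \<open>ptr\<close> and \<open>held\<close>, row 4 is the list \<open>touched\<close>,
  row 5 receives the output, and row \<open>6 + v\<close> is \<open>sent a v\<close>. Since rows are longer than the
  input, reading one entry past the end of the input yields 0.\<close>

definition addr :: "nat \<Rightarrow> nat \<Rightarrow> nat \<Rightarrow> nat" where
  "addr N r v = r * N + v"

lemma addr_eq_iff:
  assumes "v < N" "v' < N"
  shows "addr N r v = addr N r' v' \<longleftrightarrow> r = r' \<and> v = v'"
proof
  assume eq: "addr N r v = addr N r' v'"
  have "addr N r v div N = r" "addr N r v mod N = v" "addr N r' v' div N = r'" "addr N r' v' mod N = v'"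
    using assms by (auto simp: addr_def)
  with eq show "r = r' \<and> v = v'" by metis
qed simp

definition cell_addr :: "aexp \<Rightarrow> aexp \<Rightarrow> aexp" where
  "cell_addr r v = Plus (Times r (Reg 2)) v"

definition cell :: "nat \<Rightarrow> aexp \<Rightarrow> aexp" where
  "cell r v = Load (cell_addr (Const r) v)"

definition sent_addr :: "aexp \<Rightarrow> aexp \<Rightarrow> aexp" where
  "sent_addr v w = cell_addr (Plus (Const 6) v) w"

lemma aval_cell [simp]:
  "aval G (cell_addr r v) s = addr (reg s 2) (aval G r s) (aval G v s)"
  "aval G (cell q v) s = mem s (addr (reg s 2) q (aval G v s))"
  "aval G (sent_addr v w) s = addr (reg s 2) (6 + aval G v s) (aval G w s)"
  by (simp_all add: cell_addr_def cell_def sent_addr_def addr_def)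

abbreviation incr :: "nat \<Rightarrow> com" where
  "incr x \<equiv> Assign x (Plus (Reg x) (Const 1))"

definition deliver_code :: com where
  "deliver_code =
     Seq (Cond (Less (cell 3 (Reg 11)) (Times (Const 4) (Degree (Reg 11)))) Skip (Assign 13 (Const 1)))
    (Seq (Store (cell_addr (Const 3) (Reg 11)) (Plus (cell 3 (Reg 11)) (Const 1)))
    (Seq (incr 10)
         (Assign 11 (cell 0 (Reg 9)))))"

definition arc_code :: com where
  "arc_code =
     Seq (Assign 15 (Neighbour (Reg 11) (cell 2 (Reg 11))))
         (Cond (Conj (Less (cell 1 (Reg 15)) (cell 1 (Reg 11)))
                     (Less (Load (sent_addr (Reg 11) (Reg 15)))
                           (Plus (Reg 4) (Load (sent_addr (Reg 15) (Reg 11))))))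
            (Seq (Store (sent_addr (Reg 11) (Reg 15))
                        (Plus (Load (sent_addr (Reg 11) (Reg 15))) (Const 1)))
                 (Assign 11 (Reg 15)))
            (Store (cell_addr (Const 2) (Reg 11)) (Plus (cell 2 (Reg 11)) (Const 1))))"

definition relabel_code :: com where
  "relabel_code =
     Seq (Cond (Less (Const 0) (cell 1 (Reg 11))) Skip
            (Seq (Store (cell_addr (Const 4) (Reg 12)) (Reg 11)) (incr 12)))
    (Seq (Store (cell_addr (Const 1) (Reg 11)) (Plus (cell 1 (Reg 11)) (Const 1)))
         (Store (cell_addr (Const 2) (Reg 11)) (Const 0)))"

definition next_source_code :: com where
  "next_source_code = Seq (incr 9) (Seq (Assign 10 (Const 0)) (Assign 11 (cell 0 (Reg 9))))"

definition move_code :: com where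
  "move_code =
     Cond (Less (Reg 10) (Times (Reg 3) (Degree (cell 0 (Reg 9)))))
       (Cond (Conj (Neg (Less (cell 3 (Reg 11)) (Times (Const 4) (Degree (Reg 11)))))
                   (Less (cell 1 (Reg 11)) (Reg 5)))
          (Cond (Less (cell 2 (Reg 11)) (Degree (Reg 11))) arc_code relabel_code)
          deliver_code)
       next_source_code"

locale flow_machine = local_flow +
  fixes W :: nat and G :: graph_access
  assumes adj_G: "adj G = L"
    and W_addr: "(n + 7) * (n + 1) < W"
    and W_h: "h < W"
    and W_progress: "(6 * h + 4) * (M * weight (set xs)) + (h + 1) * length xs < W"
begin

definition refines :: "state \<Rightarrow> flow_state \<Rightarrow> bool" where
  "refines s a \<longleftrightarrow>
     reg s 0 = n \<and> reg s 1 = length xs \<and> reg s 2 = n + 1 \<and> reg s 3 = M \<and> reg s 4 = U \<and>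
     reg s 5 = h \<and> reg s 9 = idx a \<and> reg s 10 = tok a \<and> reg s 11 = pos a \<and>
     reg s 12 = length (touched a) \<and> reg s 13 = parked a \<and>
     (\<forall>v\<le>n. mem s (addr (n + 1) 0 v) = (if v < length xs then xs ! v else 0)) \<and>
     (\<forall>v<n. mem s (addr (n + 1) 1 v) = ht a v) \<and>
     (\<forall>v<n. mem s (addr (n + 1) 2 v) = ptr a v) \<and>
     (\<forall>v<n. mem s (addr (n + 1) 3 v) = held a v) \<and>
     (\<forall>i<length (touched a). mem s (addr (n + 1) 4 i) = touched a ! i) \<and>
     (\<forall>v<n. \<forall>w<n. mem s (addr (n + 1) (6 + v) w) = sent a v w)"

lemma refinesD:
  assumes "refines s a"
  shows "reg s 0 = n" "reg s 1 = length xs" "reg s 2 = n + 1" "reg s 3 = M" "reg s 4 = U"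
    "reg s 5 = h" "reg s 9 = idx a" "reg s 10 = tok a" "reg s 11 = pos a"
    "reg s 12 = length (touched a)" "reg s 13 = parked a"
    "v \<le> n \<Longrightarrow> mem s (addr (n + 1) 0 v) = (if v < length xs then xs ! v else 0)"
    "v < n \<Longrightarrow> mem s (addr (n + 1) 1 v) = ht a v"
    "v < n \<Longrightarrow> mem s (addr (n + 1) 2 v) = ptr a v"
    "v < n \<Longrightarrow> mem s (addr (n + 1) 3 v) = held a v"
    "i < length (touched a) \<Longrightarrow> mem s (addr (n + 1) 4 i) = touched a ! i"
    "v < n \<Longrightarrow> w < n \<Longrightarrow> mem s (addr (n + 1) (6 + v) w) = sent a v w"
  using assms unfolding refines_def by blast+

lemma length_xs: "length xs \<le> n"
proof -
  have "card (set xs) \<le> card {..<n}" using xs_less by (intro card_mono) auto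
  then show ?thesis using distinct_xs by (simp add: distinct_card)
qed

lemma addr_less: "r \<le> n + 6 \<Longrightarrow> v \<le> n \<Longrightarrow> addr (n + 1) r v < W"
proof -
  assume "r \<le> n + 6" "v \<le> n"
  then have "r * (n + 1) + v \<le> (n + 6) * (n + 1) + n" by (intro add_mono mult_right_mono) auto
  with W_addr show ?thesis unfolding addr_def by (simp add: algebra_simps)
qed

lemma n_less: "n < W"
  using W_addr by simp

lemma dg_le: "v < n \<Longrightarrow> dg v \<le> n"
  using card_L[of v] L_subset[of v] by (metis card_lessThan card_mono finite_lessThan)

lemma good_less:
  assumes a: "good a"
  shows "v < n \<Longrightarrow> ht a v < W" "v < n \<Longrightarrow> ptr a v < W" "v < n \<Longrightarrow> held a v < W"
    "v < n \<Longrightarrow> w < n \<Longrightarrow> sent a v w < W" "idx a < length xs \<Longrightarrow> tok a < W"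
    "length (touched a) \<le> n"
proof -
  have lab: "label_inv a" using a by (simp add: good_def)
  have Mw: "M * weight (set xs) < W"
  proof -
    have "1 * (M * weight (set xs)) \<le> (6 * h + 4) * (M * weight (set xs))"
      by (intro mult_right_mono) auto
    with W_progress show ?thesis by linarith
  qed
  show "v < n \<Longrightarrow> ht a v < W" using label_invD(1)[OF lab] W_h by (meson le_less_trans)
  show "v < n \<Longrightarrow> ptr a v < W"
    using label_invD(2)[OF lab] dg_le n_less by (meson le_less_trans order_trans)
  show "held a v < W" if "v < n"
  proof -
    have "held a v \<le> (\<Sum>v<n. held a v)" using that by (intro member_le_sum) auto
    then show ?thesis using held_total[OF a] Mw by linarith
  qed
  show "sent a v w < W" if "v < n" "w < n"
  proof -
    have "int (sent a v w) \<le> progress a" using a that by (auto simp: good_def flow_inv_def)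
    then show ?thesis using progress_le[OF a] W_progress by linarith
  qed
  show "idx a < length xs \<Longrightarrow> tok a < W" using routed_le[OF a] Mw by (simp add: routed_def)
  have "card (set (touched a)) \<le> card {..<n}"
    using label_invD(10)[OF lab] by (intro card_mono) auto
  then show "length (touched a) \<le> n" using label_invD(9)[OF lab] by (simp add: distinct_card)
qed

context
  fixes s :: state and a :: flow_state
  assumes ref: "refines s a" and ga: "good a" and busy: "idx a < length xs"
begin

lemma pos_less: "pos a < n" "xs ! idx a < n" "idx a < n" "idx a \<le> n"
  using tokD[OF ga busy] busy length_xs by auto

lemmas read = refinesD[OF ref]

lemma src_cell: "mem s (addr (n + 1) 0 (idx a)) = xs ! idx a"
  using read(12)[of "idx a"] busy pos_less by simp

lemma deliver_code:
  assumes t: "tok a < M * dg (xs ! idx a)"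
    and full: "held a (pos a) < 4 * dg (pos a) \<or> h \<le> ht a (pos a)"
  shows "safe W G deliver_code s \<and> refines (run G deliver_code s) (deliver a)"
proof -
  note g = good_deliver(1)[OF ga busy t full]
  have "held a (pos a) + 1 < W" "tok a + 1 < W"
    using good_less(3)[OF g pos_less(1)] good_less(5)[OF g] busy by (auto simp: deliver_def)
  moreover have "1 < W" using n_less pos_less by simp
  ultimately show ?thesis
    using pos_less n_less addr_less[of 3 "pos a"] good_less(6)[OF ga] busy ref
    unfolding refines_def
    by (auto simp: deliver_code_def deliver_def adj_G dg_def addr_eq_iff)
qed

lemma next_source_code:
  assumes t: "\<not> tok a < M * dg (xs ! idx a)"
  shows "safe W G next_source_code s \<and> refines (run G next_source_code s) (next_source a)"
proof -
  have "mem s (addr (n + 1) 0 (idx a + 1)) = (if idx a + 1 < length xs then xs ! (idx a + 1) else 0)"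
    using read(12)[of "idx a + 1"] pos_less by simp
  moreover have "idx a + 1 < length xs \<Longrightarrow> xs ! (idx a + 1) < n" using xs_less nth_mem by blast
  ultimately show ?thesis
    using pos_less n_less busy ref
    unfolding refines_def
    by (auto simp: next_source_code_def next_source_def)
qed

lemma relabel_code:
  assumes t: "tok a < M * dg (xs ! idx a)"
    and full: "4 * dg (pos a) \<le> held a (pos a)" and q: "\<not> ptr a (pos a) < dg (pos a)"
    and low: "ht a (pos a) < h"
  shows "safe W G relabel_code s \<and> refines (run G relabel_code s) (relabel a)"
proof -
  note g = good_relabel(1)[OF ga busy t full q low]
  have "ht a (pos a) + 1 < W"
    using good_less(1)[OF g pos_less(1)] by (auto simp: relabel_def)
  moreover have "ht a (pos a) = 0 \<Longrightarrow> length (touched a) < n"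
    using good_less(6)[OF g] by (auto simp: relabel_def)
  moreover have "length (touched a) \<le> n" using good_less(6)[OF ga] .
  ultimately show ?thesis
    using pos_less n_less addr_less[of 1 "pos a"] addr_less[of 2 "pos a"]
      addr_less[of 4 "length (touched a)"] busy ref
    unfolding refines_def
    by (auto simp: relabel_code_def relabel_def addr_eq_iff nth_append)
qed

lemma arc_code:
  assumes t: "tok a < M * dg (xs ! idx a)"
    and full: "4 * dg (pos a) \<le> held a (pos a)" and q: "ptr a (pos a) < dg (pos a)"
  defines "w \<equiv> L (pos a) ! ptr a (pos a)"
  shows "safe W G arc_code s \<and> refines (run G arc_code s)
    (if ht a w < ht a (pos a) \<and> residual a (pos a) w then push a w else advance a)"
proof -
  have w: "w \<in> set (L (pos a))" using q by (simp add: w_def dg_def)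
  then have wn: "w < n" using L_less pos_less by blast
  have nb: "aval G (Neighbour (Reg 11) (cell 2 (Reg 11))) s = w"
    using read(3,9,14) pos_less q by (simp add: adj_G w_def dg_def)
  define s1 where "s1 = s\<lparr>reg := (reg s)(15 := w)\<rparr>"
  have ref1: "refines s1 a" using ref unfolding refines_def by (simp add: s1_def)
  have w1: "reg s1 15 = w" by (simp add: s1_def)
  have b: "bval G (Conj (Less (cell 1 (Reg 15)) (cell 1 (Reg 11)))
                     (Less (Load (sent_addr (Reg 11) (Reg 15)))
                           (Plus (Reg 4) (Load (sent_addr (Reg 15) (Reg 11)))))) s1
      \<longleftrightarrow> ht a w < ht a (pos a) \<and> residual a (pos a) w"
    using refinesD[OF ref1] w1 pos_less wn by (simp add: residual_def)
  show ?thesis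
  proof (cases "ht a w < ht a (pos a) \<and> residual a (pos a) w")
    case True
    note g = good_push(1)[OF ga busy t w True[THEN conjunct1] True[THEN conjunct2]]
    have "sent a (pos a) w + 1 < W"
      using good_less(4)[OF g pos_less(1) wn] by (auto simp: push_def)
    then show ?thesis
      using True b nb wn n_less w1 pos_less ref1 good_less(6)[OF ga] addr_less[of "6 + pos a" w] unfolding refines_def
      by (simp add: arc_code_def push_def addr_eq_iff flip: s1_def)
  next
    case False
    note g = good_advance(1)[OF ga busy t full q False[unfolded w_def]]
    have "ptr a (pos a) + 1 < W"
      using good_less(2)[OF g pos_less(1)] by (auto simp: advance_def)
    then show ?thesis
      using False[unfolded residual_def] nb wn n_less w1 pos_less ref1 good_less(6)[OF ga] addr_less[of 2 "pos a"] unfolding refines_def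
      by (auto simp: arc_code_def advance_def addr_eq_iff residual_def simp flip: s1_def)
  qed
qed

lemma move_code: "safe W G move_code s \<and> refines (run G move_code s) (move a)"
proof -
  have b1: "bval G (Less (Reg 10) (Times (Reg 3) (Degree (cell 0 (Reg 9))))) s
      \<longleftrightarrow> tok a < M * dg (xs ! idx a)"
    using read src_cell by (simp add: adj_G dg_def)
  have b2: "bval G (Conj (Neg (Less (cell 3 (Reg 11)) (Times (Const 4) (Degree (Reg 11)))))
                   (Less (cell 1 (Reg 11)) (Reg 5))) s
      \<longleftrightarrow> \<not> (held a (pos a) < 4 * dg (pos a) \<or> h \<le> ht a (pos a))"
    using read pos_less by (auto simp: adj_G dg_def)
  have b3: "bval G (Less (cell 2 (Reg 11)) (Degree (Reg 11))) s \<longleftrightarrow> ptr a (pos a) < dg (pos a)"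
    using read pos_less by (auto simp: adj_G dg_def)
  show ?thesis
    using deliver_code next_source_code relabel_code arc_code
    unfolding move_code_def move_def Let_def safe.simps run.simps b1 b2 b3
    by (simp add: not_less not_le)
qed

end

lemma route_loop:
  assumes "refines s start"
  shows "halts W G (While (Less (Reg 9) (Reg 1)) move_code) s
     (1 + (1 + steps move_code) * ((6 * h + 4) * (M * weight (set xs)) + (h + 1) * length xs))
     (\<lambda>s'. \<exists>a. refines s' a \<and> good a \<and> idx a = length xs)"
proof (rule halts_mono)
  let ?B = "int ((6 * h + 4) * (M * weight (set xs)) + (h + 1) * length xs)"
  let ?I = "\<lambda>s k. \<exists>a. refines s a \<and> good a \<and> progress a = k"
  have b: "bval G (Less (Reg 9) (Reg 1)) s \<longleftrightarrow> idx a < length xs" if "refines s a" for s a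
    using refinesD[OF that] by simp
  show "halts W G (While (Less (Reg 9) (Reg 1)) move_code) s
     (1 + (1 + steps move_code) * nat (?B - 0))
     (\<lambda>s'. (\<exists>k. ?I s' k) \<and> \<not> bval G (Less (Reg 9) (Reg 1)) s')"
  proof (rule halts_While)
    show "?I s 0" using assms good_start by blast
    show "k \<le> ?B" if "?I s k" for s k using that progress_le by blast
    fix s k assume I: "?I s k" and busy: "bval G (Less (Reg 9) (Reg 1)) s"
    then obtain a where a: "refines s a" "good a" "k = progress a" by blast
    with busy b have "idx a < length xs" by blast
    with a good_move move_code show "safe W G move_code s \<and> (\<exists>k'>k. ?I (run G move_code s) k')"
      by blast
  qed
  fix s' assume "(\<exists>k. ?I s' k) \<and> \<not> bval G (Less (Reg 9) (Reg 1)) s'"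
  then obtain a where "refines s' a" "good a" "\<not> idx a < length xs" using b by blast
  then show "\<exists>a. refines s' a \<and> good a \<and> idx a = length xs"
    by (auto simp: good_def token_inv_def)
qed (simp only: diff_zero nat_int order_refl)

end

section \<open>Searching for a sparse level\<close>

definition scan_code :: com where
  "scan_code =
     Cond (Less (Reg 17) (Reg 12))
       (Cond (Less (cell 1 (cell 4 (Reg 17))) (Reg 16))
          (incr 17)
          (Cond (Less (Reg 18) (Degree (cell 4 (Reg 17))))
             (Seq (Cond (Less (cell 1 (Neighbour (cell 4 (Reg 17)) (Reg 18))) (Reg 16)) (incr 21) Skip)
                  (incr 18))
             (Seq (Store (cell_addr (Const 5) (Reg 19)) (cell 4 (Reg 17)))
             (Seq (incr 19)
             (Seq (Assign 20 (Plus (Reg 20) (Degree (cell 4 (Reg 17)))))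
             (Seq (incr 17)
                  (Assign 18 (Const 0))))))))
       (Seq (incr 16)
       (Seq (Assign 17 (Const 0))
       (Seq (Assign 19 (Const 0))
       (Seq (Assign 20 (Const 0))
            (Assign 21 (Const 0))))))"

definition scan_test :: bexp where
  "scan_test = Neg (Conj (Neg (Less (Reg 17) (Reg 12))) (Less_alpha (Reg 21) (Reg 20)))"

context flow_machine
begin

definition selected :: "flow_state \<Rightarrow> nat \<Rightarrow> nat \<Rightarrow> nat list" where
  "selected a i q = filter (\<lambda>v. i \<le> ht a v) (take q (touched a))"

definition below :: "flow_state \<Rightarrow> nat \<Rightarrow> nat list \<Rightarrow> nat" where
  "below a i ws = length (filter (\<lambda>w. ht a w < i) ws)"

definition accepted :: "flow_state \<Rightarrow> nat \<Rightarrow> bool" where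
  "accepted a i \<longleftrightarrow> real (boundary (above a i)) < alpha G * real (weight (above a i))"

definition scanning :: "flow_state \<Rightarrow> state \<Rightarrow> nat \<Rightarrow> nat \<Rightarrow> nat \<Rightarrow> bool" where
  "scanning a s i q e \<longleftrightarrow>
     refines s a \<and> reg s 16 = i \<and> reg s 17 = q \<and> reg s 18 = e \<and>
     reg s 19 = length (selected a i q) \<and>
     (\<forall>j<length (selected a i q). mem s (addr (n + 1) 5 j) = selected a i q ! j) \<and>
     reg s 20 = sum_list (map dg (selected a i q)) \<and>
     reg s 21 = sum_list (map (\<lambda>v. below a i (L v)) (selected a i q))
       + (if q < length (touched a) then below a i (take e (L (touched a ! q))) else 0) \<and>
     q \<le> length (touched a) \<and>
     (q < length (touched a) \<longrightarrow> e \<le> dg (touched a ! q) \<and> (0 < e \<longrightarrow> i \<le> ht a (touched a ! q))) \<and>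
     (q = length (touched a) \<longrightarrow> e = 0) \<and>
     1 \<le> i \<and> (\<forall>j. 1 \<le> j \<and> j < i \<longrightarrow> \<not> accepted a j)"

definition scan_cost :: "flow_state \<Rightarrow> nat \<Rightarrow> nat" where
  "scan_cost a q = sum_list (map (\<lambda>v. dg v + 1) (take q (touched a)))"

lemma refines_cong:
  assumes "refines s a" "\<And>x. x \<le> 13 \<Longrightarrow> reg s' x = reg s x"
    and "\<And>r v. r \<noteq> 5 \<Longrightarrow> v \<le> n \<Longrightarrow> mem s' (addr (n + 1) r v) = mem s (addr (n + 1) r v)"
    and "length (touched a) \<le> n"
  shows "refines s' a"
  using assms unfolding refines_def by simp

lemma below_le: "below a i ws \<le> length ws"
  by (simp add: below_def)

context
  fixes a :: flow_state
  assumes ga: "good a"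
begin

lemma touched_facts: "distinct (touched a)" "set (touched a) = {v. v < n \<and> 0 < ht a v}"
    "length (touched a) \<le> n" "q < length (touched a) \<Longrightarrow> touched a ! q < n"
proof -
  have lab: "label_inv a" using ga by (simp add: good_def)
  show "distinct (touched a)" "length (touched a) \<le> n" and s: "set (touched a) = {v. v < n \<and> 0 < ht a v}"
    using label_invD(9,10)[OF lab] good_less(6)[OF ga] by auto
  show "q < length (touched a) \<Longrightarrow> touched a ! q < n" using s nth_mem by fastforce
qed

lemma selected_Suc: "q < length (touched a) \<Longrightarrow>
    selected a i (Suc q) = selected a i q @ (if i \<le> ht a (touched a ! q) then [touched a ! q] else [])"
  by (simp add: selected_def take_Suc_conv_app_nth)

lemma length_selected: "q \<le> length (touched a) \<Longrightarrow> length (selected a i q) \<le> q"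
  using length_filter_le[of "\<lambda>v. i \<le> ht a v" "take q (touched a)"] by (simp add: selected_def)

lemma scan_cost_Suc: "q < length (touched a) \<Longrightarrow>
    scan_cost a (Suc q) = scan_cost a q + dg (touched a ! q) + 1"
  by (simp add: scan_cost_def take_Suc_conv_app_nth)

lemma scan_cost_mono: "q \<le> q' \<Longrightarrow> scan_cost a q \<le> scan_cost a q'"
proof -
  assume "q \<le> q'"
  then have "take q' (touched a) = take q (touched a) @ drop q (take q' (touched a))"
    by (metis append_take_drop_id min.absorb1 take_take)
  then show ?thesis unfolding scan_cost_def by (metis le_add1 map_append sum_list_append)
qed

lemma selected_all:
  assumes "1 \<le> i"
  shows "distinct (selected a i (length (touched a)))"
    "set (selected a i (length (touched a))) = above a i"
proof -
  have eq: "selected a i (length (touched a)) = filter (\<lambda>v. i \<le> ht a v) (touched a)"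
    by (simp add: selected_def)
  show "distinct (selected a i (length (touched a)))"
    unfolding eq using touched_facts(1) by simp
  show "set (selected a i (length (touched a))) = above a i"
    unfolding eq set_filter touched_facts(2) above_def using assms by auto
qed

lemma scan_result:
  assumes "scanning a s i (length (touched a)) e"
  shows "reg s 20 = weight (above a i)" "reg s 21 = boundary (above a i)"
    "mem s ` {addr (n + 1) 5 j | j. j < reg s 19} = above a i"
proof -
  have i: "1 \<le> i" using assms by (simp add: scanning_def)
  note sel = selected_all[OF i]
  show "reg s 20 = weight (above a i)"
    using assms sel by (simp add: scanning_def weight_def sum_list_distinct_conv_sum_set)
  have "below a i (L v) = card (set (L v) - above a i)" if "v \<in> above a i" for v
  proof -
    have v: "v < n" using that by (simp add: above_def)
    then have "set (filter (\<lambda>w. ht a w < i) (L v)) = set (L v) - above a i"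
      using L_less[OF v] by (auto simp: above_def)
    then show ?thesis using distinct_L[OF v] unfolding below_def by (metis distinct_card distinct_filter)
  qed
  then show "reg s 21 = boundary (above a i)"
    using assms sel by (simp add: scanning_def boundary_def sum_list_distinct_conv_sum_set)
  have "mem s ` {addr (n + 1) 5 j | j. j < reg s 19} = set (selected a i (length (touched a)))"
    using assms by (auto simp: scanning_def set_conv_nth image_def)
  then show "mem s ` {addr (n + 1) 5 j | j. j < reg s 19} = above a i" using sel by simp
qed

lemma cost_less: "scan_cost a (length (touched a)) \<le> n * (n + 1)"
proof -
  have "dg v + 1 \<le> n + 1" if "v \<in> set (touched a)" for v
    using that touched_facts(2) dg_le by auto
  then have "scan_cost a (length (touched a)) \<le> sum_list (map (\<lambda>_. n + 1) (touched a))"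
    unfolding scan_cost_def by (simp add: sum_list_mono del: map_replicate_const sum_list_replicate)
  also have "\<dots> = length (touched a) * (n + 1)" by (simp add: map_replicate_const sum_list_replicate)
  also have "\<dots> \<le> n * (n + 1)" using touched_facts(3) by (intro mult_right_mono) auto
  finally show ?thesis .
qed

lemma selected_sums: "sum_list (map dg (selected a i q)) \<le> scan_cost a q"
    "sum_list (map (\<lambda>v. below a i (L v)) (selected a i q)) \<le> scan_cost a q"
proof -
  have "sum_list (map f (filter P ys)) \<le> sum_list (map (\<lambda>v. dg v + 1) ys)"
    if "\<And>v. f v \<le> dg v" for f P ys
    by (induction ys) (use that in \<open>auto intro: add_mono le_SucI trans_le_add2\<close>)
  then show "sum_list (map dg (selected a i q)) \<le> scan_cost a q"
    "sum_list (map (\<lambda>v. below a i (L v)) (selected a i q)) \<le> scan_cost a q"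
    unfolding selected_def scan_cost_def using below_le by (auto simp: dg_def)
qed

lemma scan_less:
  assumes "scanning a s i q e"
  shows "reg s 20 < W" "reg s 21 < W"
proof -
  have q: "q \<le> length (touched a)" and i: "q < length (touched a) \<Longrightarrow> e \<le> dg (touched a ! q)"
    using assms by (auto simp: scanning_def)
  have c: "scan_cost a (length (touched a)) < W"
    using cost_less W_addr by (simp add: algebra_simps)
  show "reg s 20 < W"
    using assms selected_sums(1)[of i q] scan_cost_mono[OF q] c by (simp add: scanning_def)
  have "reg s 21 \<le> scan_cost a (length (touched a))"
  proof (cases "q < length (touched a)")
    case True
    have "below a i (take e (L (touched a ! q))) \<le> dg (touched a ! q)"
      using below_le[of a i "take e (L (touched a ! q))"] by (simp add: dg_def)
    then have "reg s 21 \<le> scan_cost a (Suc q)"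
      using assms selected_sums(2)[of i q] True by (simp add: scanning_def scan_cost_Suc)
    with scan_cost_mono[of "Suc q" "length (touched a)"] True show ?thesis by simp
  next
    case False
    then show ?thesis
      using assms selected_sums(2)[of i q] scan_cost_mono[OF q] by (simp add: scanning_def)
  qed
  with c show "reg s 21 < W" by simp
qed

lemma scan_step:
  assumes sc: "scanning a s i q e" and go: "bval G scan_test s"
    and lev: "\<exists>j. 1 \<le> j \<and> j \<le> h \<and> accepted a j"
  shows "safe W G scan_code s \<and> (\<exists>i' q' e'. scanning a (run G scan_code s) i' q' e' \<and>
    i * (scan_cost a (length (touched a)) + 1) + scan_cost a q + e
      < i' * (scan_cost a (length (touched a)) + 1) + scan_cost a q' + e')"
proof -
  have ref: "refines s a" using sc by (simp add: scanning_def)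
  note read = refinesD[OF ref]
  have regs: "reg s 16 = i" "reg s 17 = q" "reg s 18 = e" "reg s 19 = length (selected a i q)"
    and qle: "q \<le> length (touched a)"
    using sc by (auto simp: scanning_def)
  have h1: "1 < W" using W_addr by simp
  show ?thesis
  proof (cases "q < length (touched a)")
    case True
    let ?v = "touched a ! q"
    have v: "?v < n" using touched_facts(4)[OF True] .
    have e: "e \<le> dg ?v" "0 < e \<Longrightarrow> i \<le> ht a ?v" using sc True by (auto simp: scanning_def)
    have Sq: "Suc q < W" using True touched_facts(3) n_less by simp
    have cv: "mem s (addr (n + 1) 4 q) = ?v" using read(16)[OF True] .
    show ?thesis
    proof (cases "ht a ?v < i")
      case low: True
      let ?s = "s\<lparr>reg := (reg s)(17 := Suc q)\<rparr>"
      have e0: "e = 0" using e low by linarith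
      have r: "refines ?s a" using ref by (rule refines_cong) (use touched_facts in auto)
      have run: "run G scan_code s = ?s" "safe W G scan_code s"
        using True low regs read v cv Sq by (auto simp: scan_code_def)
      have "scanning a ?s i (Suc q) 0"
        using sc True low e0 r
        unfolding scanning_def selected_Suc[OF True] by (auto simp: below_def)
      then show ?thesis using run e0 scan_cost_Suc[OF True] by force
    next
      case high: False
      show ?thesis
      proof (cases "e < dg ?v")
        case inner: True
        let ?w = "L ?v ! e"
        have w: "?w < n" using L_less[OF v] inner by (simp add: dg_def)
        let ?s = "s\<lparr>reg := (reg s)(21 := reg s 21 + (if ht a ?w < i then 1 else 0), 18 := Suc e)\<rparr>"
        have r: "refines ?s a" using ref by (rule refines_cong) (use touched_facts in auto)
        have tk: "take (Suc e) (L ?v) = take e (L ?v) @ [?w]"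
          using inner by (simp add: take_Suc_conv_app_nth dg_def)
        have s': "scanning a ?s i q (Suc e)"
          using sc True high inner r unfolding scanning_def by (auto simp: tk below_def)
        have lt: "reg s 21 + (if ht a ?w < i then 1 else 0) < W"
          using scan_less(2)[OF s'] by simp
        have "Suc e < W" using inner dg_le[OF v] n_less by simp
        then have run: "run G scan_code s = ?s" "safe W G scan_code s"
          using True high inner regs read v w cv lt
          by (auto simp: scan_code_def adj_G dg_def fun_upd_def[symmetric])
        with s' show ?thesis by force
      next
        case full: False
        then have ee: "e = dg ?v" using e by simp
        let ?s = "s\<lparr>mem := (mem s)(addr (n + 1) 5 (length (selected a i q)) := ?v),
          reg := (reg s)(19 := Suc (length (selected a i q)), 20 := reg s 20 + dg ?v,
            17 := Suc q, 18 := 0)\<rparr>"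
        have len: "length (selected a i q) < n"
          using length_selected[OF qle] True touched_facts(3) by (meson le_less_trans less_le_trans)
        have r: "refines ?s a" using ref
          by (rule refines_cong) (use touched_facts len in \<open>auto simp: addr_eq_iff\<close>)
        have s': "scanning a ?s i (Suc q) 0"
          using sc True high ee r len
          unfolding scanning_def selected_Suc[OF True]
          by (auto simp: below_def nth_append addr_eq_iff dg_def less_Suc_eq)
        have lt: "reg s 20 + dg ?v < W" using scan_less(1)[OF s'] by simp
        have run: "run G scan_code s = ?s" "safe W G scan_code s"
          using True high full regs read v cv lt Sq len n_less addr_less[of 5 "length (selected a i q)"]
          by (auto simp: scan_code_def adj_G dg_def addr_eq_iff)
        then show ?thesis using s' ee scan_cost_Suc[OF True] by force
      qed
    qed
  next
    case False
    with qle have q: "q = length (touched a)" by simp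
    note res = scan_result[OF sc[unfolded q]]
    have "\<not> accepted a i"
      using go res read regs q by (simp add: scan_test_def accepted_def)
    then have na: "\<forall>j. 1 \<le> j \<and> j < Suc i \<longrightarrow> \<not> accepted a j"
      using sc by (auto simp: scanning_def less_Suc_eq)
    then have "Suc i \<le> h" using lev by (meson not_less_eq_eq le_less_trans less_Suc_eq_le not_le)
    then have Si: "Suc i < W" using W_h by simp
    let ?s = "s\<lparr>reg := (reg s)(16 := Suc i, 17 := 0, 19 := 0, 20 := 0, 21 := 0)\<rparr>"
    have r: "refines ?s a" using ref by (rule refines_cong) (use touched_facts in auto)
    have e0: "e = 0" using sc q by (simp add: scanning_def)
    have s': "scanning a ?s (Suc i) 0 0"
      using sc na r e0 unfolding scanning_def by (auto simp: selected_def below_def)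
    have run: "run G scan_code s = ?s" "safe W G scan_code s"
      using q regs read Si h1 by (auto simp: scan_code_def)
    have "i * (scan_cost a (length (touched a)) + 1) + scan_cost a q + e
      < Suc i * (scan_cost a (length (touched a)) + 1) + scan_cost a 0 + 0"
      using q e0 by simp
    with run s' show ?thesis by metis
  qed
qed

lemma scan_cost_le: "scan_cost a (length (touched a)) \<le> M * weight (set xs)"
proof -
  have lab: "label_inv a" using ga by (simp add: good_def)
  have "set (touched a) = above a 1" unfolding touched_facts(2) above_def by auto
  then have "scan_cost a (length (touched a)) = (\<Sum>v\<in>above a 1. dg v + 1)"
    using touched_facts(1) by (simp add: scan_cost_def sum_list_distinct_conv_sum_set)
  also have "(\<Sum>v\<in>above a 1. dg v + 1) \<le> (\<Sum>v\<in>above a 1. 4 * dg v)"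
    using label_invD(3)[OF lab] by (intro sum_mono) (fastforce simp: above_def)
  also have "\<dots> = 4 * weight (above a 1)" by (simp add: weight_def sum_distrib_left)
  also have "\<dots> \<le> M * weight (set xs)"
    using above_small[OF ga, of 1] by simp
  finally show ?thesis .
qed

lemma scan_loop:
  assumes ref: "refines s a"
    and init: "reg s 16 = 1" "reg s 17 = 0" "reg s 18 = 0" "reg s 19 = 0" "reg s 20 = 0" "reg s 21 = 0"
    and lev: "\<exists>j. 1 \<le> j \<and> j \<le> h \<and> accepted a j"
  shows "halts W G (While scan_test scan_code) s
     (1 + (1 + steps scan_code) * ((h + 1) * (M * weight (set xs) + 1)))
     (\<lambda>s'. refines s' a \<and> reg s' 19 \<le> n \<and> (\<exists>i. 1 \<le> i \<and> i \<le> h \<and> accepted a i \<and>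
        mem s' ` {addr (n + 1) 5 j | j. j < reg s' 19} = above a i))"
proof (rule halts_mono)
  let ?c = "scan_cost a (length (touched a))"
  let ?B = "int ((h + 1) * (M * weight (set xs) + 1))"
  let ?I = "\<lambda>s k. \<exists>i q e. scanning a s i q e \<and> int (i * (?c + 1) + scan_cost a q + e) = k"
  show "halts W G (While scan_test scan_code) s
     (1 + (1 + steps scan_code) * nat (?B - int (?c + 1)))
     (\<lambda>s'. (\<exists>k. ?I s' k) \<and> \<not> bval G scan_test s')"
  proof (rule halts_While)
    have "scanning a s 1 0 0"
      using ref init unfolding scanning_def by (auto simp: selected_def below_def)
    moreover have "scan_cost a 0 = 0" by (simp add: scan_cost_def)
    ultimately show "?I s (int (?c + 1))" by force
    fix s k assume I: "?I s k"
    then obtain i q e where sc: "scanning a s i q e" and k: "k = int (i * (?c + 1) + scan_cost a q + e)"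
      by blast
    obtain j where j: "1 \<le> j" "j \<le> h" "accepted a j" using lev by blast
    have "\<not> j < i" using sc j unfolding scanning_def by blast
    then have "i \<le> h" using j by simp
    have q: "q \<le> length (touched a)" using sc by (simp add: scanning_def)
    have "scan_cost a q + e \<le> ?c"
    proof (cases "q < length (touched a)")
      case True
      then have "scan_cost a q + e \<le> scan_cost a (Suc q)"
        using sc by (simp add: scanning_def scan_cost_Suc)
      with scan_cost_mono[of "Suc q" "length (touched a)"] True show ?thesis by simp
    next
      case False
      with q sc show ?thesis by (simp add: scanning_def)
    qed
    then have "i * (?c + 1) + scan_cost a q + e \<le> h * (?c + 1) + ?c"
      using \<open>i \<le> h\<close> mult_right_mono[of i h "?c + 1"] by linarith
    also have "\<dots> \<le> (h + 1) * (M * weight (set xs) + 1)"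
    proof -
      have "h * ?c \<le> h * (M * weight (set xs))" by (intro mult_left_mono scan_cost_le) simp
      moreover have "(h + 1) * (Z + 1) = h * Z + h + Z + 1" for Z
        by (simp add: algebra_simps)
      note this[of "M * weight (set xs)"]
      moreover have "h * (?c + 1) = h * ?c + h" by simp
      ultimately show ?thesis using scan_cost_le by linarith
    qed
    finally show "k \<le> ?B" unfolding k by (rule of_nat_mono)
    assume "bval G scan_test s"
    from scan_step[OF sc this lev] obtain i' q' e' where
      safe: "safe W G scan_code s" and sc': "scanning a (run G scan_code s) i' q' e'"
      and less: "i * (?c + 1) + scan_cost a q + e < i' * (?c + 1) + scan_cost a q' + e'"
      by blast
    have "k < int (i' * (?c + 1) + scan_cost a q' + e')"
      unfolding k using less by (rule of_nat_less_iff[THEN iffD2])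
    with safe sc' show "safe W G scan_code s \<and> (\<exists>k'>k. ?I (run G scan_code s) k')" by blast
  qed
  fix s' assume "(\<exists>k. ?I s' k) \<and> \<not> bval G scan_test s'"
  then obtain i q e where sc: "scanning a s' i q e" and stop: "\<not> bval G scan_test s'" by blast
  have ref': "refines s' a" using sc by (simp add: scanning_def)
  have q: "q = length (touched a)" and acc: "real (reg s' 21) < alpha G * real (reg s' 20)"
    using sc stop refinesD(10)[OF ref'] by (auto simp: scanning_def scan_test_def)
  note res = scan_result[OF sc[unfolded q]]
  have ai: "accepted a i" using acc res by (simp add: accepted_def)
  obtain j where j: "1 \<le> j" "j \<le> h" "accepted a j" using lev by blast
  have "1 \<le> i" "\<not> j < i" using sc j unfolding scanning_def by blast+
  then have "1 \<le> i" "i \<le> h" using j by simp_all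
  moreover have "reg s' 19 \<le> n"
    using sc length_selected[of q i] touched_facts(3) by (auto simp: scanning_def)
  ultimately show "refines s' a \<and> reg s' 19 \<le> n \<and> (\<exists>i. 1 \<le> i \<and> i \<le> h \<and> accepted a i \<and>
      mem s' ` {addr (n + 1) 5 j | j. j < reg s' 19} = above a i)"
    using ref' ai res by blast
next
  show "1 + (1 + steps scan_code) *
      nat (int ((h + 1) * (M * weight (set xs) + 1)) - int (scan_cost a (length (touched a)) + 1))
    \<le> 1 + (1 + steps scan_code) * ((h + 1) * (M * weight (set xs) + 1))"
    by (intro add_left_mono mult_left_mono) linarith+
qed

end

end

section \<open>The algorithm and its answers\<close>

lemma halts_Assign:
  "aval G a s < W \<Longrightarrow> Q (s\<lparr>reg := (reg s)(x := aval G a s)\<rparr>) \<Longrightarrow> halts W G (Assign x a) s 1 Q"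
  using halts_safe[of W G "Assign x a" s Q] by simp

lemma halts_Assign_Seq:
  assumes "aval G a s < W" "halts W G c (s\<lparr>reg := (reg s)(x := aval G a s)\<rparr>) T Q"
  shows "halts W G (Seq (Assign x a) c) s (1 + T) Q"
  by (rule halts_Seq, rule halts_Assign[where Q = "\<lambda>s'. s' = s\<lparr>reg := (reg s)(x := aval G a s)\<rparr>"])
    (use assms in auto)

lemma halts_search:
  fixes m0 B :: nat
  assumes guard: "\<And>m. bval G b (s\<lparr>reg := (reg s)(x := m)\<rparr>) \<longleftrightarrow> P m"
    and start: "reg s x = m0" "m0 \<le> B" and less: "\<And>m. P m \<Longrightarrow> m < B" and B: "B < W"
  shows "halts W G (While b (incr x)) s (1 + 2 * B)
    (\<lambda>s'. \<exists>m. s' = s\<lparr>reg := (reg s)(x := m)\<rparr> \<and> m0 \<le> m \<and> m \<le> B \<and> \<not> P m \<and> (m = m0 \<or> P (m - 1)))"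
proof (rule halts_mono)
  let ?I = "\<lambda>s' k. \<exists>m. s' = s\<lparr>reg := (reg s)(x := m)\<rparr> \<and> m0 \<le> m \<and> m \<le> B \<and> (m = m0 \<or> P (m - 1)) \<and> k = int m"
  show "halts W G (While b (incr x)) s (1 + (1 + steps (incr x)) * nat (int B - int m0))
    (\<lambda>s'. (\<exists>k. ?I s' k) \<and> \<not> bval G b s')"
  proof (rule halts_While)
    have "s\<lparr>reg := (reg s)(x := m0)\<rparr> = s" using start by (auto simp: fun_upd_idem)
    then show "?I s (int m0)" using start by (intro exI[of _ m0]) auto
    fix s' k assume I: "?I s' k"
    then obtain m where m: "s' = s\<lparr>reg := (reg s)(x := m)\<rparr>" "m0 \<le> m" "m \<le> B" "k = int m" by blast
    show "k \<le> int B" using m by simp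
    assume "bval G b s'"
    then have "P m" using m guard by simp
    then have "m < B" by (rule less)
    with m B \<open>P m\<close> show "safe W G (incr x) s' \<and> (\<exists>k'>k. ?I (run G (incr x) s') k')"
      by (auto intro!: exI[of _ "int (Suc m)"] exI[of _ "Suc m"])
  qed
qed (use guard start in \<open>auto\<close>)

lemma halts_doubling:
  fixes N :: nat and B :: nat
  assumes start: "reg s 7 = 0" "reg s 8 = 1" "reg s 2 = N" and N: "1 \<le> N"
    and B: "\<And>j. 2 ^ j < N * N \<Longrightarrow> j < B" and W: "2 * (N * N) < W" "B < W"
  shows "halts W G (While (Less (Reg 8) (Times (Reg 2) (Reg 2)))
      (Seq (Assign 8 (Times (Reg 8) (Const 2))) (incr 7))) s (1 + 3 * B)
    (\<lambda>s'. \<exists>j. s' = s\<lparr>reg := (reg s)(8 := 2 ^ j, 7 := j)\<rparr> \<and> N * N \<le> 2 ^ j \<and> j \<le> B)"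
proof (rule halts_mono)
  let ?b = "Less (Reg 8) (Times (Reg 2) (Reg 2))"
  let ?c = "Seq (Assign 8 (Times (Reg 8) (Const 2))) (incr 7)"
  let ?I = "\<lambda>s' k. \<exists>j. s' = s\<lparr>reg := (reg s)(8 := 2 ^ j, 7 := j)\<rparr> \<and> j \<le> B \<and> k = int j"
  show "halts W G (While ?b ?c) s (1 + (1 + steps ?c) * nat (int B - 0))
    (\<lambda>s'. (\<exists>k. ?I s' k) \<and> \<not> bval G ?b s')"
  proof (rule halts_While)
    have "s\<lparr>reg := (reg s)(8 := 2 ^ 0, 7 := 0)\<rparr> = s" using start by (auto simp: fun_upd_idem)
    then show "?I s 0" by (intro exI[of _ 0]) auto
    fix s' k assume I: "?I s' k"
    then obtain j where j: "s' = s\<lparr>reg := (reg s)(8 := 2 ^ j, 7 := j)\<rparr>" "j \<le> B" "k = int j" by blast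
    show "k \<le> int B" using j by simp
    assume "bval G ?b s'"
    then have lt: "2 ^ j < N * N" using j start by simp
    then have "j < B" by (rule B)
    have run: "run G ?c s' = s\<lparr>reg := (reg s)(8 := 2 ^ Suc j, 7 := Suc j)\<rparr>"
      using j by (auto simp: fun_eq_iff)
    have "safe W G ?c s'" using j lt W \<open>j < B\<close> by simp
    moreover have "?I (run G ?c s') (int (Suc j))"
      unfolding run using \<open>j < B\<close> by (intro exI[of _ "Suc j"]) auto
    moreover have "k < int (Suc j)" using j by simp
    ultimately show "safe W G ?c s' \<and> (\<exists>k'>k. ?I (run G ?c s') k')" by blast
  qed
qed (use start in auto)

text \<open>Registers: 3 to 5 hold \<open>M\<close>, the edge capacity and \<open>h\<close>; 6 and 7 hold \<open>s\<close> and \<open>k\<close>; 9 to 13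
  hold \<open>idx\<close>, \<open>tok\<close>, \<open>pos\<close>, the length of \<open>touched\<close> and \<open>parked\<close>; 14 holds the volume of the
  source set; 16 to 21 hold the level, the positions in \<open>touched\<close> and in an adjacency
  list, and the size, volume and boundary of the selected set.\<close>

definition volume_code :: com where
  "volume_code =
     Seq (Assign 2 (Plus (Reg 0) (Const 1)))
         (While (Less (Reg 9) (Reg 1))
            (Seq (Assign 14 (Plus (Reg 14) (Degree (Load (Reg 9))))) (incr 9)))"

definition scale_code :: com where
  "scale_code =
     Seq (Assign 9 (Const 0))
    (Seq (Assign 6 (Const 1))
    (Seq (While (Conj (Neg (Less_alpha (Const 1) (Reg 6))) (Less (Reg 6) (Times (Reg 2) (Reg 2)))) (incr 6))
    (Seq (Assign 3 (Const 1))
    (Seq (While (Neg (Less_sigma (Const 4) (Reg 3))) (incr 3))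
    (Seq (incr 3)
    (Seq (Assign 8 (Const 1))
    (Seq (While (Less (Reg 8) (Times (Reg 2) (Reg 2)))
            (Seq (Assign 8 (Times (Reg 8) (Const 2))) (incr 7)))
    (Seq (Assign 4 (Times (Times (Const 4) (Reg 3)) (Reg 6)))
    (Seq (Assign 5 (Plus (Times (Times (Const 8) (Reg 6)) (Reg 7)) (Const 1)))
         (Assign 11 (cell 0 (Const 0))))))))))))"

definition output_code :: com where
  "output_code =
     Cond (Less (Const 0) (Reg 13))
       (Seq (Assign 16 (Const 1))
       (Seq (Assign 17 (Const 0))
       (Seq (Assign 18 (Const 0))
       (Seq (Assign 19 (Const 0))
       (Seq (Assign 20 (Const 0))
       (Seq (Assign 21 (Const 0))
       (Seq (While scan_test scan_code)
       (Seq (Assign 0 (Const 1))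
       (Seq (Assign 1 (Times (Const 5) (Reg 2)))
            (Assign 2 (Reg 19)))))))))))
       (Assign 0 (Const 0))"

definition lbs_code :: com where
  "lbs_code =
     Cond (Less_alpha (Const 0) (Const 1))
       (Seq volume_code
          (Cond (Less (Const 0) (Reg 14))
             (Seq scale_code (Seq (While (Less (Reg 9) (Reg 1)) move_code) output_code))
             (Assign 0 (Const 0))))
       (Assign 0 (Const 0))"

locale lbs_input =
  fixes n :: nat and E :: "nat set set" and L :: "nat \<Rightarrow> nat list" and xs :: "nat list"
    and \<sigma> \<alpha> :: real
  assumes simple: "simple_graph {..<n} E" and adj: "adjacency_lists n E L"
    and xs: "distinct xs" "set xs \<subseteq> {..<n}"
    and \<alpha>: "0 \<le> \<alpha>" "\<alpha> \<le> 1" and \<sigma>: "0 < \<sigma>" "\<sigma> \<le> 1"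
    and small: "2 * vol E (set xs) \<le> vol E ({..<n} - set xs)"
    and overlap: "2 * real (vol E (set xs)) / real (vol E ({..<n} - set xs)) \<le> \<sigma>"
begin

abbreviation "V \<equiv> {..<n}"
abbreviation "A \<equiv> set xs"
abbreviation "W \<equiv> (n + 2) ^ 20"
abbreviation "G \<equiv> \<lparr>adj = L, alpha = \<alpha>, sigma = \<sigma>\<rparr>"

lemma vol_split: "S \<subseteq> V \<Longrightarrow> vol E V = vol E S + vol E (V - S)"
  unfolding vol_def using sum.subset_diff[of S V "deg E"] by simp

lemma vol_adj: "S \<subseteq> V \<Longrightarrow> vol E S = (\<Sum>v\<in>S. length (L v))"
  unfolding vol_def using deg_adj[OF simple adj] by (intro sum.cong) auto

lemma length_L_le: "v < n \<Longrightarrow> length (L v) \<le> n"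
proof -
  assume v: "v < n"
  interpret local_flow n 0 0 1 L xs by (rule local_flow_graph[OF simple adj]) (use xs in auto)
  show ?thesis using distinct_L[OF v] L_less[OF v]
    by (metis card_lessThan card_mono distinct_card finite_lessThan lessThan_iff subsetI)
qed

lemma vol_le: "S \<subseteq> V \<Longrightarrow> vol E S \<le> n * n"
proof -
  assume S: "S \<subseteq> V"
  have "vol E S \<le> (\<Sum>v\<in>S. n)" unfolding vol_adj[OF S] using S length_L_le by (intro sum_mono) auto
  also have "\<dots> = card S * n" by simp
  also have "\<dots> \<le> n * n" using S card_mono[of V S] by (intro mult_right_mono) auto
  finally show ?thesis .
qed

definition no_cut :: "real \<Rightarrow> bool" where
  "no_cut \<beta> \<longleftrightarrow> \<not> (\<exists>S. sparse_cut V E \<beta> S \<and> overlapping E A \<sigma> S)"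

lemma OPT_no_cut: "no_cut \<beta> \<Longrightarrow> OPT V E \<beta> A \<sigma> = 0"
  unfolding no_cut_def OPT_def opt_candidates_def by auto

lemma OPT_le:
  assumes "\<And>S. sparse_cut V E \<beta> S \<Longrightarrow> overlapping E A \<sigma> S \<Longrightarrow> real (vol E S) \<le> c" and "0 \<le> c"
  shows "real (OPT V E \<beta> A \<sigma>) \<le> c"
proof (cases "opt_candidates V E \<beta> A \<sigma> = {}")
  case False
  have "opt_candidates V E \<beta> A \<sigma> \<subseteq> Pow V" by (auto simp: opt_candidates_def sparse_cut_def)
  then have "finite (opt_candidates V E \<beta> A \<sigma>)" by (rule finite_subset) simp
  with False have "Max (vol E ` opt_candidates V E \<beta> A \<sigma>) \<in> vol E ` opt_candidates V E \<beta> A \<sigma>"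
    by (intro Max_in) auto
  with assms(1) False show ?thesis by (auto simp: OPT_def opt_candidates_def)
qed (use assms in \<open>simp add: OPT_def\<close>)

definition answers :: "nat set option \<Rightarrow> bool" where
  "answers r \<longleftrightarrow> lbs_answer (108 / \<sigma>\<^sup>2) (96 / \<sigma>\<^sup>2) V E A \<sigma> \<alpha> r \<and>
     (r = None \<longrightarrow> no_cut (\<alpha> / (96 / \<sigma>\<^sup>2)))"

lemma answers_None: "no_cut (\<alpha> / (96 / \<sigma>\<^sup>2)) \<Longrightarrow> answers None"
  by (simp add: answers_def lbs_answer_def OPT_no_cut)

lemma crossing_less:
  assumes "sparse_cut V E \<beta> S"
  shows "real (crossing V E S) < \<beta> * real (vol E S)" "0 < vol E S" "0 < \<beta>"
proof -
  let ?m = "min (vol E S) (vol E (V - S))"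
  have m: "0 < ?m" and c: "real (crossing V E S) / real ?m < \<beta>"
    using assms unfolding sparse_cut_def conductance_def by auto
  have "0 \<le> real (crossing V E S) / real ?m" by simp
  with c show b: "0 < \<beta>" by linarith
  have "real (crossing V E S) < \<beta> * real ?m" using c m by (simp only: pos_divide_less_eq of_nat_0_less_iff)
  also have "\<dots> \<le> \<beta> * real (vol E S)" using b by (intro mult_left_mono of_nat_mono) auto
  finally show "real (crossing V E S) < \<beta> * real (vol E S)" .
  show "0 < vol E S" using m by simp
qed

lemma no_cut_trivial:
  assumes "\<alpha> = 0 \<or> vol E A = 0"
  shows "no_cut (\<alpha> / (96 / \<sigma>\<^sup>2))"
  unfolding no_cut_def
proof
  assume "\<exists>S. sparse_cut V E (\<alpha> / (96 / \<sigma>\<^sup>2)) S \<and> overlapping E A \<sigma> S"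
  then obtain S where S: "sparse_cut V E (\<alpha> / (96 / \<sigma>\<^sup>2)) S" "overlapping E A \<sigma> S" by blast
  have "\<alpha> \<noteq> 0" using crossing_less(3)[OF S(1)] by auto
  then have "vol E A = 0" using assms by blast
  moreover have "vol E (S \<inter> A) \<le> vol E A" unfolding vol_def by (intro sum_mono2) auto
  ultimately have "vol E (S \<inter> A) = 0" by simp
  then show False using S(2) \<sigma> by (simp add: overlapping_def)
qed

lemma overlap_vol:
  assumes "0 < vol E A"
  shows "2 * real (vol E A) \<le> \<sigma> * real (vol E (V - A))"
proof -
  have "0 < vol E (V - A)" using small assms by linarith
  with overlap show ?thesis by (simp add: divide_le_eq)
qed

text \<open>Here \<open>s\<close> stands for \<open>1 / \<alpha>\<close>. The search for it stops at \<open>(n + 1)\<^sup>2\<close>, which exceeds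
  every volume: beyond that bound, a sparse cut is one without crossing edges.\<close>

definition parameters :: "nat \<Rightarrow> nat \<Rightarrow> nat \<Rightarrow> bool" where
  "parameters s M k \<longleftrightarrow>
     1 \<le> s \<and> s \<le> (n + 1) * (n + 1) \<and> real s * \<alpha> \<le> 2 \<and> (1 < \<alpha> * real s \<or> (n + 1) * (n + 1) \<le> s) \<and>
     4 / \<sigma> + 1 \<le> real M \<and> real M \<le> 4 / \<sigma> + 2 \<and> M \<le> 2 * (n * n) + 2 \<and>
     (n + 1) * (n + 1) \<le> 2 ^ k \<and> k \<le> (n + 1) * (n + 1) \<and> real k \<le> 2 * log 2 (real n + 2) + 1"

lemma parameters_small:
  assumes "parameters s M k"
  defines "h \<equiv> 8 * s * k + 1"
  shows "4 * M * s < W" "h < W" "(6 * h + 4) * (M * vol E A) + (h + 1) * length xs < W"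
    "(n + 7) * (n + 1) < W"
proof -
  define Z where "Z = n + 2"
  have Z: "2 \<le> Z" "n \<le> Z" "n + 1 \<le> Z" by (auto simp: Z_def)
  have Zp: "1 \<le> Z" using Z by simp
  have num: "2 \<le> Z ^ 1" "4 \<le> Z ^ 2" "8 \<le> Z ^ 3" "16 \<le> Z ^ 4"
    using Z(1) power_mono[of 2 Z 2] power_mono[of 2 Z 3] power_mono[of 2 Z 4] by auto
  have up: "Z ^ i \<le> Z ^ j" if "i \<le> j" for i j using that Zp by (rule power_increasing)
  have sq: "(n + 1) * (n + 1) \<le> Z ^ 2" "n * n \<le> Z ^ 2"
    unfolding power2_eq_square using Z by (intro mult_le_mono; simp)+
  have len: "length xs \<le> Z ^ 1"
    using xs card_mono[of V A] Z by (simp add: distinct_card)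
  have s: "s \<le> Z ^ 2" and k: "k \<le> Z ^ 2" and "M \<le> 2 * (n * n) + 2"
    using assms sq by (auto simp: parameters_def)
  moreover have "n * n + 1 \<le> (n + 1) * (n + 1)" by simp
  ultimately have "M \<le> 2 * Z ^ 2" using sq(1) by linarith
  also have "\<dots> \<le> Z ^ 1 * Z ^ 2" using num(1) by (intro mult_right_mono) auto
  also have "\<dots> = Z ^ 3" by (simp add: power2_eq_square power3_eq_cube)
  finally have M: "M \<le> Z ^ 3" .
  have w: "vol E A \<le> Z ^ 2" using vol_le[of A] xs sq by simp
  have "4 * M * s \<le> Z ^ 2 * Z ^ 3 * Z ^ 2" by (intro mult_le_mono num M s)
  also have "\<dots> = Z ^ 7" unfolding power_add[symmetric] by simp
  finally have U: "4 * M * s \<le> Z ^ 7" .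
  have "8 * s * k \<le> Z ^ 3 * Z ^ 2 * Z ^ 2" by (intro mult_le_mono num k s)
  also have "\<dots> = Z ^ 7" unfolding power_add[symmetric] by simp
  finally have "8 * s * k \<le> Z ^ 7" .
  moreover have "1 \<le> Z ^ 7" using Zp by simp
  ultimately have "h \<le> 2 * Z ^ 7" by (simp add: h_def)
  also have "\<dots> \<le> Z ^ 1 * Z ^ 7" using num(1) by (intro mult_right_mono) auto
  also have "\<dots> = Z ^ 8" unfolding power_add[symmetric] by simp
  finally have hZ: "h \<le> Z ^ 8" .
  have h1: "1 \<le> h" by (simp add: h_def)
  have "(6 * h + 4) * (M * vol E A) \<le> (16 * h) * (M * vol E A)"
    using h1 by (intro mult_right_mono) auto
  also have "\<dots> \<le> (Z ^ 4 * Z ^ 8) * (Z ^ 3 * Z ^ 2)" by (intro mult_le_mono num hZ M w)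
  also have "\<dots> = Z ^ 17" unfolding power_add[symmetric] by simp
  finally have 1: "(6 * h + 4) * (M * vol E A) \<le> Z ^ 17" .
  have "(h + 1) * length xs \<le> (2 * h) * length xs" using h1 by (intro mult_right_mono) auto
  also have "\<dots> \<le> (Z ^ 1 * Z ^ 8) * Z ^ 1" by (intro mult_le_mono num hZ len)
  also have "\<dots> = Z ^ 10" unfolding power_add[symmetric] by simp
  also have "\<dots> \<le> Z ^ 17" by (rule up) simp
  finally have "(6 * h + 4) * (M * vol E A) + (h + 1) * length xs \<le> 2 * Z ^ 17" using 1 by linarith
  also have "\<dots> \<le> Z ^ 1 * Z ^ 17" using num(1) by (intro mult_right_mono) auto
  also have "\<dots> = Z ^ 18" unfolding power_add[symmetric] by simp
  finally have B: "(6 * h + 4) * (M * vol E A) + (h + 1) * length xs \<le> Z ^ 18" .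
  have "n + 7 \<le> 4 * Z" by (simp add: Z_def)
  then have "(n + 7) * (n + 1) \<le> (4 * Z) * Z" using Z by (intro mult_le_mono)
  also have "\<dots> \<le> (Z ^ 2 * Z) * Z" by (intro mult_le_mono num order_refl)
  also have "\<dots> = Z ^ 4" by (simp add: numeral_eq_Suc)
  finally have a: "(n + 7) * (n + 1) \<le> Z ^ 4" .
  have less: "x < W" if "x \<le> Z ^ j" "j < 20" for x j
  proof -
    have "Z ^ j < Z ^ 20" using that(2) Z(1) by (intro power_strict_increasing) auto
    with that(1) show ?thesis unfolding Z_def by (rule le_less_trans)
  qed
  show "4 * M * s < W" by (rule less[OF U]) simp
  show "h < W" by (rule less[OF hZ]) simp
  show "(6 * h + 4) * (M * vol E A) + (h + 1) * length xs < W" by (rule less[OF B]) simp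
  show "(n + 7) * (n + 1) < W" by (rule less[OF a]) simp
qed

end

locale scaled_input = lbs_input +
  fixes s M k :: nat
  assumes par: "parameters s M k" and vol_A: "0 < vol E (set xs)" and \<alpha>_pos: "0 < \<alpha>"
begin

abbreviation "h \<equiv> 8 * s * k + 1"

sublocale fm: flow_machine n M "4 * M * s" h L xs W G
proof -
  interpret local_flow n M "4 * M * s" h L xs
    by (rule local_flow_graph[OF simple adj]) (use xs in auto)
  have "weight A = vol E A" using xs vol_adj[of A] by (simp add: weight_def dg_def)
  with parameters_small[OF par] show "flow_machine n M h L xs W G"
    by unfold_locales auto
qed

lemma weight_vol: "S \<subseteq> V \<Longrightarrow> fm.weight S = vol E S"
  by (simp add: fm.weight_def fm.dg_def vol_adj)

lemma boundary_crossing: "S \<subseteq> V \<Longrightarrow> fm.boundary S = crossing V E S"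
  by (simp add: fm.boundary_def crossing_adj[OF simple adj])

lemma M_bounds: "4 / \<sigma> + 1 \<le> real M" "real M \<le> 4 / \<sigma> + 2" "real M \<le> 6 / \<sigma>" "0 < M"
proof -
  show m: "4 / \<sigma> + 1 \<le> real M" "real M \<le> 4 / \<sigma> + 2" using par by (auto simp: parameters_def)
  have "2 \<le> 2 / \<sigma>" using \<sigma> by (simp add: field_simps)
  with m show "real M \<le> 6 / \<sigma>" by (simp add: field_simps)
  have "0 < 4 / \<sigma>" using \<sigma> by simp
  with m have "0 < real M" by linarith
  then show "0 < M" by simp
qed

lemma capacity_\<alpha>: "real (4 * M * s) * \<alpha> \<le> 48 / \<sigma>"
proof -
  have "real s * \<alpha> \<le> 2" using par by (simp add: parameters_def)
  then have "4 * real M * (real s * \<alpha>) \<le> 4 * (6 / \<sigma>) * 2"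
    using M_bounds \<sigma> \<alpha> by (intro mult_mono) auto
  then show ?thesis by (simp add: mult.assoc)
qed

context
  fixes a :: flow_state
  assumes ga: "fm.good a" and finished: "idx a = length xs"
begin

lemma cut_excess:
  assumes "sparse_cut V E (\<alpha> / (96 / \<sigma>\<^sup>2)) S" "overlapping E A \<sigma> S"
  shows "\<sigma> / 2 * real (vol E S) \<le> real (fm.excess a)"
proof -
  let ?d = "real (crossing V E S)" and ?w = "real (vol E S)"
  have S: "S \<subseteq> V" using assms by (simp add: sparse_cut_def)
  have w: "0 < ?w" using crossing_less(2)[OF assms(1)] by simp
  have "M * vol E (S \<inter> A) \<le> 4 * vol E S + fm.excess a + 4 * M * s * crossing V E S"
    using fm.source_le[OF ga finished S] weight_vol[OF S] weight_vol[of "S \<inter> A"]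
      boundary_crossing[OF S] S by (auto simp: le_infI1)
  then have "real (M * vol E (S \<inter> A)) \<le> real (4 * vol E S + fm.excess a + 4 * M * s * crossing V E S)"
    by (rule of_nat_mono)
  then have 1: "real M * real (vol E (S \<inter> A)) \<le> 4 * ?w + real (fm.excess a) + real (4 * M * s) * ?d"
    by simp
  have "\<sigma> * ?w \<le> real (vol E (S \<inter> A))" using assms(2) w by (simp add: overlapping_def le_divide_eq)
  then have "(4 / \<sigma> + 1) * (\<sigma> * ?w) \<le> real M * real (vol E (S \<inter> A))"
    using M_bounds \<sigma> w by (intro mult_mono) auto
  moreover have "(4 / \<sigma> + 1) * (\<sigma> * ?w) = 4 * ?w + \<sigma> * ?w" using \<sigma> by (simp add: field_simps)
  ultimately have 2: "\<sigma> * ?w \<le> real (fm.excess a) + real (4 * M * s) * ?d" using 1 by linarith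
  have "real (4 * M * s) * ?d \<le> real (4 * M * s) * (\<alpha> / (96 / \<sigma>\<^sup>2) * ?w)"
    using crossing_less(1)[OF assms(1)] by (intro mult_left_mono) auto
  also have "\<dots> = (real (4 * M * s) * \<alpha>) * (\<sigma>\<^sup>2 / 96 * ?w)" by (simp add: field_simps)
  also have "\<dots> \<le> (48 / \<sigma>) * (\<sigma>\<^sup>2 / 96 * ?w)"
    using capacity_\<alpha> by (intro mult_right_mono) auto
  also have "\<dots> = \<sigma> / 2 * ?w" using \<sigma> by (simp add: field_simps power2_eq_square)
  finally show ?thesis using 2 by linarith
qed

lemma answer_None:
  assumes "parked a = 0"
  shows "answers None"
proof (rule answers_None)
  show "no_cut (\<alpha> / (96 / \<sigma>\<^sup>2))"
    unfolding no_cut_def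
  proof
    assume "\<exists>S. sparse_cut V E (\<alpha> / (96 / \<sigma>\<^sup>2)) S \<and> overlapping E A \<sigma> S"
    then obtain S where S: "sparse_cut V E (\<alpha> / (96 / \<sigma>\<^sup>2)) S" "overlapping E A \<sigma> S" by blast
    have "\<sigma> / 2 * real (vol E S) \<le> 0"
      using cut_excess[OF S] fm.excess_eq_0[OF ga finished assms] by simp
    moreover have "0 < \<sigma> / 2 * real (vol E S)" using crossing_less(2)[OF S(1)] \<sigma> by simp
    ultimately show False by linarith
  qed
qed

lemma accepted_level:
  assumes "parked a \<noteq> 0"
  shows "\<exists>i. 1 \<le> i \<and> i \<le> h \<and> fm.accepted a i"
proof -
  have s: "0 < s" "1 < \<alpha> * real s \<or> (n + 1) * (n + 1) \<le> s" and k: "(n + 1) * (n + 1) \<le> 2 ^ k"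
    using par by (auto simp: parameters_def)
  have w: "vol E S < (n + 1) * (n + 1)" if "S \<subseteq> V" for S
    using vol_le[OF that] by (simp add: algebra_simps)
  have "fm.weight V < 2 ^ k" using w[of V] weight_vol[of V] k by simp
  then obtain i where i: "1 \<le> i" "i \<le> h" "2 * s * fm.boundary (fm.above a i) \<le> fm.weight (fm.above a i)"
    "0 < fm.weight (fm.above a i)"
    using fm.sparse_level[OF ga finished refl refl M_bounds(4) s(1) _ assms] by blast
  let ?b = "fm.boundary (fm.above a i)" and ?w = "fm.weight (fm.above a i)"
  have "real ?b < \<alpha> * real ?w"
  proof (cases "1 < \<alpha> * real s")
    case True
    have "real (2 * s * ?b) \<le> real ?w" using i(3) by (rule of_nat_mono)
    then have "2 * real s * real ?b \<le> 1 * real ?w" by simp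
    also have "\<dots> < \<alpha> * real s * real ?w" using True i(4) by (intro mult_strict_right_mono) auto
    finally have "real s * (2 * real ?b) < real s * (\<alpha> * real ?w)" by (simp add: mult_ac)
    then have "2 * real ?b < \<alpha> * real ?w" using s(1) by simp
    then show ?thesis by linarith
  next
    case False
    have "fm.above a i \<subseteq> V" by (auto simp: fm.above_def)
    from w[OF this] weight_vol[OF this] have "?w < (n + 1) * (n + 1)" by simp
    then have "?w < s" using False s(2) by linarith
    with i(3) have "2 * s * ?b < s" by linarith
    then have "?b = 0" by (cases ?b) auto
    then show ?thesis using \<alpha>_pos i(4) by simp
  qed
  then have "fm.accepted a i" by (simp add: fm.accepted_def)
  with i show ?thesis by blast
qed

lemma answer_Some:
  assumes i: "1 \<le> i" "i \<le> h" and acc: "fm.accepted a i"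
  shows "answers (Some (fm.above a i))"
proof -
  let ?S = "fm.above a i"
  let ?w = "real (vol E ?S)" and ?d = "real (crossing V E ?S)"
  have S: "?S \<subseteq> V" by (auto simp: fm.above_def)
  have d: "?d < \<alpha> * ?w" using acc by (simp add: fm.accepted_def weight_vol[OF S] boundary_crossing[OF S])
  have "0 \<le> ?d" by simp
  then have "0 < \<alpha> * ?w" using d by linarith
  then have w: "0 < ?w" using \<alpha>_pos zero_less_mult_pos by blast
  have half: "vol E ?S \<le> vol E (V - ?S)"
  proof -
    have "real (4 * vol E ?S) \<le> real (M * vol E A)"
      using fm.above_small[OF ga i(1)] weight_vol S xs by (intro of_nat_mono) auto
    also have "\<dots> \<le> (4 / \<sigma> + 2) * real (vol E A)"
      using M_bounds(2) by (simp add: mult_right_mono)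
    also have "\<dots> = 2 / \<sigma> * (2 * real (vol E A)) + 2 * real (vol E A)" by (simp add: field_simps)
    also have "\<dots> \<le> 2 / \<sigma> * (\<sigma> * real (vol E (V - A))) + 2 * real (vol E A)"
      using overlap_vol[OF vol_A] \<sigma> by (intro add_right_mono mult_left_mono) auto
    also have "\<dots> = 2 * real (vol E V)" using \<sigma> vol_split[of A] xs by simp
    finally have "4 * vol E ?S \<le> 2 * vol E V" by linarith
    with vol_split[OF S] show ?thesis by simp
  qed
  have sp: "sparse_cut V E \<alpha> ?S"
    using S w half d by (simp add: sparse_cut_def conductance_def divide_less_eq min_def)
  have ex: "real (fm.excess a) \<le> 54 / \<sigma> * ?w"
  proof -
    have "vol E (?S \<inter> A) \<le> vol E ?S"
      unfolding vol_def using S by (intro sum_mono2) (auto intro: finite_subset)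
    then have "M * vol E (?S \<inter> A) \<le> M * vol E ?S" by (rule mult_le_mono2)
    moreover have "fm.excess a \<le> M * vol E (?S \<inter> A) + 4 * M * s * crossing V E ?S"
      using fm.excess_le[OF ga finished i] weight_vol[of "?S \<inter> A"]
        boundary_crossing[OF S] S by (simp add: le_infI1)
    ultimately have "fm.excess a \<le> M * vol E ?S + 4 * M * s * crossing V E ?S" by linarith
    then have "real (fm.excess a) \<le> real (M * vol E ?S + 4 * M * s * crossing V E ?S)" by (rule of_nat_mono)
    also have "\<dots> = real M * ?w + real (4 * M * s) * ?d" by simp
    also have "\<dots> \<le> 6 / \<sigma> * ?w + real (4 * M * s) * (\<alpha> * ?w)"
      using M_bounds(3) d by (intro add_mono mult_right_mono mult_left_mono) auto
    also have "real (4 * M * s) * (\<alpha> * ?w) \<le> 48 / \<sigma> * ?w"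
      using mult_right_mono[OF capacity_\<alpha>, of ?w] by (simp add: mult.assoc)
    finally show ?thesis by (simp add: field_simps)
  qed
  have "real (OPT V E (\<alpha> / (96 / \<sigma>\<^sup>2)) A \<sigma>) \<le> 108 / \<sigma>\<^sup>2 * ?w"
  proof (rule OPT_le)
    fix T assume T: "sparse_cut V E (\<alpha> / (96 / \<sigma>\<^sup>2)) T" "overlapping E A \<sigma> T"
    have "\<sigma> / 2 * real (vol E T) \<le> 54 / \<sigma> * ?w" using cut_excess[OF T] ex by linarith
    then show "real (vol E T) \<le> 108 / \<sigma>\<^sup>2 * ?w" using \<sigma> by (simp add: field_simps power2_eq_square)
  qed (use w in simp)
  with sp half show ?thesis by (simp add: answers_def lbs_answer_def)
qed

end

end

section \<open>Computing the parameters\<close>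

lemma least_power:
  fixes x :: nat
  assumes "1 \<le> x"
  defines "B \<equiv> LEAST j. x \<le> 2 ^ j"
  shows "2 ^ j < x \<Longrightarrow> j < B" "B \<le> x" "real B \<le> log 2 (real x) + 1"
proof -
  have B: "x \<le> 2 ^ B" unfolding B_def by (rule LeastI[of _ x]) (simp add: less_imp_le)
  have min: "2 ^ j < x" if "j < B" for j
    using not_less_Least[OF that[unfolded B_def]] by simp
  show "j < B" if "2 ^ j < x"
  proof (rule ccontr)
    assume "\<not> j < B"
    then have "(2::nat) ^ B \<le> 2 ^ j" by (intro power_increasing) auto
    with B that show False by linarith
  qed
  have "B \<le> x \<and> real B \<le> log 2 (real x) + 1"
  proof (cases B)
    case 0
    then show ?thesis using assms by simp
  next
    case (Suc j)
    then have lt: "2 ^ j < x" using min by simp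
    have "j < 2 ^ j" by simp
    with lt have "j < x" by linarith
    moreover have "real j \<le> log 2 (real x)"
    proof -
      have "real (2 ^ j) < real x" using lt by (simp only: of_nat_less_iff)
      then have "2 powr real j \<le> real x" by (simp add: powr_realpow)
      then show ?thesis using assms by (subst le_log_iff) auto
    qed
    ultimately show ?thesis using Suc by simp
  qed
  then show "B \<le> x" "real B \<le> log 2 (real x) + 1" by auto
qed

context lbs_input
begin

lemma vol_A_sum: "vol E A = (\<Sum>i<length xs. length (L (xs ! i)))"
proof -
  have "(\<Sum>i<length xs. length (L (xs ! i))) = (\<Sum>v\<in>A. length (L v))"
    by (rule sum.reindex_bij_betw) (use xs in \<open>simp add: bij_betw_nth\<close>)
  with vol_adj[OF xs(2)] show ?thesis by simp
qed

lemma length_xs_le: "length xs \<le> n"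
  using xs card_mono[of V A] by (simp add: distinct_card)

lemma squares_less: "2 * ((n + 1) * (n + 1)) < W" "2 * (n * n) + 2 < W"
proof -
  have "2 * ((n + 1) * (n + 1)) < (n + 2) ^ 1 * ((n + 2) ^ 1 * (n + 2) ^ 1)"
    by (simp add: algebra_simps)
  also have "\<dots> = (n + 2) ^ 3" by (simp add: power3_eq_cube)
  also have "\<dots> \<le> W" by (rule power_increasing) auto
  finally show "2 * ((n + 1) * (n + 1)) < W" .
  then show "2 * (n * n) + 2 < W" by (simp add: algebra_simps)
qed

lemma volume_code:
  defines "s0 \<equiv> input_state n xs"
  shows "halts W G volume_code s0 (2 + 3 * length xs)
    (\<lambda>s. mem s = mem s0 \<and> reg s 2 = n + 1 \<and> reg s 14 = vol E A \<and>
      (\<forall>x. x \<notin> {2, 9, 14} \<longrightarrow> reg s x = reg s0 x))"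
proof -
  let ?b = "Less (Reg 9) (Reg 1)"
  let ?c = "Seq (Assign 14 (Plus (Reg 14) (Degree (Load (Reg 9))))) (incr 9)"
  let ?I = "\<lambda>(s :: state) k. mem s = mem s0 \<and> reg s 2 = n + 1 \<and> reg s 9 \<le> length xs \<and>
    reg s 14 = (\<Sum>i<reg s 9. length (L (xs ! i))) \<and>
    (\<forall>x. x \<notin> {2, 9, 14} \<longrightarrow> reg s x = reg s0 x) \<and> k = int (reg s 9)"
  let ?s1 = "s0\<lparr>reg := (reg s0)(2 := n + 1)\<rparr>"
  have n: "n + 1 < W" using squares_less by (simp add: algebra_simps)
  have r0: "reg s0 0 = n" "reg s0 1 = length xs" "reg s0 9 = 0" "reg s0 14 = 0"
      "\<And>i. i < length xs \<Longrightarrow> mem s0 i = xs ! i"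
    by (auto simp: s0_def input_state_def)
  have partial: "(\<Sum>i<j. length (L (xs ! i))) < W" if "j \<le> length xs" for j
  proof -
    have "(\<Sum>i<j. length (L (xs ! i))) \<le> vol E A"
      unfolding vol_A_sum using that by (intro sum_mono2) auto
    also have "\<dots> \<le> n * n" using xs by (intro vol_le) auto
    finally show ?thesis using squares_less by linarith
  qed
  have "halts W G (While ?b ?c) ?s1 (1 + (1 + steps ?c) * nat (int (length xs) - 0))
    (\<lambda>s. (\<exists>k. ?I s k) \<and> \<not> bval G ?b s)"
  proof (rule halts_While)
    show "?I ?s1 0" using r0 by simp
    fix s k assume I: "?I s k"
    then show "k \<le> int (length xs)" by simp
    assume "bval G ?b s"
    then have lt: "reg s 9 < length xs" using I r0 by simp
    have mem: "mem s (reg s 9) = xs ! reg s 9" using I r0 lt by simp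
    have sum: "(\<Sum>i<reg s 9. length (L (xs ! i))) + length (L (xs ! reg s 9)) < W"
      using partial[of "Suc (reg s 9)"] lt by simp
    have "safe W G ?c s" using I lt mem sum n length_xs_le by simp
    moreover have "?I (run G ?c s) (k + 1)" using I lt mem by simp
    ultimately show "safe W G ?c s \<and> (\<exists>k'>k. ?I (run G ?c s) k')"
      by (metis less_add_one)
  qed
  then have loop: "halts W G (While ?b ?c) ?s1 (1 + 3 * length xs)
    (\<lambda>s. mem s = mem s0 \<and> reg s 2 = n + 1 \<and> reg s 14 = vol E A \<and>
      (\<forall>x. x \<notin> {2, 9, 14} \<longrightarrow> reg s x = reg s0 x))"
  proof (rule halts_mono)
    fix s assume "(\<exists>k. ?I s k) \<and> \<not> bval G ?b s"
    then have "?I s (int (reg s 9))" "reg s 9 = length xs" using r0 by auto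
    then show "mem s = mem s0 \<and> reg s 2 = n + 1 \<and> reg s 14 = vol E A \<and>
      (\<forall>x. x \<notin> {2, 9, 14} \<longrightarrow> reg s x = reg s0 x)" by (simp add: vol_A_sum)
  qed simp
  have "halts W G volume_code s0 (1 + (1 + 3 * length xs))
    (\<lambda>s. mem s = mem s0 \<and> reg s 2 = n + 1 \<and> reg s 14 = vol E A \<and>
      (\<forall>x. x \<notin> {2, 9, 14} \<longrightarrow> reg s x = reg s0 x))"
    unfolding volume_code_def
    by (rule halts_Assign_Seq) (use n r0 loop in auto)
  then show ?thesis by simp
qed

definition B_alpha :: nat where
  "B_alpha = min ((n + 1) * (n + 1)) (nat \<lfloor>1 / \<alpha>\<rfloor> + 1)"

definition B_sigma :: nat where
  "B_sigma = nat \<lfloor>4 / \<sigma>\<rfloor> + 1"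

definition B_log :: nat where
  "B_log = (LEAST j. (n + 1) * (n + 1) \<le> 2 ^ j)"

lemma B_log: "2 ^ j < (n + 1) * (n + 1) \<Longrightarrow> j < B_log" "B_log \<le> (n + 1) * (n + 1)"
    "real B_log \<le> 2 * log 2 (real n + 2) + 1"
proof -
  note l = least_power[of "(n + 1) * (n + 1)", folded B_log_def]
  show "2 ^ j < (n + 1) * (n + 1) \<Longrightarrow> j < B_log" "B_log \<le> (n + 1) * (n + 1)" using l by auto
  have "log 2 (real ((n + 1) * (n + 1))) = 2 * log 2 (real (n + 1))"
    unfolding of_nat_mult by (subst log_mult) auto
  also have "\<dots> \<le> 2 * log 2 (real n + 2)" by simp
  finally show "real B_log \<le> 2 * log 2 (real n + 2) + 1" using l(3) by simp
qed

lemma B_sigma_le: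
  assumes "0 < vol E A"
  shows "4 / \<sigma> \<le> 2 * real (n * n)" "B_sigma \<le> 2 * (n * n) + 1"
proof -
  have "2 * 1 \<le> 2 * real (vol E A)" using assms by simp
  also have "\<dots> \<le> \<sigma> * real (vol E (V - A))" by (rule overlap_vol[OF assms])
  also have "\<dots> \<le> \<sigma> * real (n * n)" using \<sigma> vol_le[of "V - A"] by (intro mult_left_mono of_nat_mono) auto
  finally show le: "4 / \<sigma> \<le> 2 * real (n * n)" using \<sigma> by (simp add: divide_le_eq mult.commute)
  have "\<lfloor>4 / \<sigma>\<rfloor> \<le> int (2 * (n * n))" using le by (simp add: floor_le_iff)
  then show "B_sigma \<le> 2 * (n * n) + 1" by (simp add: B_sigma_def nat_le_iff)
qed

lemma scale_code:
  assumes vol_A: "0 < vol E A" and \<alpha>_pos: "0 < \<alpha>"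
    and s0: "reg s0 0 = n" "reg s0 1 = length xs" "reg s0 2 = n + 1" "reg s0 7 = 0"
    and mem0: "mem s0 0 < W"
  shows "halts W G scale_code s0 (11 + 2 * B_alpha + 2 * B_sigma + 3 * B_log)
    (\<lambda>st. mem st = mem s0 \<and> (\<exists>s M k. parameters s M k \<and> s \<le> B_alpha \<and> k \<le> B_log \<and>
       reg st 3 = M \<and> reg st 4 = 4 * M * s \<and> reg st 5 = 8 * s * k + 1 \<and> reg st 9 = 0 \<and>
       reg st 11 = mem s0 0 \<and> (\<forall>x. x \<notin> {3, 4, 5, 6, 7, 8, 9, 11} \<longrightarrow> reg st x = reg s0 x)))"
    (is "halts W G scale_code s0 _ ?Q")
proof -
  let ?N = "n + 1"
  have W1: "1 < W" "?N * ?N < W" "2 * (?N * ?N) < W" using squares_less by (auto simp: algebra_simps)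
  have parameters: "parameters s (Suc m) k"
    if s: "1 \<le> s" "s \<le> B_alpha" "\<not> (\<not> 1 < \<alpha> * real s \<and> s < ?N * ?N)"
        "s = 1 \<or> (\<not> 1 < \<alpha> * real (s - 1) \<and> s - 1 < ?N * ?N)"
      and m: "1 \<le> m" "4 < \<sigma> * real m" "m = 1 \<or> \<not> 4 < \<sigma> * real (m - 1)"
      and k: "?N * ?N \<le> 2 ^ k" "k \<le> B_log" for s m k
  proof -
    have "real s * \<alpha> \<le> 2"
    proof (cases "s = 1")
      case False
      then have "\<alpha> * real (s - 1) \<le> 1" using s(4) by auto
      then have "\<alpha> * real s \<le> 1 + \<alpha>" using s(1) by (simp add: of_nat_diff algebra_simps)
      then show ?thesis using \<alpha> by (simp add: mult.commute)
    qed (use \<alpha> in simp)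
    moreover have "4 / \<sigma> < real m" using m(2) \<sigma> by (simp add: divide_less_eq mult.commute)
    moreover have m_le: "real m \<le> 4 / \<sigma> + 1"
    proof (cases "m = 1")
      case False
      then have "\<sigma> * (real m - 1) \<le> 4" using m by (auto simp: of_nat_diff)
      then have "real m - 1 \<le> 4 / \<sigma>" using \<sigma> by (simp add: le_divide_eq mult.commute)
      then show ?thesis by simp
    qed (use \<sigma> in simp)
    moreover have "Suc m \<le> 2 * (n * n) + 2"
    proof -
      have "real m \<le> real (2 * (n * n) + 1)" using m_le B_sigma_le(1)[OF vol_A] by simp
      then have "m \<le> 2 * (n * n) + 1" by (simp only: of_nat_le_iff)
      then show ?thesis by simp
    qed
    moreover have "real k \<le> 2 * log 2 (real n + 2) + 1"
      using k(2) B_log(3) by (meson of_nat_mono order_trans)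
    moreover have "k \<le> ?N * ?N" using k(2) B_log(2) by (rule order_trans)
    moreover have "s \<le> ?N * ?N" using s(2) by (simp add: B_alpha_def)
    ultimately show ?thesis using s k unfolding parameters_def by auto
  qed
  have small: "4 * Suc m * s < W" "8 * s * k + 1 < W" if "parameters s (Suc m) k" for s m k
    using parameters_small(1,2)[OF that] by auto
  let ?s1 = "s0\<lparr>reg := (reg s0)(9 := 0, 6 := 1)\<rparr>"
  let ?s2 = "\<lambda>s. s0\<lparr>reg := (reg s0)(9 := 0, 6 := s, 3 := 1)\<rparr>"
  let ?s3 = "\<lambda>s m. s0\<lparr>reg := (reg s0)(9 := 0, 6 := s, 3 := Suc m, 8 := 1)\<rparr>"
  let ?s4 = "\<lambda>s m k. s0\<lparr>reg := (reg s0)(9 := 0, 6 := s, 3 := Suc m, 8 := 2 ^ k, 7 := k)\<rparr>"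
  let ?c4 = "Seq (Assign 4 (Times (Times (Const 4) (Reg 3)) (Reg 6)))
    (Seq (Assign 5 (Plus (Times (Times (Const 8) (Reg 6)) (Reg 7)) (Const 1)))
         (Assign 11 (cell 0 (Const 0))))"
  let ?P1 = "\<lambda>s. \<not> 1 < \<alpha> * real s \<and> s < ?N * ?N"
  let ?P2 = "\<lambda>m. \<not> 4 < \<sigma> * real m"
  let ?R1 = "\<lambda>s. 1 \<le> s \<and> s \<le> B_alpha \<and> \<not> ?P1 s \<and> (s = 1 \<or> ?P1 (s - 1))"
  let ?R2 = "\<lambda>m. 1 \<le> m \<and> m \<le> B_sigma \<and> \<not> ?P2 m \<and> (m = 1 \<or> ?P2 (m - 1))"
  have 4: "halts W G ?c4 (?s4 s m k) (1 + (1 + 1)) ?Q"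
    if p: "parameters s (Suc m) k" and le: "s \<le> B_alpha" "k \<le> B_log" for s m k
  proof -
    have "?Q (?s4 s m k\<lparr>reg := (reg (?s4 s m k))(4 := 4 * Suc m * s, 5 := 8 * s * k + 1, 11 := mem s0 0)\<rparr>)"
      using p le by (intro conjI exI[of _ s] exI[of _ "Suc m"] exI[of _ k]) auto
    then show ?thesis
      using small[OF p] mem0 s0
      by (intro halts_Assign_Seq halts_Assign) (auto simp: addr_def)
  qed
  have 3: "halts W G (Seq (While (Less (Reg 8) (Times (Reg 2) (Reg 2)))
            (Seq (Assign 8 (Times (Reg 8) (Const 2))) (incr 7))) ?c4) (?s3 s m)
      ((1 + 3 * B_log) + (1 + (1 + 1))) ?Q" if R: "?R1 s" "?R2 m" for s m
  proof (rule halts_Seq)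
    show "halts W G (While (Less (Reg 8) (Times (Reg 2) (Reg 2)))
            (Seq (Assign 8 (Times (Reg 8) (Const 2))) (incr 7))) (?s3 s m) (1 + 3 * B_log)
        (\<lambda>st. \<exists>k. st = (?s3 s m)\<lparr>reg := (reg (?s3 s m))(8 := 2 ^ k, 7 := k)\<rparr> \<and> ?N * ?N \<le> 2 ^ k \<and> k \<le> B_log)"
      by (rule halts_doubling) (use s0 B_log W1 in auto)
    fix st assume "\<exists>k. st = (?s3 s m)\<lparr>reg := (reg (?s3 s m))(8 := 2 ^ k, 7 := k)\<rparr> \<and> ?N * ?N \<le> 2 ^ k \<and> k \<le> B_log"
    then obtain k where k: "st = ?s4 s m k" "?N * ?N \<le> 2 ^ k" "k \<le> B_log" by auto
    show "halts W G ?c4 st (1 + (1 + 1)) ?Q"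
      unfolding k(1) using 4 parameters R k by auto
  qed
  have 2: "halts W G (Seq (While (Neg (Less_sigma (Const 4) (Reg 3))) (incr 3))
      (Seq (incr 3) (Seq (Assign 8 (Const 1)) (Seq (While (Less (Reg 8) (Times (Reg 2) (Reg 2)))
            (Seq (Assign 8 (Times (Reg 8) (Const 2))) (incr 7))) ?c4)))) (?s2 s)
      ((1 + 2 * B_sigma) + (1 + (1 + ((1 + 3 * B_log) + (1 + (1 + 1)))))) ?Q" if R: "?R1 s" for s
  proof (rule halts_Seq)
    have "m < B_sigma" if "?P2 m" for m
    proof -
      have "real m \<le> 4 / \<sigma>" using that \<sigma> by (simp add: le_divide_eq mult.commute)
      then have "m \<le> nat \<lfloor>4 / \<sigma>\<rfloor>" by (rule le_nat_floor)
      then show ?thesis by (simp add: B_sigma_def)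
    qed
    moreover have "B_sigma < W" using B_sigma_le(2)[OF vol_A] squares_less(2) by linarith
    ultimately show "halts W G (While (Neg (Less_sigma (Const 4) (Reg 3))) (incr 3)) (?s2 s) (1 + 2 * B_sigma)
        (\<lambda>st. \<exists>m. st = (?s2 s)\<lparr>reg := (reg (?s2 s))(3 := m)\<rparr> \<and> 1 \<le> m \<and> m \<le> B_sigma \<and> \<not> ?P2 m \<and>
          (m = 1 \<or> ?P2 (m - 1)))"
      by (intro halts_search) (auto simp: B_sigma_def)
    fix st assume "\<exists>m. st = (?s2 s)\<lparr>reg := (reg (?s2 s))(3 := m)\<rparr> \<and> 1 \<le> m \<and> m \<le> B_sigma \<and> \<not> ?P2 m \<and>
          (m = 1 \<or> ?P2 (m - 1))"
    then obtain m where m: "st = (?s2 s)\<lparr>reg := (reg (?s2 s))(3 := m)\<rparr>" "?R2 m" by auto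
    have "Suc m < W" using m(2) B_sigma_le(2)[OF vol_A] squares_less(2) by linarith
    then show "halts W G (Seq (incr 3) (Seq (Assign 8 (Const 1)) (Seq (While (Less (Reg 8) (Times (Reg 2) (Reg 2)))
            (Seq (Assign 8 (Times (Reg 8) (Const 2))) (incr 7))) ?c4))) st
        (1 + (1 + ((1 + 3 * B_log) + (1 + (1 + 1))))) ?Q"
      unfolding m(1) using 3[OF R m(2)] W1
      by (intro halts_Assign_Seq) auto
  qed
  have 1: "halts W G (Seq (While (Conj (Neg (Less_alpha (Const 1) (Reg 6))) (Less (Reg 6) (Times (Reg 2) (Reg 2)))) (incr 6))
      (Seq (Assign 3 (Const 1)) (Seq (While (Neg (Less_sigma (Const 4) (Reg 3))) (incr 3))
      (Seq (incr 3) (Seq (Assign 8 (Const 1)) (Seq (While (Less (Reg 8) (Times (Reg 2) (Reg 2)))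
            (Seq (Assign 8 (Times (Reg 8) (Const 2))) (incr 7))) ?c4)))))) ?s1
      ((1 + 2 * B_alpha) + (1 + ((1 + 2 * B_sigma) + (1 + (1 + ((1 + 3 * B_log) + (1 + (1 + 1)))))))) ?Q"
  proof (rule halts_Seq)
    have "s < B_alpha" if "?P1 s" for s
    proof -
      have "real s \<le> 1 / \<alpha>" using that \<alpha>_pos by (simp add: le_divide_eq mult.commute)
      then have "s \<le> nat \<lfloor>1 / \<alpha>\<rfloor>" by (rule le_nat_floor)
      then show ?thesis unfolding B_alpha_def min_less_iff_conj using that by auto
    qed
    moreover have "B_alpha < W" using W1 by (simp add: B_alpha_def)
    moreover have "1 \<le> B_alpha" by (simp add: B_alpha_def)
    ultimately show "halts W G (While (Conj (Neg (Less_alpha (Const 1) (Reg 6))) (Less (Reg 6) (Times (Reg 2) (Reg 2)))) (incr 6))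
        ?s1 (1 + 2 * B_alpha)
        (\<lambda>st. \<exists>s. st = ?s1\<lparr>reg := (reg ?s1)(6 := s)\<rparr> \<and> 1 \<le> s \<and> s \<le> B_alpha \<and> \<not> ?P1 s \<and>
          (s = 1 \<or> ?P1 (s - 1)))"
      using s0 by (intro halts_search) auto
    fix st assume "\<exists>s. st = ?s1\<lparr>reg := (reg ?s1)(6 := s)\<rparr> \<and> 1 \<le> s \<and> s \<le> B_alpha \<and> \<not> ?P1 s \<and>
          (s = 1 \<or> ?P1 (s - 1))"
    then obtain s where s: "st = ?s1\<lparr>reg := (reg ?s1)(6 := s)\<rparr>" "?R1 s" by blast
    show "halts W G (Seq (Assign 3 (Const 1)) (Seq (While (Neg (Less_sigma (Const 4) (Reg 3))) (incr 3))
      (Seq (incr 3) (Seq (Assign 8 (Const 1)) (Seq (While (Less (Reg 8) (Times (Reg 2) (Reg 2)))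
            (Seq (Assign 8 (Times (Reg 8) (Const 2))) (incr 7))) ?c4))))) st
        (1 + ((1 + 2 * B_sigma) + (1 + (1 + ((1 + 3 * B_log) + (1 + (1 + 1))))))) ?Q"
      unfolding s(1) using 2[OF s(2)] W1
      by (intro halts_Assign_Seq) auto
  qed
  have "halts W G scale_code s0
     (1 + (1 + ((1 + 2 * B_alpha) + (1 + ((1 + 2 * B_sigma) + (1 + (1 + ((1 + 3 * B_log) + (1 + (1 + 1)))))))))) ?Q"
    unfolding scale_code_def using 1 W1
    by (intro halts_Assign_Seq) auto
  then show ?thesis by (rule halts_mono) auto
qed

end

section \<open>Running time\<close>

context scaled_input
begin

definition route_time :: nat where
  "route_time = 1 + (1 + steps move_code) * ((6 * h + 4) * (M * vol E A) + (h + 1) * length xs)"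

definition output_time :: nat where
  "output_time = 11 + (1 + steps scan_code) * ((h + 1) * (M * vol E A + 1))"

lemma refines_start:
  assumes "mem st = mem (input_state n xs)"
    and "reg st 0 = n" "reg st 1 = length xs" "reg st 2 = n + 1" "reg st 3 = M"
      "reg st 4 = 4 * M * s" "reg st 5 = h" "reg st 9 = 0" "reg st 10 = 0"
      "reg st 11 = mem st 0" "reg st 12 = 0" "reg st 13 = 0"
  shows "fm.refines st fm.start"
proof -
  have zero: "mem st (addr (n + 1) r v) = 0" if "1 \<le> r" for r v
  proof -
    have "length xs \<le> n + 1" using length_xs_le by simp
    also have "\<dots> \<le> r * (n + 1)" using that by (cases r) auto
    also have "\<dots> \<le> addr (n + 1) r v" by (simp add: addr_def)
    finally show ?thesis by (simp add: assms(1) input_state_def)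
  qed
  have "mem st (addr (n + 1) 0 v) = (if v < length xs then xs ! v else 0)" for v
    by (simp add: assms(1) input_state_def addr_def)
  moreover have "mem st 0 = (if xs = [] then 0 else xs ! 0)"
    by (simp add: assms(1) input_state_def)
  ultimately show ?thesis
    using assms zero unfolding fm.refines_def by (simp add: fm.start_def)
qed

lemma output_code:
  assumes ref: "fm.refines st a" and ga: "fm.good a" and finished: "idx a = length xs"
  shows "halts W G output_code st output_time (\<lambda>st. answers (result st))"
proof -
  note read = fm.refinesD[OF ref]
  have small: "1 < W" "5 * (n + 1) < W" "n < W" using fm.W_addr by (auto simp: algebra_simps)
  let ?T = "(1 + (1 + steps scan_code) * ((h + 1) * (M * vol E A + 1))) + (1 + (1 + 1))"
  have "halts W G output_code st (1 + (1 + (1 + (1 + (1 + (1 + (1 + ?T))))))) (\<lambda>st. answers (result st))"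
    unfolding output_code_def
  proof (rule halts_Cond)
    assume "\<not> bval G (Less (Const 0) (Reg 13)) st"
    then have "parked a = 0" using read by simp
    then have "answers None" by (rule answer_None[OF ga finished])
    then have "halts W G (Assign 0 (Const 0)) st 1 (\<lambda>st. answers (result st))"
      using small by (intro halts_Assign) (auto simp: result_def)
    then show "halts W G (Assign 0 (Const 0)) st (1 + (1 + (1 + (1 + (1 + (1 + ?T))))))
        (\<lambda>st. answers (result st))"
      by (rule halts_mono) auto
  next
    assume "bval G (Less (Const 0) (Reg 13)) st"
    then have parked: "parked a \<noteq> 0" using read by simp
    let ?s1 = "st\<lparr>reg := (reg st)(16 := 1, 17 := 0, 18 := 0, 19 := 0, 20 := 0, 21 := 0)\<rparr>"
    let ?out = "Seq (Assign 0 (Const 1)) (Seq (Assign 1 (Times (Const 5) (Reg 2))) (Assign 2 (Reg 19)))"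
    have ref1: "fm.refines ?s1 a"
      using ref by (rule fm.refines_cong) (use fm.touched_facts[OF ga] in auto)
    have "halts W G (Seq (While scan_test scan_code) ?out) ?s1 ?T (\<lambda>st. answers (result st))"
    proof (rule halts_Seq)
      show "halts W G (While scan_test scan_code) ?s1
          (1 + (1 + steps scan_code) * ((h + 1) * (M * vol E A + 1)))
          (\<lambda>s'. fm.refines s' a \<and> reg s' 19 \<le> n \<and> (\<exists>i. 1 \<le> i \<and> i \<le> h \<and> fm.accepted a i \<and>
            mem s' ` {addr (n + 1) 5 j | j. j < reg s' 19} = fm.above a i))"
        using fm.scan_loop[OF ga ref1 _ _ _ _ _ _ accepted_level[OF ga finished parked]]
          weight_vol[OF xs(2)] by simp
      fix s'
      assume "fm.refines s' a \<and> reg s' 19 \<le> n \<and> (\<exists>i. 1 \<le> i \<and> i \<le> h \<and> fm.accepted a i \<and>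
            mem s' ` {addr (n + 1) 5 j | j. j < reg s' 19} = fm.above a i)"
      then obtain i where s': "fm.refines s' a" "reg s' 19 \<le> n"
        and i: "1 \<le> i" "i \<le> h" "fm.accepted a i"
          "mem s' ` {addr (n + 1) 5 j | j. j < reg s' 19} = fm.above a i"
        by blast
      have N: "reg s' 2 = n + 1" using fm.refinesD(3)[OF s'(1)] .
      have "(\<lambda>j. mem s' (5 * (n + 1) + j)) ` {..<reg s' 19} = fm.above a i"
        using i(4) by (auto simp: addr_def image_def)
      then have "answers (Some ((\<lambda>j. mem s' (5 * (n + 1) + j)) ` {..<reg s' 19}))"
        using answer_Some[OF ga finished i(1-3)] by simp
      then show "halts W G ?out s' (1 + (1 + 1)) (\<lambda>st. answers (result st))"
        using small N s'(2)
        by (intro halts_Assign_Seq halts_Assign) (auto simp: result_def)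
    qed
    then show "halts W G (Seq (Assign 16 (Const 1)) (Seq (Assign 17 (Const 0)) (Seq (Assign 18 (Const 0))
        (Seq (Assign 19 (Const 0)) (Seq (Assign 20 (Const 0)) (Seq (Assign 21 (Const 0))
        (Seq (While scan_test scan_code) ?out))))))) st
        (1 + (1 + (1 + (1 + (1 + (1 + ?T)))))) (\<lambda>st. answers (result st))"
      using small by (intro halts_Assign_Seq) auto
  qed
  then show ?thesis by (rule halts_mono) (auto simp: output_time_def)
qed

lemma route_and_output:
  assumes "fm.refines st fm.start"
  shows "halts W G (Seq (While (Less (Reg 9) (Reg 1)) move_code) output_code) st
    (route_time + output_time) (\<lambda>st. answers (result st))"
proof (rule halts_Seq)
  show "halts W G (While (Less (Reg 9) (Reg 1)) move_code) st route_time
      (\<lambda>s'. \<exists>a. fm.refines s' a \<and> fm.good a \<and> idx a = length xs)"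
    using fm.route_loop[OF assms] weight_vol[OF xs(2)] by (simp add: route_time_def)
qed (use output_code in blast)

end

definition time_factor :: real where
  "time_factor = 61 + 1838 * real (1 + steps move_code) + 350 * real (1 + steps scan_code)"

context lbs_input
begin

definition budget :: real where
  "budget = log 2 (real n + 2) * (real (Max {1, card A, vol E A}) / (\<alpha> * \<sigma>\<^sup>2))"

context
  assumes \<alpha>_pos: "0 < \<alpha>"
begin

lemma log_ge_1: "1 \<le> log 2 (real n + 2)"
  by (subst le_log_iff) auto

lemma size_ge: "1 \<le> real (Max {1, card A, vol E A})"
    "real (length xs) \<le> real (Max {1, card A, vol E A})"
    "real (vol E A) \<le> real (Max {1, card A, vol E A})"
  using xs(1) by (auto simp: distinct_card)

lemma budget_ge:
  assumes "0 \<le> l" "l \<le> log 2 (real n + 2)" "0 \<le> x" "x \<le> real (Max {1, card A, vol E A})"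
    and "0 \<le> u" "u \<le> 1 / \<alpha>" "0 \<le> v" "v \<le> 1 / \<sigma>"
  shows "l * x * u * v \<le> budget"
proof -
  have "\<sigma>\<^sup>2 \<le> \<sigma>" using \<sigma> by (simp add: power2_eq_square)
  then have "1 / \<sigma> \<le> 1 / \<sigma>\<^sup>2" using \<sigma> by (simp add: frac_le)
  then have "v \<le> 1 / \<sigma>\<^sup>2" using assms(8) by linarith
  then have "l * x * u * v
      \<le> log 2 (real n + 2) * real (Max {1, card A, vol E A}) * (1 / \<alpha>) * (1 / \<sigma>\<^sup>2)"
    using assms log_ge_1 size_ge(1) \<alpha>_pos by (intro mult_mono mult_nonneg_nonneg) auto
  then show ?thesis by (simp add: budget_def)
qed

lemma inverse_ge: "1 \<le> 1 / \<alpha>" "1 \<le> 1 / \<sigma>"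
  using \<alpha> \<sigma> \<alpha>_pos by auto

lemma budget_bounds: "1 \<le> budget" "real (length xs) \<le> budget" "1 / \<alpha> \<le> budget" "1 / \<sigma> \<le> budget"
    "log 2 (real n + 2) \<le> budget"
  using budget_ge[of 1 1 1 1] budget_ge[of 1 "real (length xs)" 1 1] budget_ge[of 1 1 "1 / \<alpha>" 1]
    budget_ge[of 1 1 1 "1 / \<sigma>"] budget_ge[of "log 2 (real n + 2)" 1 1 1]
    log_ge_1 size_ge inverse_ge \<sigma> \<alpha>_pos
  by auto

lemma B_bounds: "real B_alpha \<le> 2 * budget" "real B_sigma \<le> 5 * budget" "real B_log \<le> 3 * budget"
proof -
  have "real B_alpha \<le> real (nat \<lfloor>1 / \<alpha>\<rfloor> + 1)" unfolding B_alpha_def by (intro of_nat_mono) simp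
  also have "\<dots> \<le> 1 / \<alpha> + 1" using \<alpha>_pos by (simp add: of_nat_nat)
  finally show "real B_alpha \<le> 2 * budget" using budget_bounds by linarith
  have "real B_sigma \<le> 4 * (1 / \<sigma>) + 1" using \<sigma> by (simp add: B_sigma_def of_nat_nat)
  then show "real B_sigma \<le> 5 * budget" using budget_bounds by linarith
  show "real B_log \<le> 3 * budget" using B_log(3) budget_bounds by linarith
qed

lemma route_output_time:
  assumes par: "parameters s M k" and k: "k \<le> B_log" and vol_A: "0 < vol E A"
  defines "h \<equiv> 8 * s * k + 1"
  shows "real ((6 * h + 4) * (M * vol E A) + (h + 1) * length xs) \<le> 1838 * budget"
    "real ((h + 1) * (M * vol E A + 1)) \<le> 350 * budget"
proof -
  interpret scaled_input n E L xs \<sigma> \<alpha> s M k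
    by unfold_locales (use par vol_A \<alpha>_pos in auto)
  define l where "l = log 2 (real n + 2)"
  define x where "x = real (Max {1, card A, vol E A})"
  have l: "1 \<le> l" using log_ge_1 by (simp add: l_def)
  have x: "1 \<le> x" "real (length xs) \<le> x" "real (vol E A) \<le> x" using size_ge by (auto simp: x_def)
  have s: "real s \<le> 2 / \<alpha>" using par \<alpha>_pos by (simp add: parameters_def le_divide_eq)
  have kl: "real k \<le> 3 * l"
    using k B_log(3) l unfolding l_def by (smt (verit) of_nat_mono)
  have la: "1 \<le> l / \<alpha>" using l \<alpha> \<alpha>_pos by (simp add: le_divide_eq)
  have "real (s * k) \<le> (2 / \<alpha>) * (3 * l)"
    unfolding of_nat_mult using s kl \<alpha>_pos by (intro mult_mono) auto
  then have "real h \<le> 48 * (l / \<alpha>) + 1" by (simp add: h_def)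
  then have hl: "real h \<le> 49 * (l / \<alpha>)" using la by linarith
  have "real (M * vol E A) \<le> (6 / \<sigma>) * x"
    unfolding of_nat_mult using M_bounds x \<sigma> by (intro mult_mono) auto
  then have Mv: "real (M * vol E A) \<le> 6 * (x / \<sigma>)" by simp
  have xs1: "1 \<le> x / \<sigma>" "x \<le> x / \<sigma>" using x \<sigma> by (auto simp: le_divide_eq mult_le_cancel_left1)
  have P: "(l / \<alpha>) * (x / \<sigma>) \<le> budget"
    using budget_ge[of l x "1 / \<alpha>" "1 / \<sigma>"] l x \<alpha>_pos \<sigma> by (simp add: l_def x_def)
  have "real ((6 * h + 4) * (M * vol E A)) \<le> (298 * (l / \<alpha>)) * (6 * (x / \<sigma>))"
    unfolding of_nat_mult[of "6 * h + 4"] using hl la Mv by (intro mult_mono) auto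
  then have 1: "real ((6 * h + 4) * (M * vol E A)) \<le> 1788 * budget" using P by simp
  have "real ((h + 1) * length xs) \<le> (50 * (l / \<alpha>)) * (x / \<sigma>)"
    unfolding of_nat_mult using hl la x xs1 by (intro mult_mono) auto
  then have 2: "real ((h + 1) * length xs) \<le> 50 * budget" using P by simp
  show "real ((6 * h + 4) * (M * vol E A) + (h + 1) * length xs) \<le> 1838 * budget"
    using 1 2 unfolding of_nat_add by linarith
  have "real ((h + 1) * (M * vol E A + 1)) \<le> (50 * (l / \<alpha>)) * (7 * (x / \<sigma>))"
    unfolding of_nat_mult[of "h + 1"] using hl la Mv xs1 by (intro mult_mono) auto
  then show "real ((h + 1) * (M * vol E A + 1)) \<le> 350 * budget" using P by simp
qed

lemma lbs_code_positive:
  "halts W G lbs_code (input_state n xs) (nat \<lfloor>time_factor * budget\<rfloor>) (\<lambda>st. answers (result st))"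
proof -
  let ?s0 = "input_state n xs"
  let ?R = "nat \<lfloor>(time_factor - 49) * budget\<rfloor>"
  let ?T = "11 + 2 * B_alpha + 2 * B_sigma + 3 * B_log"
  have "1 < W" using squares_less by simp
  have "halts W G (Cond (Less (Const 0) (Reg 14))
      (Seq scale_code (Seq (While (Less (Reg 9) (Reg 1)) move_code) output_code)) (Assign 0 (Const 0))) st
      (1 + (?T + ?R)) (\<lambda>st. answers (result st))"
    if st: "mem st = mem ?s0 \<and> reg st 2 = n + 1 \<and> reg st 14 = vol E A \<and>
      (\<forall>x. x \<notin> {2, 9, 14} \<longrightarrow> reg st x = reg ?s0 x)" for st
  proof (rule halts_Cond)
    assume "\<not> bval G (Less (Const 0) (Reg 14)) st"
    then have "vol E A = 0" using st by simp
    then have "answers None" using no_cut_trivial answers_None by blast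
    then have "halts W G (Assign 0 (Const 0)) st 1 (\<lambda>st. answers (result st))"
      using \<open>1 < W\<close> by (intro halts_Assign) (auto simp: result_def)
    then show "halts W G (Assign 0 (Const 0)) st (?T + ?R) (\<lambda>st. answers (result st))"
      by (rule halts_mono) auto
  next
    assume "bval G (Less (Const 0) (Reg 14)) st"
    then have vol_A: "0 < vol E A" using st by simp
    have regs: "reg st 0 = n" "reg st 1 = length xs" "reg st 2 = n + 1" "reg st 7 = 0"
        "reg st 10 = 0" "reg st 12 = 0" "reg st 13 = 0"
      using st by (auto simp: input_state_def)
    have "mem st 0 < W"
    proof -
      have "mem st 0 \<le> n" using st xs(2) by (cases xs) (auto simp: input_state_def)
      then show ?thesis using squares_less by simp
    qed
    note scale = scale_code[OF vol_A \<alpha>_pos regs(1-4) this]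
    show "halts W G (Seq scale_code (Seq (While (Less (Reg 9) (Reg 1)) move_code) output_code)) st
        (?T + ?R) (\<lambda>st. answers (result st))"
    proof (rule halts_Seq[OF scale], elim conjE exE)
      fix st' :: state and s M k
      assume mem: "mem st' = mem st" and par: "parameters s M k" and k: "k \<le> B_log"
        and r: "reg st' 3 = M" "reg st' 4 = 4 * M * s" "reg st' 5 = 8 * s * k + 1" "reg st' 9 = 0"
          "reg st' 11 = mem st 0" "\<forall>x. x \<notin> {3, 4, 5, 6, 7, 8, 9, 11} \<longrightarrow> reg st' x = reg st x"
      interpret scaled_input n E L xs \<sigma> \<alpha> s M k
        by unfold_locales (use par vol_A \<alpha>_pos in auto)
      have "fm.refines st' fm.start"
        by (rule refines_start) (use mem r regs st in auto)
      then have "halts W G (Seq (While (Less (Reg 9) (Reg 1)) move_code) output_code) st'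
        (route_time + output_time) (\<lambda>st. answers (result st))" by (rule route_and_output)
      moreover have "route_time + output_time \<le> ?R"
      proof (rule le_nat_floor)
        note t = route_output_time[OF par k vol_A]
        have "real route_time \<le> 1 + real (1 + steps move_code) * (1838 * budget)"
          unfolding route_time_def of_nat_add[of 1] of_nat_mult[of "1 + steps move_code"] of_nat_1
          by (intro add_left_mono mult_left_mono t(1)) simp
        moreover have "real output_time \<le> 11 + real (1 + steps scan_code) * (350 * budget)"
          unfolding output_time_def of_nat_add[of 11] of_nat_mult[of "1 + steps scan_code"] of_nat_numeral
          by (intro add_left_mono mult_left_mono t(2)) simp
        moreover have "(time_factor - 49) * budget = 12 * budget
            + real (1 + steps move_code) * (1838 * budget) + real (1 + steps scan_code) * (350 * budget)"
          by (simp add: time_factor_def algebra_simps)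
        ultimately show "real (route_time + output_time) \<le> (time_factor - 49) * budget"
          using budget_bounds(1) unfolding of_nat_add[of route_time] by linarith
      qed
      ultimately show "halts W G (Seq (While (Less (Reg 9) (Reg 1)) move_code) output_code) st'
          ?R (\<lambda>st. answers (result st))"
        by (rule halts_mono)
    qed
  qed
  then have "halts W G (Seq volume_code (Cond (Less (Const 0) (Reg 14))
      (Seq scale_code (Seq (While (Less (Reg 9) (Reg 1)) move_code) output_code)) (Assign 0 (Const 0)))) ?s0
      ((2 + 3 * length xs) + (1 + (?T + ?R))) (\<lambda>st. answers (result st))"
    by (rule halts_Seq[OF volume_code])
  then have "halts W G lbs_code ?s0 (1 + ((2 + 3 * length xs) + (1 + (?T + ?R)))) (\<lambda>st. answers (result st))"
    unfolding lbs_code_def using \<alpha>_pos by (intro halts_Cond) auto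
  then show ?thesis
  proof (rule halts_mono)
    show "1 + ((2 + 3 * length xs) + (1 + (?T + ?R))) \<le> nat \<lfloor>time_factor * budget\<rfloor>"
    proof (rule le_nat_floor)
      have "0 \<le> time_factor - 49" by (simp add: time_factor_def)
      then have "0 \<le> (time_factor - 49) * budget" using budget_bounds(1) by simp
      then have "real ?R \<le> (time_factor - 49) * budget" by (rule of_nat_floor)
      moreover have "(time_factor - 49) * budget + 49 * budget = time_factor * budget"
        by (simp add: algebra_simps)
      moreover have "real (1 + ((2 + 3 * length xs) + (1 + (?T + ?R))))
          = 15 + 3 * real (length xs) + 2 * real B_alpha + 2 * real B_sigma + 3 * real B_log + real ?R"
        by simp
      ultimately show "real (1 + ((2 + 3 * length xs) + (1 + (?T + ?R)))) \<le> time_factor * budget"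
        using budget_bounds(1,2) B_bounds by linarith
    qed
  qed
qed

end

lemma lbs_code_zero:
  assumes "\<alpha> = 0"
  shows "halts W G lbs_code (input_state n xs) 2 (\<lambda>st. answers (result st))"
proof -
  have "answers None" using assms no_cut_trivial answers_None by blast
  moreover have "0 < W" by simp
  ultimately have "halts W G (Assign 0 (Const 0)) (input_state n xs) 1 (\<lambda>st. answers (result st))"
    by (intro halts_Assign) (auto simp: result_def)
  then have "halts W G lbs_code (input_state n xs) (1 + 1) (\<lambda>st. answers (result st))"
    unfolding lbs_code_def using assms by (intro halts_Cond) auto
  then show ?thesis by (rule halts_mono) auto
qed

end

theorem theorem4p4:
  shows "\<exists>(c_size :: real \<Rightarrow> real) (c_con :: real \<Rightarrow> real) (K :: real).
    (\<forall>\<sigma>. 0 < \<sigma> \<and> \<sigma> \<le> 1 \<longrightarrow>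
        1 \<le> c_size \<sigma> \<and> c_size \<sigma> \<le> K / \<sigma>\<^sup>2 \<and> 1 \<le> c_con \<sigma> \<and> c_con \<sigma> \<le> K / \<sigma>\<^sup>2) \<and>
    (\<exists>(P :: com) (C :: real) (k :: nat) (d :: nat).
      \<forall>(n :: nat) (V :: nat set) (E :: nat set set) (L :: nat \<Rightarrow> nat list)
        (A :: nat set) (xs :: nat list) (\<sigma> :: real) (\<alpha> :: real).
        V = {..<n} \<and> simple_graph V E \<and> adjacency_lists n E L \<and>
        A \<subseteq> V \<and> distinct xs \<and> set xs = A \<and>
        0 \<le> \<alpha> \<and> \<alpha> \<le> 1 \<and>
        2 * vol E A \<le> vol E (V - A) \<and>
        0 < \<sigma> \<and> 2 * real (vol E A) / real (vol E (V - A)) \<le> \<sigma> \<and> \<sigma> \<le> 1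
        \<longrightarrow>
        (\<exists>t s. exec ((n + 2) ^ d) \<lparr>adj = L, alpha = \<alpha>, sigma = \<sigma>\<rparr> P (input_state n xs) t s \<and>
          (\<alpha> > 0 \<longrightarrow>
             real t \<le> C * log 2 (real n + 2) ^ k *
                       (real (Max {1, card A, vol E A}) / (\<alpha> * \<sigma>\<^sup>2))) \<and>
          lbs_answer (c_size \<sigma>) (c_con \<sigma>) V E A \<sigma> \<alpha> (result s) \<and>
          (result s = None \<longrightarrow>
             \<not> (\<exists>S. sparse_cut V E (\<alpha> / c_con \<sigma>) S \<and> overlapping E A \<sigma> S))))"
proof (intro exI conjI)
  let ?c_size = "\<lambda>\<sigma> :: real. 108 / \<sigma>\<^sup>2" and ?c_con = "\<lambda>\<sigma> :: real. 96 / \<sigma>\<^sup>2"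
  show "\<forall>\<sigma>. 0 < \<sigma> \<and> \<sigma> \<le> 1 \<longrightarrow> 1 \<le> ?c_size \<sigma> \<and> ?c_size \<sigma> \<le> 108 / \<sigma>\<^sup>2
      \<and> 1 \<le> ?c_con \<sigma> \<and> ?c_con \<sigma> \<le> 108 / \<sigma>\<^sup>2"
  proof (intro allI impI)
    fix \<sigma> :: real assume \<sigma>: "0 < \<sigma> \<and> \<sigma> \<le> 1"
    then have "\<sigma>\<^sup>2 \<le> 1" "0 < \<sigma>\<^sup>2" by (auto simp: power_le_one)
    then show "1 \<le> ?c_size \<sigma> \<and> ?c_size \<sigma> \<le> 108 / \<sigma>\<^sup>2 \<and> 1 \<le> ?c_con \<sigma> \<and> ?c_con \<sigma> \<le> 108 / \<sigma>\<^sup>2"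
      by (simp add: le_divide_eq divide_right_mono)
  qed
  show "\<forall>n V E L A xs \<sigma> \<alpha>.
        V = {..<n} \<and> simple_graph V E \<and> adjacency_lists n E L \<and>
        A \<subseteq> V \<and> distinct xs \<and> set xs = A \<and> 0 \<le> \<alpha> \<and> \<alpha> \<le> 1 \<and>
        2 * vol E A \<le> vol E (V - A) \<and>
        0 < \<sigma> \<and> 2 * real (vol E A) / real (vol E (V - A)) \<le> \<sigma> \<and> \<sigma> \<le> 1
        \<longrightarrow>
        (\<exists>t s. exec ((n + 2) ^ 20) \<lparr>adj = L, alpha = \<alpha>, sigma = \<sigma>\<rparr> lbs_code (input_state n xs) t s \<and>
          (\<alpha> > 0 \<longrightarrow>
             real t \<le> time_factor * log 2 (real n + 2) ^ 1 *
                       (real (Max {1, card A, vol E A}) / (\<alpha> * \<sigma>\<^sup>2))) \<and>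
          lbs_answer (?c_size \<sigma>) (?c_con \<sigma>) V E A \<sigma> \<alpha> (result s) \<and>
          (result s = None \<longrightarrow>
             \<not> (\<exists>S. sparse_cut V E (\<alpha> / ?c_con \<sigma>) S \<and> overlapping E A \<sigma> S)))"
  proof (intro allI impI, elim conjE)
    fix n V E L A xs and \<sigma> \<alpha> :: real
    assume V: "V = {..<n}" and A: "set xs = A" "A \<subseteq> V"
      and asms: "simple_graph V E" "adjacency_lists n E L" "distinct xs" "0 \<le> \<alpha>" "\<alpha> \<le> 1"
        "2 * vol E A \<le> vol E (V - A)" "0 < \<sigma>"
        "2 * real (vol E A) / real (vol E (V - A)) \<le> \<sigma>" "\<sigma> \<le> 1"
    interpret lbs_input n E L xs \<sigma> \<alpha>
      by unfold_locales (use V A asms in auto)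
    have "halts W G lbs_code (input_state n xs) (if \<alpha> = 0 then 2 else nat \<lfloor>time_factor * budget\<rfloor>)
        (\<lambda>st. answers (result st))"
      using lbs_code_zero lbs_code_positive \<alpha>(1) by auto
    then obtain t s where run: "exec W G lbs_code (input_state n xs) t s" "answers (result s)"
      and t: "t \<le> (if \<alpha> = 0 then 2 else nat \<lfloor>time_factor * budget\<rfloor>)"
      unfolding halts_def by blast
    have bound: "real t \<le> time_factor * log 2 (real n + 2) ^ 1 * (real (Max {1, card A, vol E A}) / (\<alpha> * \<sigma>\<^sup>2))"
      if "0 < \<alpha>"
    proof -
      have "0 \<le> time_factor * budget"
        using budget_bounds(1)[OF that] by (simp add: time_factor_def)
      then have "real (nat \<lfloor>time_factor * budget\<rfloor>) \<le> time_factor * budget" by (rule of_nat_floor)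
      moreover have "real t \<le> real (nat \<lfloor>time_factor * budget\<rfloor>)" using t that by simp
      ultimately show ?thesis using A by (simp add: budget_def mult.assoc)
    qed
    show "\<exists>t s. exec W G lbs_code (input_state n xs) t s \<and>
          (\<alpha> > 0 \<longrightarrow>
             real t \<le> time_factor * log 2 (real n + 2) ^ 1 *
                       (real (Max {1, card A, vol E A}) / (\<alpha> * \<sigma>\<^sup>2))) \<and>
          lbs_answer (?c_size \<sigma>) (?c_con \<sigma>) V E A \<sigma> \<alpha> (result s) \<and>
          (result s = None \<longrightarrow>
             \<not> (\<exists>S. sparse_cut V E (\<alpha> / ?c_con \<sigma>) S \<and> overlapping E A \<sigma> S))"
      unfolding V A(1)[symmetric] using run[unfolded answers_def no_cut_def] bound[folded A(1)]
      by (intro exI[of _ t] exI[of _ s] conjI impI) simp_all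
  qed
qed

end
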